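(* Let $0\le\lambda<\frac{1}{\sum_{j\in\mathbb{Z}^d}a_j}$, let $\mu$ be the minimal stationary distribution on $\mathbb{N}_0^{\mathbb{Z}^d}$ of the interference queueing dynamics on $\mathbb{Z}^d$ with arrival intensity $\lambda$ and interference sequence $(a_j)_{j\in\mathbb{Z}^d}$ (see context), and let $\mathbf{X}=\{X_i\}_{i\in\mathbb{Z}^d}$ have law $\mu$. For any $f\in L^1(\mu)$ and any F{\o}lner sequence $\{F_r:r\in\mathbb{N}\}$ of $\mathbb{Z}^d$, $$\lim_{r\to\infty}\frac{1}{|F_r|}\sum_{i\in F_r}f\left(\mathbf{X}_{(i)}\right)=\int f(\mathbf{x})\,\mu(d\mathbf{x})$$ in $L^1$ with respect to $\mu$. In addition, the convergence of $\frac{1}{|F_r|}\sum_{i\in F_r}f\left(\mathbf{X}_{(i)}\right)$ to $\int f(\mathbf{x})\,\mu(d\mathbf{x})$ as $r\to\infty$ holds almost surely with respect to $\mu$ if $\{F_r:r\in\mathbb{N}\}$ is a tempered F{\o}lner sequence (for example, a sequence of nonempty boxes $B_r=\{k\in\mathbb{Z}^d: i^{(r)}_l\le k_l<j^{(r)}_l \text{ for all } 1\le l\le d\}$, with $i^{(r)},j^{(r)}\in\mathbb{Z}^d$, $B_r\subset B_{r+1}$ for all $r\in\mathbb{N}$ and $\bigcup_{r\in\mathbb{N}}B_r=\mathbb{Z}^d$).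
   Context: Model. Fix $d\ge1$ and a sequence $(a_i)_{i\in\mathbb{Z}^d}$ (the interference sequence) with $a_i\ge0$, $a_i=a_{-i}$ for all $i$, $a_0=1$ and $\sum_{i\in\mathbb{Z}^d}a_i<\infty$ (infinitely many $a_i$ may be nonzero). Convention: $0/0=0$. $\mathbb{N}_0=\{0,1,2,\dots\}$. Let $\{\mathcal{A}_i\}_{i\in\mathbb{Z}^d}$ be independent Poisson point processes on $\mathbb{R}$ with intensity $\lambda$, and, independently, let $\{\mathcal{D}_i\}_{i\in\mathbb{Z}^d}$ be independent Poisson point processes of unit intensity on $\mathbb{R}\times[0,1]$. There is a queue at each $i\in\mathbb{Z}^d$, with queue length $X_i(t)\in\mathbb{N}_0$ at time $t$. An arrival ($X_i$ increases by 1) occurs at queue $i$ at each epoch of $\mathcal{A}_i$. At each atom $(t,u)$ of $\mathcal{D}_i$, a departure ($X_i$ decreases by 1) occurs from queue $i$ at time $t$ if and only if $u\le \frac{X_i(t)}{\sum_{j\in\mathbb{Z}^d}a_jX_{i-j}(t)}$, with queue lengths evaluated just before $t$. Thus, given the configuration, queue $i$ has departures at rate $\frac{X_i(t)}{\sum_{j}a_jX_{i-j}(t)}$. It is known that this process is well defined path-wise from the driving processes and is monotone: with the same driving processes, coordinate-wise ordered initial configurations remain coordinate-wise ordered for all later times. Minimal stationary distribution (Coupling-From-The-Past). For $t\ge0$ and $s\ge-t$ let $X_{i;t}(s)$ be the length of queue $i$ at time $s$ when the dynamics is started at time $-t$ with all queues empty, all these processes being built from the same $(\mathcal{A}_i,\mathcal{D}_i)_{i\in\mathbb{Z}^d}$.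 By monotonicity $t\mapsto X_{i;t}(s)$ is non-decreasing almost surely; set $X_{i;\infty}(s):=\lim_{t\to\infty}X_{i;t}(s)$. It is known that if $\lambda<1/\sum_{j}a_j$, then $\{X_{i;\infty}(s)\}$ is a (finite, translation invariant) stationary solution of the dynamics, and it is minimal: any other stationary solution stochastically dominates it coordinate-wise. The minimal stationary distribution $\mu$ is the law of $\{X_{i;\infty}(s)\}_{i\in\mathbb{Z}^d}$ (for any fixed $s$) on $(\mathbb{N}_0^{\mathbb{Z}^d},\mathcal{B}(\mathbb{N}_0^{\mathbb{Z}^d}))$. Notation. For $i\in\mathbb{Z}^d$ and $\mathbf{x}\in\mathbb{N}_0^{\mathbb{Z}^d}$, $\mathbf{x}_{(i)}\in\mathbb{N}_0^{\mathbb{Z}^d}$ is defined by $(\mathbf{x}_{(i)})_l:=x_{l+i}$, $l\in\mathbb{Z}^d$. $|\cdot|$ is cardinality, $\Delta$ is symmetric difference, $\mathbf{e}_h$ is the $h$-th standard unit vector of $\mathbb{Z}^d$. A sequence $\{F_r:r\in\mathbb{N}\}$ of finite (nonempty) subsets of $\mathbb{Z}^d$ with $\bigcup_rF_r=\mathbb{Z}^d$ is a F{\o}lner sequence if $\lim_{r\to\infty}\frac{|(\theta_hF_r)\Delta F_r|}{|F_r|}=0$ for every $h\in\{1,\dots,d\}$, where $\theta_hF_r:=\{f+\mathbf{e}_h:f\in F_r\}$. It is tempered if there is $C>0$ such that for all $r\in\mathbb{N}$, $\left|\bigcup_{u<r}F_u^{-1}F_r\right|\le C|F_r|$, where $F_u^{-1}F_r=\{i-j:i\in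 F_r,j\in F_u\}$. *)

theory Defs
  imports "HOL-Probability.Probability"
begin

subsection \<open>Poisson point processes\<close>

text \<open>
  A point process on \<open>E\<close> is a random locally finite subset of \<open>E\<close>. Random sets (rather than
  random counting measures) suffice because the intensity \<open>c\<close> times Lebesgue measure is diffuse.
  The Poisson weights are written out because \<^const>\<open>poisson_pmf\<close> excludes mean 0.
\<close>

definition poisson_point_process ::
  "'w measure \<Rightarrow> 'b::euclidean_space set \<Rightarrow> real \<Rightarrow> ('w \<Rightarrow> 'b set) \<Rightarrow> bool" where
  "poisson_point_process M E c P \<longleftrightarrow>
     (\<forall>\<omega>\<in>space M. P \<omega> \<subseteq> E \<and> (\<forall>B. bounded B \<longrightarrow> finite (P \<omega> \<inter> B))) \<and>
     (\<forall>B\<in>sets borel. bounded B \<and> B \<subseteq> E \<longrightarrow>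
        (\<lambda>\<omega>. card (P \<omega> \<inter> B)) \<in> measurable M (count_space UNIV) \<and>
        (\<forall>k. measure M {\<omega>\<in>space M. card (P \<omega> \<inter> B) = k} =
              exp (- (c * measure lborel B)) * (c * measure lborel B) ^ k / fact k)) \<and>
     (\<forall>n B. (\<forall>k<n. B k \<in> sets borel \<and> bounded (B k) \<and> B k \<subseteq> E) \<and> disjoint_family_on B {..<n} \<longrightarrow>
        prob_space.indep_vars M (\<lambda>_. count_space UNIV) (\<lambda>k \<omega>. card (P \<omega> \<inter> B k)) {..<n::nat})"

text \<open>The \<open>\<sigma>\<close>-algebra generated by a point process, i.e. by its counts on bounded Borel sets.\<close>

definition point_process_events ::
  "'w measure \<Rightarrow> ('w \<Rightarrow> 'b::euclidean_space set) \<Rightarrow> 'w set set" where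
  "point_process_events M P =
     sigma_sets (space M)
       {{\<omega>\<in>space M. card (P \<omega> \<inter> B) = k} | B k. B \<in> sets borel \<and> bounded B}"

text \<open>
  Joint independence of all the arrival and departure processes is expressed by one family of
  \<open>\<sigma>\<close>-algebras indexed by the disjoint sum of two copies of the set of sites.
\<close>

definition driving_processes ::
  "'w measure \<Rightarrow> real \<Rightarrow> ('i \<Rightarrow> 'w \<Rightarrow> real set) \<Rightarrow> ('i \<Rightarrow> 'w \<Rightarrow> (real \<times> real) set) \<Rightarrow> bool" where
  "driving_processes M lam A D \<longleftrightarrow>
     prob_space M \<and>
     (\<forall>i. poisson_point_process M UNIV lam (A i)) \<and>
     (\<forall>i. poisson_point_process M (UNIV \<times> {0..1}) 1 (D i)) \<and>
     prob_space.indep_sets M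
       (case_sum (\<lambda>i. point_process_events M (A i)) (\<lambda>i. point_process_events M (D i))) UNIV"


subsection \<open>The interference queueing dynamics\<close>

definition interference_sequence :: "('i::ab_group_add \<Rightarrow> real) \<Rightarrow> bool" where
  "interference_sequence a \<longleftrightarrow>
     (\<forall>i. 0 \<le> a i) \<and> (\<forall>i. a (- i) = a i) \<and> a 0 = 1 \<and> a summable_on UNIV"

text \<open>
  In \<^typ>\<open>ennreal\<close> the sum always exists, \<open>0 / 0 = 0\<close>, and the ratio is \<open>0\<close> if the sum is infinite.
\<close>

definition departure_rate :: "('i::ab_group_add \<Rightarrow> real) \<Rightarrow> ('i \<Rightarrow> nat) \<Rightarrow> 'i \<Rightarrow> ennreal" where
  "departure_rate a x i = of_nat (x i) / (\<Sum>\<^sub>\<infinity>j. ennreal (a j) * of_nat (x (i - j)))"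

definition left_value :: "(real \<Rightarrow> 'i \<Rightarrow> nat) \<Rightarrow> real \<Rightarrow> 'i \<Rightarrow> nat" where
  "left_value X s i = Lim (at_left s) (\<lambda>r. X r i)"

text \<open>
  \<open>queue_path a Ar De s0 x X\<close>: the trajectory \<open>X\<close> starts at time \<open>s0\<close> from the configuration \<open>x\<close>
  (and is extended by \<open>x\<close> to earlier times) and follows the dynamics driven by the realisations
  \<open>Ar\<close>, \<open>De\<close> of the driving processes. Each queue length is right continuous with left limits in
  the discrete space \<^typ>\<open>nat\<close>, hence constant between its jumps. Truncated subtraction at \<open>0\<close>
  matters only for atoms with mark \<open>u = 0\<close>, and the existential quantifier differs from counting
  atoms only if a queue has two atoms at the same time; almost surely neither happens.
\<close>

definition queue_path ::
  "('i::ab_group_add \<Rightarrow> real) \<Rightarrow> ('i \<Rightarrow> real set) \<Rightarrow> ('i \<Rightarrow> (real \<times> real) set) \<Rightarrow>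
   real \<Rightarrow> ('i \<Rightarrow> nat) \<Rightarrow> (real \<Rightarrow> 'i \<Rightarrow> nat) \<Rightarrow> bool" where
  "queue_path a Ar De s0 x X \<longleftrightarrow>
     (\<forall>s\<le>s0. X s = x) \<and>
     (\<forall>s i. ((\<lambda>r. X r i) \<longlongrightarrow> X s i) (at_right s)) \<and>
     (\<forall>s i. ((\<lambda>r. X r i) \<longlongrightarrow> left_value X s i) (at_left s)) \<and>
     (\<forall>s>s0. \<forall>i. X s i =
        left_value X s i + of_bool (s \<in> Ar i)
        - of_bool (\<exists>u. (s, u) \<in> De i \<and> ennreal u \<le> departure_rate a (left_value X s) i))"

text \<open>
  Almost surely there is exactly one trajectory. As infinitely many queues interact, uniqueness can
  fail on a null set of realisations; there the least trajectory is taken, which is the increasing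
  limit of the dynamics restricted to finite sets of queues and exists for all locally finite
  \<open>Ar\<close>, \<open>De\<close>.
\<close>

definition queue_process ::
  "('i::ab_group_add \<Rightarrow> real) \<Rightarrow> ('i \<Rightarrow> real set) \<Rightarrow> ('i \<Rightarrow> (real \<times> real) set) \<Rightarrow>
   real \<Rightarrow> ('i \<Rightarrow> nat) \<Rightarrow> real \<Rightarrow> 'i \<Rightarrow> nat" where
  "queue_process a Ar De s0 x = (LEAST X. queue_path a Ar De s0 x X)"


subsection \<open>Coupling from the past and the minimal stationary distribution\<close>

definition queue_from_past ::
  "('i::ab_group_add \<Rightarrow> real) \<Rightarrow> ('i \<Rightarrow> real set) \<Rightarrow> ('i \<Rightarrow> (real \<times> real) set) \<Rightarrow>
   real \<Rightarrow> real \<Rightarrow> 'i \<Rightarrow> nat" where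
  "queue_from_past a Ar De t s i = queue_process a Ar De (- t) (\<lambda>_. 0) s i"

definition queue_from_infinite_past ::
  "('i::ab_group_add \<Rightarrow> real) \<Rightarrow> ('i \<Rightarrow> real set) \<Rightarrow> ('i \<Rightarrow> (real \<times> real) set) \<Rightarrow>
   real \<Rightarrow> 'i \<Rightarrow> nat" where
  "queue_from_infinite_past a Ar De s i = Lim at_top (\<lambda>t. queue_from_past a Ar De t s i)"

text \<open>The law of the coupling-from-the-past limit at time \<open>s\<close>; it does not depend on \<open>s\<close>.\<close>

definition minimal_stationary_distribution ::
  "'w measure \<Rightarrow> ('i::ab_group_add \<Rightarrow> real) \<Rightarrow> ('i \<Rightarrow> 'w \<Rightarrow> real set) \<Rightarrow>
   ('i \<Rightarrow> 'w \<Rightarrow> (real \<times> real) set) \<Rightarrow> real \<Rightarrow> ('i \<Rightarrow> nat) measure" where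
  "minimal_stationary_distribution M a A D s =
     distr M borel (\<lambda>\<omega>. queue_from_infinite_past a (\<lambda>i. A i \<omega>) (\<lambda>i. D i \<omega>) s)"


subsection \<open>Translations and Foelner sequences\<close>

definition translate :: "'i::ab_group_add \<Rightarrow> ('i \<Rightarrow> 'b) \<Rightarrow> 'i \<Rightarrow> 'b" where
  "translate i x = (\<lambda>l. x (l + i))"

definition spatial_average ::
  "'i::ab_group_add set \<Rightarrow> (('i \<Rightarrow> 'b) \<Rightarrow> real) \<Rightarrow> ('i \<Rightarrow> 'b) \<Rightarrow> real" where
  "spatial_average F f x = (1 / real (card F)) * (\<Sum>i\<in>F. f (translate i x))"

definition folner_sequence :: "(nat \<Rightarrow> (int ^ 'd) set) \<Rightarrow> bool" where
  "folner_sequence F \<longleftrightarrow>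
     (\<forall>r. finite (F r) \<and> F r \<noteq> {}) \<and> (\<Union>r. F r) = UNIV \<and>
     (\<forall>h. (\<lambda>r. real (card (sym_diff ((\<lambda>f. f + axis h 1) ` F r) (F r))) / real (card (F r)))
        \<longlonglongrightarrow> 0)"

definition tempered :: "(nat \<Rightarrow> (int ^ 'd) set) \<Rightarrow> bool" where
  "tempered F \<longleftrightarrow>
     (\<exists>C>0. \<forall>r. real (card (\<Union>u<r. {i - j | i j. i \<in> F r \<and> j \<in> F u})) \<le> C * real (card (F r)))"

definition exhausting_boxes :: "(nat \<Rightarrow> (int ^ 'd) set) \<Rightarrow> bool" where
  "exhausting_boxes B \<longleftrightarrow>
     (\<exists>lo hi :: nat \<Rightarrow> int ^ 'd. \<forall>r. B r = {k. \<forall>l. lo r $ l \<le> k $ l \<and> k $ l < hi r $ l}) \<and>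
     (\<forall>r. B r \<noteq> {}) \<and> (\<forall>r. B r \<subseteq> B (Suc r)) \<and> (\<Union>r. B r) = UNIV"

end

theory Submission
  imports Defs
begin

text \<open>
  The least trajectory of the queues is a translation equivariant measurable function of the driving
  processes, and so is its limit from the infinite past. This includes the arbitrary value of
  \<^const>\<open>Lim\<close> at queues where the limit does not exist, which is the same at every site, so the
  finiteness of the stationary queues is not an issue. Hence the minimal stationary distribution is a factor
  of a product measure on which the lattice acts by relabelling the coordinates. Averages of
  cylinder sets converge in \<open>L\<^sup>2\<close> because distant cylinders are independent, and an approximation
  argument gives the mean ergodic theorem for all of \<open>L\<^sup>1\<close>.

  For almost sure convergence, write
  \<open>f - \<integral> f = (f - b) + (b - A\<^sub>m b) + (A\<^sub>m b - \<integral> b) + (\<integral> b - \<integral> f)\<close> with \<open>b\<close> bounded and close to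
  \<open>f\<close> in \<open>L\<^sup>1\<close>, where \<open>A\<^sub>m\<close> averages over \<open>F m\<close>. The averages of the second term vanish uniformly, since
  it is a sum of bounded coboundaries; the first and third terms are small in \<open>L\<^sup>1\<close>, so a weak type
  \<open>(1, 1)\<close> maximal inequality for tempered sequences controls the supremum of their averages.
\<close>

section \<open>A covering inequality for tempered sequences\<close>

text \<open>The law is a push-forward under a map that is given only implicitly:
  \<open>queue_process\<close> is the least among the trajectories of infinitely many interacting
  queues, so its existence, measurability and equivariance all have to be earned. One description
  yields all three. Each queue has finitely many events in bounded time, so its value is the update
  at its last event; trajectories become fixed points of a monotone operator, and iterating from
  zero reaches the least one in countably many steps. The limit passes through the infinite
  interference sums by monotone convergence, and through the acceptance test for departures because
  the rates approach their limit from above once the queue itself has settled. The obstacle to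
  measurability is quantification over uncountably many times. It is removed by letting the
  quantifiers range over the points of random locally finite sets, whose counts are
  measurable.\<close>

text \<open>
  A deterministic version of Lindenstrauss's random covering: treating the levels \<open>u c\<close> from the
  largest downwards, a centre \<open>c\<close> is selected, with the fractional weight \<open>1 / card (F (u c))\<close>, iff
  the weight of the larger levels is below \<open>1\<close> on its whole translate. A rejected centre therefore
  meets translates of larger levels of total weight at least \<open>1\<close>.
\<close>

lemma fractional_covering:
  fixes F :: "nat \<Rightarrow> 'g::ab_group_add set" and H :: "'g set" and u :: "'g \<Rightarrow> nat"
  assumes fin: "\<And>r. finite (F r)" "\<And>r. F r \<noteq> {}" and finH: "finite H"
  shows "\<exists>S\<subseteq>{c\<in>H. m \<le> u c}.
     (\<forall>x. (\<Sum>c\<in>S. of_bool (x - c \<in> F (u c)) / real (card (F (u c)))) \<le> 2) \<and>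
     (\<forall>c\<in>H - S. m \<le> u c \<longrightarrow>
        1 \<le> (\<Sum>b\<in>{b\<in>S. u c < u b \<and> (\<exists>x. x - c \<in> F (u c) \<and> x - b \<in> F (u b))}. 1 / real (card (F (u b)))))"
proof -
  obtain N where N: "\<And>c. c \<in> H \<Longrightarrow> u c < N"
    using finH by (metis finite_imageI finite_nat_set_iff_bounded imageI)
  show ?thesis
  proof (cases "m \<le> N")
    case False
    then have "{c\<in>H. m \<le> u c} = {}" using N by fastforce
    then show ?thesis by (intro exI[of _ "{}"]) auto
  next
    case True
    then show ?thesis
    \<comment> \<open>Levels are treated from above: \<open>N\<close> exceeds all values of
      \<open>u\<close> on \<open>H\<close>, so at level \<open>N\<close> there is nothing to select,
      and each step adds centres of one lower level.\<close>
    proof (induction m rule: inc_induct)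
      case base
      have "{c\<in>H. N \<le> u c} = {}" using N by fastforce
      then show ?case by (intro exI[of _ "{}"]) auto
    next
      case (step m)
      define w where "w c = 1 / real (card (F (u c)))" for c
      define P where "P S x = (\<Sum>c\<in>S. of_bool (x - c \<in> F (u c)) / real (card (F (u c))))" for S x
      define meet where "meet c b \<longleftrightarrow> (\<exists>x. x - c \<in> F (u c) \<and> x - b \<in> F (u b))" for c b
      from step.IH obtain S where S: "S \<subseteq> {c\<in>H. Suc m \<le> u c}" "\<And>x. P S x \<le> 2"
        "\<And>c. c \<in> H - S \<Longrightarrow> Suc m \<le> u c \<Longrightarrow> 1 \<le> sum w {b\<in>S. u c < u b \<and> meet c b}"
        unfolding P_def w_def meet_def by blast
      define A where "A = {c\<in>H. u c = m \<and> (\<forall>x. x - c \<in> F m \<longrightarrow> P S x < 1)}"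
      have fS: "finite S" "finite A" using S(1) finH unfolding A_def by (auto intro: finite_subset)
      have disj: "S \<inter> A = {}" using S(1) unfolding A_def by auto
      have wpos: "0 \<le> w c" for c by (simp add: w_def)
      \<comment> \<open>All centres in \<open>A\<close> have level \<open>m\<close>, and those whose
        translate contains \<open>x\<close> are of the form \<open>x - f\<close> with
        \<open>f\<close> in \<open>F m\<close>: at most \<open>card (F m)\<close> of them, each of
        weight \<open>1 / card (F m)\<close>.\<close>
      have PA: "P A x \<le> 1" for x
      proof -
        have "P A x = (\<Sum>c\<in>{c\<in>A. x - c \<in> F m}. 1 / real (card (F m)))"
          unfolding P_def using fS by (intro sum.mono_neutral_cong_right) (auto simp: A_def)
        also have "\<dots> = real (card {c\<in>A. x - c \<in> F m}) / real (card (F m))" by simp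
        also have "card {c\<in>A. x - c \<in> F m} \<le> card (F m)"
          by (rule card_inj_on_le[where f="\<lambda>c. x - c"]) (auto simp: inj_on_def fin)
        then have "real (card {c\<in>A. x - c \<in> F m}) / real (card (F m)) \<le> 1"
          by (simp add: divide_le_eq_1 fin card_gt_0_iff)
        finally show ?thesis .
      qed
      \<comment> \<open>New weight falls only on translates where the old weight is below
        \<open>1\<close>, and at most \<open>1\<close> is added there; this is the origin of the
        bound \<open>2\<close>.\<close>
      have P2: "P (S \<union> A) x \<le> 2" for x
      proof -
        have eq: "P (S \<union> A) x = P S x + P A x"
          unfolding P_def using fS disj by (intro sum.union_disjoint)
        show ?thesis
        proof (cases "\<exists>c\<in>A. x - c \<in> F m")
          case True
          then have "P S x < 1" unfolding A_def by auto
          then show ?thesis using eq PA[of x] by linarith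
        next
          case False
          then have "P A x = 0" unfolding P_def by (intro sum.neutral) (auto simp: A_def)
          then show ?thesis using eq S(2)[of x] by linarith
        qed
      qed
      have killed: "1 \<le> sum w {b\<in>S \<union> A. u c < u b \<and> meet c b}" if c: "c \<in> H - (S \<union> A)" "m \<le> u c" for c
      proof (cases "u c = m")
        case False
        then have "1 \<le> sum w {b\<in>S. u c < u b \<and> meet c b}" using c by (intro S(3)) auto
        also have "\<dots> \<le> sum w {b\<in>S \<union> A. u c < u b \<and> meet c b}"
          using fS wpos by (intro sum_mono2) auto
        finally show ?thesis .
      next
        case True
        \<comment> \<open>Rejection means that some point \<open>x\<close> of the translate already
          carries weight at least \<open>1\<close>; the centres producing that weight all meet the
          translate at \<open>x\<close>.\<close>
        then obtain x where x: "x - c \<in> F m" "P S x \<ge> 1" using c unfolding A_def by (auto simp: not_less)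
        note x(2)
        also have "P S x = sum w {b\<in>S. x - b \<in> F (u b)}"
          unfolding P_def w_def using fS by (intro sum.mono_neutral_cong_right) auto
        also have "\<dots> \<le> sum w {b\<in>S \<union> A. u c < u b \<and> meet c b}"
        proof (intro sum_mono2)
          show "{b \<in> S. x - b \<in> F (u b)} \<subseteq> {b \<in> S \<union> A. u c < u b \<and> meet c b}"
            using S(1) x(1) True unfolding meet_def by auto
        qed (use fS wpos in auto)
        finally show ?thesis .
      qed
      have sub: "S \<union> A \<subseteq> {c\<in>H. m \<le> u c}" using S(1) unfolding A_def by auto
      from sub P2 killed show ?case unfolding P_def w_def meet_def by blast
    qed
  qed
qed

text \<open>Each rejected centre is charged to the selected translates it meets. By temperedness a
  selected \<open>b\<close> is met by at most \<open>C * card (F (u b))\<close> rejected centres of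
  smaller level, each charging \<open>1 / card (F (u b))\<close>, so \<open>b\<close> receives at
  most \<open>C\<close>; hence \<open>card H\<close> is at most \<open>(C + 1) * card S\<close>.
  Each selected centre accounts for \<open>\<alpha>\<close>, and their weights overlap at most
  \<open>2\<close>-fold.\<close>

lemma covering_inequality:
  fixes F :: "nat \<Rightarrow> 'g::ab_group_add set" and H K :: "'g set" and u :: "'g \<Rightarrow> nat"
    and g :: "'g \<Rightarrow> real"
  assumes fin: "\<And>r. finite (F r)" "\<And>r. F r \<noteq> {}" and finH: "finite H" and finK: "finite K"
    and C: "\<And>r. real (card (\<Union>v<r. {i - j | i j. i \<in> F r \<and> j \<in> F v})) \<le> C * real (card (F r))"
    and g: "\<And>k. 0 \<le> g k"
    and large: "\<And>c. c \<in> H \<Longrightarrow> \<alpha> * real (card (F (u c))) \<le> (\<Sum>k\<in>F (u c). g (k + c))"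
    and K: "\<And>c k. c \<in> H \<Longrightarrow> k \<in> F (u c) \<Longrightarrow> k + c \<in> K"
    and "0 \<le> \<alpha>"
  shows "\<alpha> * real (card H) \<le> 2 * (C + 1) * (\<Sum>k\<in>K. g k)"
proof -
  define w where "w c = 1 / real (card (F (u c)))" for c
  define meet where "meet c b \<longleftrightarrow> (\<exists>x. x - c \<in> F (u c) \<and> x - b \<in> F (u b))" for c b
  obtain S where S: "S \<subseteq> H" and P2: "\<And>x. (\<Sum>c\<in>S. of_bool (x - c \<in> F (u c)) * w c) \<le> 2"
    and kill: "\<And>c. c \<in> H - S \<Longrightarrow> 1 \<le> sum w {b\<in>S. u c < u b \<and> meet c b}"
    using fractional_covering[where F=F and u=u and m=0, OF fin finH]
    unfolding w_def meet_def by auto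
  have fS: "finite S" using S finH by (rule finite_subset)
  have cpos: "real (card (F r)) > 0" for r using fin by (simp add: card_gt_0_iff)
  have wpos: "0 \<le> w c" for c by (simp add: w_def)
  have "0 \<le> C * real (card (F 0))" using C[of 0] by simp
  then have C0: "0 \<le> C" using cpos[of 0] by (simp add: zero_le_mult_iff)
  \<comment> \<open>For a common point \<open>x\<close> of the two translates,
    \<open>c - b = (x - b) - (x - c)\<close> is an element of \<open>F (u b)\<close> minus one of
    the earlier set \<open>F (u c)\<close>; temperedness counts exactly such differences.\<close>
  have cnt: "real (card {c\<in>H - S. u c < u b \<and> meet c b}) \<le> C * real (card (F (u b)))" for b
  proof -
    have "card {c\<in>H - S. u c < u b \<and> meet c b} \<le> card (\<Union>v<u b. {i - j | i j. i \<in> F (u b) \<and> j \<in> F v})"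
    proof (rule card_inj_on_le[where f="\<lambda>c. c - b"])
      show "(\<lambda>c. c - b) ` {c \<in> H - S. u c < u b \<and> meet c b}
        \<subseteq> (\<Union>v<u b. {i - j |i j. i \<in> F (u b) \<and> j \<in> F v})"
      proof clarsimp
        fix c assume "u c < u b" "meet c b"
        then obtain x where "x - c \<in> F (u c)" "x - b \<in> F (u b)" unfolding meet_def by auto
        with \<open>u c < u b\<close> show "\<exists>v\<in>{..<u b}. \<exists>i j. c - b = i - j \<and> i \<in> F (u b) \<and> j \<in> F v"
          by (intro bexI[of _ "u c"] exI[of _ "x - b"] exI[of _ "x - c"]) auto
      qed
      have "{i - j |i j. i \<in> F (u b) \<and> j \<in> F v} = (\<lambda>(i, j). i - j) ` (F (u b) \<times> F v)" for v by auto
      then show "finite (\<Union>v<u b. {i - j |i j. i \<in> F (u b) \<and> j \<in> F v})" by (simp add: fin)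
    qed (auto simp: inj_on_def)
    then show ?thesis using C[of "u b"] by linarith
  qed
  have "real (card (H - S)) = (\<Sum>c\<in>H - S. 1)" by simp
  also have "\<dots> \<le> (\<Sum>c\<in>H - S. sum w {b\<in>S. u c < u b \<and> meet c b})" by (intro sum_mono kill)
  also have "\<dots> = (\<Sum>b\<in>S. \<Sum>c\<in>{c\<in>H - S. u c < u b \<and> meet c b}. w b)"
    using finH fS by (subst sum.swap_restrict) auto
  also have "\<dots> = (\<Sum>b\<in>S. w b * real (card {c\<in>H - S. u c < u b \<and> meet c b}))"
    by (simp add: mult.commute)
  also have "\<dots> \<le> (\<Sum>b\<in>S. C)"
  proof (intro sum_mono)
    fix b
    have "w b * real (card {c\<in>H - S. u c < u b \<and> meet c b}) \<le> w b * (C * real (card (F (u b))))"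
      by (intro mult_left_mono cnt wpos)
    also have "\<dots> = C" using cpos[of "u b"] by (simp add: w_def)
    finally show "w b * real (card {c\<in>H - S. u c < u b \<and> meet c b}) \<le> C" .
  qed
  finally have "real (card (H - S)) \<le> C * real (card S)" by (simp add: mult.commute)
  moreover have "real (card H) = real (card (H - S)) + real (card S)"
    using S finH fS by (simp add: card_Diff_subset card_mono of_nat_diff)
  ultimately have cH: "real (card H) \<le> (C + 1) * real (card S)" by (simp add: algebra_simps)
  \<comment> \<open>Weight times cardinality is \<open>1\<close>, so each selected centre stands for
    a full \<open>\<alpha>\<close>; exchanging the sums leaves the total weight at each point, which
    is at most \<open>2\<close>.\<close>
  have "\<alpha> * real (card S) = (\<Sum>c\<in>S. w c * (\<alpha> * real (card (F (u c)))))"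
    using cpos by (simp add: w_def mult.commute less_imp_neq[THEN not_sym])
  also have "\<dots> \<le> (\<Sum>c\<in>S. w c * (\<Sum>k\<in>F (u c). g (k + c)))"
    using S by (intro sum_mono mult_left_mono large wpos) auto
  also have "\<dots> = (\<Sum>c\<in>S. \<Sum>x\<in>K. (of_bool (x - c \<in> F (u c)) * w c) * g x)"
  proof (intro sum.cong refl)
    fix c assume c: "c \<in> S"
    have "(\<Sum>k\<in>F (u c). g (k + c)) = (\<Sum>x\<in>{x\<in>K. x - c \<in> F (u c)}. g x)"
      using c S K by (intro sum.reindex_bij_witness[of _ "\<lambda>x. x - c" "\<lambda>k. k + c"]) auto
    also have "\<dots> = (\<Sum>x\<in>K. of_bool (x - c \<in> F (u c)) * g x)"
      using finK by (intro sum.mono_neutral_cong_left) auto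
    finally show "w c * (\<Sum>k\<in>F (u c). g (k + c)) = (\<Sum>x\<in>K. (of_bool (x - c \<in> F (u c)) * w c) * g x)"
      by (simp add: sum_distrib_left mult_ac)
  qed
  also have "\<dots> = (\<Sum>x\<in>K. (\<Sum>c\<in>S. of_bool (x - c \<in> F (u c)) * w c) * g x)"
    by (subst sum.swap) (simp add: sum_distrib_right)
  also have "\<dots> \<le> (\<Sum>x\<in>K. 2 * g x)" by (intro sum_mono mult_right_mono P2 g)
  finally have "\<alpha> * real (card S) \<le> 2 * (\<Sum>x\<in>K. g x)" by (simp add: sum_distrib_left)
  then have "(C + 1) * (\<alpha> * real (card S)) \<le> (C + 1) * (2 * (\<Sum>x\<in>K. g x))"
    using C0 by (intro mult_left_mono) auto
  moreover have "\<alpha> * real (card H) \<le> \<alpha> * ((C + 1) * real (card S))"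
    using cH \<open>0 \<le> \<alpha>\<close> by (rule mult_left_mono)
  ultimately show ?thesis by (simp add: algebra_simps)
qed

section \<open>Foelner sequences in the integer lattice\<close>

lemma folner_sequenceD:
  assumes "folner_sequence F"
  shows "finite (F r)" "F r \<noteq> {}" "(\<Union>r. F r) = UNIV"
    "(\<lambda>r. real (card (sym_diff ((\<lambda>f. f + axis h 1) ` F r) (F r))) / real (card (F r))) \<longlonglongrightarrow> 0"
  using assms unfolding folner_sequence_def by auto

lemma card_sym_diff_triangle:
  assumes "finite A" "finite B" "finite C"
  shows "card (sym_diff A C) \<le> card (sym_diff A B) + card (sym_diff B C)"
proof -
  have "card (sym_diff A C) \<le> card (sym_diff A B \<union> sym_diff B C)"
    using assms by (intro card_mono) auto
  also have "\<dots> \<le> card (sym_diff A B) + card (sym_diff B C)" by (rule card_Un_le)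
  finally show ?thesis .
qed

lemma card_sym_diff_image:
  assumes "inj f" shows "card (sym_diff (f ` A) (f ` B)) = card (sym_diff A B)"
proof -
  have "sym_diff (f ` A) (f ` B) = f ` sym_diff A B"
    using assms by (auto simp: inj_image_mem_iff dest: injD)
  then show ?thesis using assms by (simp add: card_image inj_on_def)
qed

text \<open>Unit vectors generate the lattice as a group. The rule extends the Foelner condition,
  which is stated for unit vectors only, to all translations.\<close>

lemma int_vec_induct [case_names zero axis minus add]:
  fixes k :: "int ^ 'd"
  assumes "P 0" "\<And>h. P (axis h 1)" "\<And>k. P k \<Longrightarrow> P (- k)"
    "\<And>k l. P k \<Longrightarrow> P l \<Longrightarrow> P (k + l)"
  shows "P k"
proof -
  have ax: "P (axis h n)" for h n
  proof (induction n rule: int_induct[where k=0])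
    case base
    have "axis h 0 = (0 :: int ^ 'd)" by (simp add: vec_eq_iff axis_def)
    then show ?case using assms(1) by metis
  next
    case (step1 i)
    have "axis h (i + 1) = (axis h i + axis h 1 :: int ^ 'd)" by (simp add: vec_eq_iff axis_def)
    then show ?case using assms(2,4) step1 by simp
  next
    case (step2 i)
    have "axis h (i - 1) = (axis h i + - axis h 1 :: int ^ 'd)" by (simp add: vec_eq_iff axis_def)
    then show ?case using assms(2,3,4) step2 by metis
  qed
  have "P (\<Sum>h\<in>I. axis h (k $ h))" if "finite I" for I
    using that by (induction I rule: finite_induct) (use ax assms(1,4) in auto)
  from this[of UNIV] have "P (\<Sum>h\<in>UNIV. axis h (k $ h))" by simp
  also have "(\<Sum>h\<in>UNIV. axis h (k $ h)) = k"
    by (simp add: vec_eq_iff axis_def sum.delta cong: if_cong)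
  finally show ?thesis .
qed

text \<open>Translations preserve the size of symmetric differences, so the boundary for
  \<open>- k\<close> is as large as that for \<open>k\<close>, and the one for \<open>k + l\<close>
  is at most the sum of those for \<open>k\<close> and \<open>l\<close>.\<close>

lemma folner_translate:
  assumes "folner_sequence F"
  shows "(\<lambda>r. real (card (sym_diff ((\<lambda>f. f + k) ` F r) (F r))) / real (card (F r))) \<longlonglongrightarrow> 0"
proof (induction k rule: int_vec_induct)
  case zero then show ?case by simp
next
  case (axis h) then show ?case by (rule folner_sequenceD(4)[OF assms])
next
  case (minus k)
  have "card (sym_diff ((\<lambda>f. f + - k) ` F r) (F r)) = card (sym_diff ((\<lambda>f. f + k) ` F r) (F r))" for r
    using card_sym_diff_image[of "\<lambda>f. f + k" "(\<lambda>f. f + - k) ` F r" "F r"]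
    by (simp add: image_image inj_def Un_commute)
  then show ?case using minus by simp
next
  case (add k l)
  show ?case
  proof (rule tendsto_sandwich[OF _ _ tendsto_const tendsto_add_zero[OF add]])
    show "\<forall>\<^sub>F r in sequentially.
      real (card (sym_diff ((\<lambda>f. f + (k + l)) ` F r) (F r))) / real (card (F r))
      \<le> real (card (sym_diff ((\<lambda>f. f + k) ` F r) (F r))) / real (card (F r)) +
         real (card (sym_diff ((\<lambda>f. f + l) ` F r) (F r))) / real (card (F r))"
    proof (intro always_eventually allI)
      fix r
      have "card (sym_diff ((\<lambda>f. f + (k + l)) ` F r) (F r)) \<le>
        card (sym_diff ((\<lambda>f. f + (k + l)) ` F r) ((\<lambda>f. f + l) ` F r)) + card (sym_diff ((\<lambda>f. f + l) ` F r) (F r))"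
        using folner_sequenceD(1)[OF assms] by (intro card_sym_diff_triangle) auto
      also have "card (sym_diff ((\<lambda>f. f + (k + l)) ` F r) ((\<lambda>f. f + l) ` F r)) =
         card (sym_diff ((\<lambda>f. f + k) ` F r) (F r))"
        using card_sym_diff_image[of "\<lambda>f. f + l" "(\<lambda>f. f + k) ` F r" "F r"]
        by (simp add: image_image inj_def add.assoc)
      finally show "real (card (sym_diff ((\<lambda>f. f + (k + l)) ` F r) (F r))) / real (card (F r))
      \<le> real (card (sym_diff ((\<lambda>f. f + k) ` F r) (F r))) / real (card (F r)) +
         real (card (sym_diff ((\<lambda>f. f + l) ` F r) (F r))) / real (card (F r))"
        unfolding add_divide_distrib[symmetric] of_nat_add[symmetric]
        by (intro divide_right_mono of_nat_mono) auto
    qed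
  qed auto
qed

text \<open>A nonempty finite set is never invariant under a unit translation, because the
  translation adds its cardinality to a coordinate of the sum of its elements. So the symmetric
  difference has at least one element, and the Foelner ratio dominates
  \<open>1 / card (F r)\<close>.\<close>

lemma folner_card_at_top:
  fixes F :: "nat \<Rightarrow> (int ^ 'd) set"
  assumes "folner_sequence F"
  shows "(\<lambda>r. 1 / real (card (F r))) \<longlonglongrightarrow> 0"
proof -
  note F = folner_sequenceD[OF assms]
  obtain h :: 'd where True by simp
  let ?e = "axis h (1 :: int) :: int ^ 'd"
  have ne: "1 \<le> card (sym_diff ((\<lambda>f. f + ?e) ` F r) (F r))" for r
  proof (rule ccontr)
    assume "\<not> ?thesis"
    then have "sym_diff ((\<lambda>f. f + ?e) ` F r) (F r) = {}" using F(1) by (simp add: not_le)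
    then have "(\<lambda>f. f + ?e) ` F r = F r" by auto
    then have "\<Sum> (F r) = \<Sum> ((\<lambda>f. f + ?e) ` F r)" by simp
    also have "\<dots> = \<Sum> (F r) + of_nat (card (F r)) * ?e"
      by (subst sum.reindex) (auto simp: inj_on_def sum.distrib)
    finally have "(of_nat (card (F r)) * ?e) $ h = 0" by simp
    moreover have "(of_nat n :: int ^ 'd) $ h = int n" for n by (induction n) auto
    ultimately show False using F(1,2)[of r] by (simp add: axis_def)
  qed
  show ?thesis
  proof (rule tendsto_sandwich[OF _ _ tendsto_const F(4)[of h]])
    show "\<forall>\<^sub>F r in sequentially. 1 / real (card (F r)) \<le>
       real (card (sym_diff ((\<lambda>f. f + ?e) ` F r) (F r))) / real (card (F r))"
      using ne by (intro always_eventually allI divide_right_mono) (simp_all add: of_nat_le_iff[of 1, simplified])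
  qed auto
qed

text \<open>Outside \<open>F r\<close> the thickened set consists of boundary points for the
  finitely many shifts in \<open>K\<close>, whose total proportion tends to \<open>0\<close>. This
  serves the transference argument, where an orbit window must not grow much; \<open>2\<close> is a
  convenient factor above \<open>1\<close>.\<close>

lemma folner_thickening:
  fixes F :: "nat \<Rightarrow> (int ^ 'd) set"
  assumes "folner_sequence F" "finite K"
  shows "eventually (\<lambda>r. real (card {k + c | k c. k \<in> K \<and> c \<in> F r}) \<le> 2 * real (card (F r))) sequentially"
proof -
  note F = folner_sequenceD[OF assms(1)]
  have "(\<lambda>r. \<Sum>k\<in>K. real (card (sym_diff ((\<lambda>f. f + k) ` F r) (F r))) / real (card (F r))) \<longlonglongrightarrow> (\<Sum>k\<in>K. 0)"
    by (intro tendsto_sum folner_translate assms)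
  then have "eventually (\<lambda>r. (\<Sum>k\<in>K. real (card (sym_diff ((\<lambda>f. f + k) ` F r) (F r))) / real (card (F r))) < 1) sequentially"
    by (rule order_tendstoD) simp
  then show ?thesis
  proof eventually_elim
    case (elim r)
    have pos: "real (card (F r)) > 0" using F by (simp add: card_gt_0_iff)
    have "{k + c | k c. k \<in> K \<and> c \<in> F r} \<subseteq> F r \<union> (\<Union>k\<in>K. sym_diff ((\<lambda>f. f + k) ` F r) (F r))"
      by (auto simp: add.commute)
    then have "card {k + c | k c. k \<in> K \<and> c \<in> F r} \<le> card (F r \<union> (\<Union>k\<in>K. sym_diff ((\<lambda>f. f + k) ` F r) (F r)))"
      using F(1) assms(2) by (intro card_mono) auto
    also have "\<dots> \<le> card (F r) + card (\<Union>k\<in>K. sym_diff ((\<lambda>f. f + k) ` F r) (F r))" by (rule card_Un_le)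
    also have "card (\<Union>k\<in>K. sym_diff ((\<lambda>f. f + k) ` F r) (F r)) \<le> (\<Sum>k\<in>K. card (sym_diff ((\<lambda>f. f + k) ` F r) (F r)))"
      by (rule card_UN_le[OF assms(2)])
    finally have "real (card {k + c | k c. k \<in> K \<and> c \<in> F r}) \<le>
       real (card (F r)) + (\<Sum>k\<in>K. real (card (sym_diff ((\<lambda>f. f + k) ` F r) (F r))))"
      unfolding of_nat_add[symmetric] of_nat_sum[symmetric] of_nat_le_iff by linarith
    also have "(\<Sum>k\<in>K. real (card (sym_diff ((\<lambda>f. f + k) ` F r) (F r)))) \<le> real (card (F r))"
      using elim pos by (simp flip: sum_divide_distrib)
    finally show ?case by simp
  qed
qed

section \<open>Boxes in the integer lattice\<close>

definition int_box :: "int ^ 'd \<Rightarrow> int ^ 'd \<Rightarrow> (int ^ 'd) set" where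
  "int_box lo hi = {k. \<forall>l. lo $ l \<le> k $ l \<and> k $ l < hi $ l}"

lemma int_box_eq_image: "int_box lo hi = vec_lambda ` PiE UNIV (\<lambda>l. {lo $ l..<hi $ l})"
proof (intro set_eqI iffI)
  fix k assume "k \<in> int_box lo hi"
  then show "k \<in> vec_lambda ` PiE UNIV (\<lambda>l. {lo $ l..<hi $ l})"
    by (intro image_eqI[of _ _ "($) k"]) (auto simp: int_box_def)
qed (auto simp: int_box_def)

lemma finite_int_box: "finite (int_box lo hi)"
  unfolding int_box_eq_image by (intro finite_imageI finite_PiE) auto

lemma card_int_box: "card (int_box lo hi) = (\<Prod>l\<in>UNIV. nat (hi $ l - lo $ l))"
proof -
  have "inj_on vec_lambda (PiE UNIV (\<lambda>l. {lo $ l..<hi $ l}))"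
    by (rule inj_on_subset[OF _ subset_UNIV]) (auto simp: inj_def fun_eq_iff vec_lambda_inject)
  then show ?thesis unfolding int_box_eq_image by (simp add: card_image card_PiE)
qed

text \<open>A unit shift in direction \<open>h\<close> changes the box only in two layers orthogonal
  to \<open>h\<close>, each of size the product of the other side lengths. Multiplying by the side
  length in direction \<open>h\<close> avoids division.\<close>

lemma card_sym_diff_int_box:
  fixes lo hi :: "int ^ 'd"
  assumes "int_box lo hi \<noteq> {}"
  shows "card (sym_diff ((\<lambda>k. k + axis h 1) ` int_box lo hi) (int_box lo hi)) * nat (hi $ h - lo $ h)
    \<le> 2 * card (int_box lo hi)"
proof -
  \<comment> \<open>The two layers: \<open>int_box lo hi1\<close> is the bottom layer at height
    \<open>lo $ h\<close>, which is lost, and \<open>int_box lo' hi2\<close> the layer at height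
    \<open>hi $ h\<close>, which is gained.\<close>
  define lo' :: "int ^ 'd" where "lo' = (\<chi> l. if l = h then hi $ h else lo $ l)"
  define hi1 :: "int ^ 'd" where "hi1 = (\<chi> l. if l = h then lo $ h + 1 else hi $ l)"
  define hi2 :: "int ^ 'd" where "hi2 = (\<chi> l. if l = h then hi $ h + 1 else hi $ l)"
  have "sym_diff ((\<lambda>k. k + axis h 1) ` int_box lo hi) (int_box lo hi) \<subseteq> int_box lo hi1 \<union> int_box lo' hi2"
  proof
    fix x assume x: "x \<in> sym_diff ((\<lambda>k. k + axis h 1) ` int_box lo hi) (int_box lo hi)"
    have im: "x \<in> (\<lambda>k. k + axis h 1) ` int_box lo hi \<longleftrightarrow> x - axis h 1 \<in> int_box lo hi"
      by (auto intro: image_eqI[of _ _ "x - axis h 1"])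
    show "x \<in> int_box lo hi1 \<union> int_box lo' hi2"
    proof (cases "x \<in> int_box lo hi")
      case True
      then have "x - axis h 1 \<notin> int_box lo hi" using x im by auto
      then obtain l where l: "\<not> (lo $ l \<le> (x - axis h 1) $ l \<and> (x - axis h 1) $ l < hi $ l)"
        unfolding int_box_def by auto
      have "l = h" "x $ h = lo $ h" using l True unfolding int_box_def
        by (auto simp: axis_def split: if_splits) (smt (verit))+
      then show ?thesis using True by (auto simp: int_box_def hi1_def)
    next
      case False
      then have y: "x - axis h 1 \<in> int_box lo hi" using x im by auto
      then have y': "lo $ l \<le> x $ l - (if l = h then 1 else 0) \<and> x $ l - (if l = h then 1 else 0) < hi $ l" for l
        by (auto simp: int_box_def axis_def)
      from False obtain l where l: "\<not> (lo $ l \<le> x $ l \<and> x $ l < hi $ l)"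
        unfolding int_box_def by auto
      have "l = h" using l y'[of l] by (auto split: if_splits)
      then have h: "x $ h = hi $ h" using l y'[of l] by auto
      have "x \<in> int_box lo' hi2" unfolding int_box_def
      proof (intro CollectI allI)
        fix l show "lo' $ l \<le> x $ l \<and> x $ l < hi2 $ l"
          using y'[of l] h by (auto simp: lo'_def hi2_def)
      qed
      then show ?thesis by simp
    qed
  qed
  then have "card (sym_diff ((\<lambda>k. k + axis h 1) ` int_box lo hi) (int_box lo hi))
      \<le> card (int_box lo hi1 \<union> int_box lo' hi2)"
    by (intro card_mono) (auto simp: finite_int_box)
  also have "\<dots> \<le> card (int_box lo hi1) + card (int_box lo' hi2)" by (rule card_Un_le)
  also have "card (int_box lo hi1) = (\<Prod>l\<in>UNIV - {h}. nat (hi $ l - lo $ l))"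
    by (subst card_int_box, subst prod.remove[of _ h]) (auto simp: hi1_def)
  also have "card (int_box lo' hi2) = (\<Prod>l\<in>UNIV - {h}. nat (hi $ l - lo $ l))"
    by (subst card_int_box, subst prod.remove[of _ h]) (auto simp: hi2_def lo'_def)
  finally have "card (sym_diff ((\<lambda>k. k + axis h 1) ` int_box lo hi) (int_box lo hi)) * nat (hi $ h - lo $ h) \<le>
    2 * (\<Prod>l\<in>UNIV - {h}. nat (hi $ l - lo $ l)) * nat (hi $ h - lo $ h)"
    by (intro mult_right_mono) auto
  also have "\<dots> = 2 * card (int_box lo hi)"
    by (subst card_int_box, subst (2) prod.remove[of _ h]) auto
  finally show ?thesis .
qed

lemma exhausting_boxesD:
  assumes "exhausting_boxes B"
  shows "\<exists>lo hi. \<forall>r. B r = int_box (lo r) (hi r)" "B r \<noteq> {}" "r \<le> s \<Longrightarrow> B r \<subseteq> B s" "(\<Union>r. B r) = UNIV"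
  using assms lift_Suc_mono_le[of B r s] unfolding exhausting_boxes_def int_box_def by simp_all

text \<open>Boxes that eventually contain \<open>0\<close> and \<open>axis h N\<close> have side
  length above \<open>N\<close> in direction \<open>h\<close>, so all sides grow without bound, and
  the Foelner ratio is at most twice the inverse of the side length.\<close>

lemma exhausting_boxes_imp_folner_sequence:
  fixes B :: "nat \<Rightarrow> (int ^ 'd) set"
  assumes "exhausting_boxes B"
  shows "folner_sequence B"
proof -
  obtain lo hi where B1: "\<And>r. B r = int_box (lo r) (hi r)"
    using exhausting_boxesD(1)[OF assms] by blast
  have ne: "int_box (lo r) (hi r) \<noteq> {}" for r
    using exhausting_boxesD(2)[OF assms, of r] by (simp add: B1)
  note B = B1 ne exhausting_boxesD(3,4)[OF assms]
  have "(\<lambda>r. real (card (sym_diff ((\<lambda>f. f + axis h 1) ` B r) (B r))) / real (card (B r))) \<longlonglongrightarrow> 0" for h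
  proof -
    define n where "n r = nat (hi r $ h - lo r $ h)" for r
    have n: "filterlim n at_top sequentially"
      unfolding filterlim_at_top
    proof
      fix N :: nat
      obtain r1 where r1: "0 \<in> B r1" using B(4) by auto
      obtain r2 where r2: "axis h (int N) \<in> B r2" using B(4) by auto
      show "\<forall>\<^sub>F r in sequentially. N \<le> n r"
        using eventually_ge_at_top[of "max r1 r2"]
      proof eventually_elim
        case (elim r)
        then have "0 \<in> B r" "axis h (int N) \<in> B r" using B(3)[of r1 r] B(3)[of r2 r] r1 r2 by auto
        then have "lo r $ h \<le> (0 :: int ^ 'd) $ h" "axis h (int N) $ h < hi r $ h"
          unfolding B(1) int_box_def by blast+
        then show ?case by (simp add: n_def axis_def)
      qed
    qed
    have pos: "0 < n r" for r
    proof -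
      obtain k where "k \<in> int_box (lo r) (hi r)" using B(2) by blast
      then have "lo r $ h \<le> k $ h" "k $ h < hi r $ h" unfolding int_box_def by blast+
      then show ?thesis by (simp add: n_def)
    qed
    have "(\<lambda>r. 2 * inverse (real (n r))) \<longlonglongrightarrow> 2 * 0"
      by (intro tendsto_mult tendsto_const tendsto_inverse_0_at_top
          filterlim_compose[OF filterlim_real_sequentially n])
    then have lim: "(\<lambda>r. 2 * inverse (real (n r))) \<longlonglongrightarrow> 0" by simp
    show ?thesis
    proof (rule tendsto_sandwich[OF _ _ tendsto_const lim])
      show "\<forall>\<^sub>F r in sequentially. real (card (sym_diff ((\<lambda>f. f + axis h 1) ` B r) (B r))) / real (card (B r))
         \<le> 2 * inverse (real (n r))"
      proof (intro always_eventually allI)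
        fix r
        have c: "0 < real (card (B r))" using B(2)[of r] by (simp add: B(1) card_gt_0_iff finite_int_box)
        have "real (card (sym_diff ((\<lambda>f. f + axis h 1) ` B r) (B r)) * n r) \<le> real (2 * card (B r))"
          unfolding of_nat_le_iff n_def B(1) by (rule card_sym_diff_int_box[OF B(2)])
        then show "real (card (sym_diff ((\<lambda>f. f + axis h 1) ` B r) (B r))) / real (card (B r))
         \<le> 2 * inverse (real (n r))"
          using c pos[of r] by (simp add: field_simps)
      qed
    qed auto
  qed
  then show ?thesis
    using B(2,4) by (auto simp: folner_sequence_def B(1) finite_int_box)
qed

text \<open>As the boxes are nested, all differences lie in a centred box whose sides are twice
  those of \<open>B r\<close>; this gives the constant \<open>2 ^ CARD('d)\<close>.\<close>

lemma exhausting_boxes_imp_tempered: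
  fixes B :: "nat \<Rightarrow> (int ^ 'd) set"
  assumes "exhausting_boxes B"
  shows "tempered B"
proof -
  obtain lo hi where B1: "\<And>r. B r = int_box (lo r) (hi r)"
    using exhausting_boxesD(1)[OF assms] by blast
  have ne: "int_box (lo r) (hi r) \<noteq> {}" for r
    using exhausting_boxesD(2)[OF assms, of r] by (simp add: B1)
  note B = B1 ne exhausting_boxesD(3,4)[OF assms]
  have "real (card (\<Union>u<r. {i - j | i j. i \<in> B r \<and> j \<in> B u})) \<le> 2 ^ CARD('d) * real (card (B r))" for r
  proof -
    have "(\<Union>u<r. {i - j | i j. i \<in> B r \<and> j \<in> B u}) \<subseteq> int_box (lo r - hi r) (hi r - lo r)"
    proof clarify
      fix u i j assume "u < r" "i \<in> B r" "j \<in> B u"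
      then have "j \<in> B r" using B(3)[of u r] by auto
      with \<open>i \<in> B r\<close> show "i - j \<in> int_box (lo r - hi r) (hi r - lo r)"
        unfolding B(1) int_box_def by (auto; smt (verit))
    qed
    then have "card (\<Union>u<r. {i - j | i j. i \<in> B r \<and> j \<in> B u}) \<le> card (int_box (lo r - hi r) (hi r - lo r))"
      by (intro card_mono finite_int_box)
    also have "\<dots> = (\<Prod>l\<in>UNIV. 2 * nat (hi r $ l - lo r $ l))"
      unfolding card_int_box by (intro prod.cong) auto
    also have "\<dots> = 2 ^ CARD('d) * card (B r)"
      by (simp add: B(1) card_int_box prod.distrib)
    finally have "real (card (\<Union>u<r. {i - j | i j. i \<in> B r \<and> j \<in> B u})) \<le> real (2 ^ CARD('d) * card (B r))"
      by (rule of_nat_mono)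
    then show ?thesis by simp
  qed
  then show ?thesis unfolding tempered_def by (intro exI[of _ "2 ^ CARD('d)"]) auto
qed

section \<open>The pointwise ergodic theorem for lattice actions\<close>

locale lattice_action = prob_space M for M :: "'a measure" +
  fixes T :: "int ^ 'd \<Rightarrow> 'a \<Rightarrow> 'a"
  assumes T_measurable: "\<And>k. T k \<in> measurable M M"
    and distr_T: "\<And>k. distr M M (T k) = M"
    and T_add: "\<And>k l x. x \<in> space M \<Longrightarrow> T (k + l) x = T k (T l x)"
begin

definition avg :: "(int ^ 'd) set \<Rightarrow> ('a \<Rightarrow> real) \<Rightarrow> 'a \<Rightarrow> real" where
  "avg F g x = (\<Sum>i\<in>F. g (T i x)) / real (card F)"

lemma T_space: "x \<in> space M \<Longrightarrow> T k x \<in> space M"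
  using measurable_space[OF T_measurable] .

lemma integrable_T: "integrable M g \<Longrightarrow> integrable M (\<lambda>x. g (T k x))" for g :: "'a \<Rightarrow> real"
  using integrable_distr[where T="T k" and M=M and M'=M and f=g] distr_T[of k] T_measurable by simp

lemma integral_T: "integrable M g \<Longrightarrow> (LINT x|M. g (T k x)) = (LINT x|M. g x)" for g :: "'a \<Rightarrow> real"
  using integral_distr[where g="T k" and M=M and N=M and f=g] distr_T[of k] T_measurable by simp

lemma measure_T:
  assumes "E \<in> sets M" shows "measure M {x\<in>space M. T k x \<in> E} = measure M E"
proof -
  have "measure (distr M M (T k)) E = measure M (T k -` E \<inter> space M)"
    using assms T_measurable by (intro measure_distr) auto
  then show ?thesis by (simp add: distr_T vimage_def Int_def conj_commute)
qed

lemma avg_measurable [measurable]: "g \<in> borel_measurable M \<Longrightarrow> avg F g \<in> borel_measurable M"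
  unfolding avg_def
  by (intro borel_measurable_divide borel_measurable_sum borel_measurable_const
      measurable_compose[OF T_measurable])

lemma integrable_avg [intro]: "integrable M g \<Longrightarrow> integrable M (avg F g)"
  unfolding avg_def by (intro integrable_divide Bochner_Integration.integrable_sum integrable_T)

lemma integral_avg:
  assumes "integrable M g" "finite F" "F \<noteq> {}"
  shows "(LINT x|M. avg F g x) = (LINT x|M. g x)"
  using assms by (simp add: avg_def integrable_T integral_T)

lemma avg_add: "avg F (\<lambda>x. g x + h x) x = avg F g x + avg F h x"
  by (simp add: avg_def sum.distrib add_divide_distrib)

lemma avg_diff: "avg F (\<lambda>x. g x - h x) x = avg F g x - avg F h x"
  by (simp add: avg_def sum_subtractf diff_divide_distrib)

lemma avg_const: "finite F \<Longrightarrow> F \<noteq> {} \<Longrightarrow> avg F (\<lambda>_. c) x = c"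
  by (simp add: avg_def)

lemma abs_avg_le: "\<bar>avg F g x\<bar> \<le> avg F (\<lambda>x. \<bar>g x\<bar>) x"
  by (simp add: avg_def abs_divide divide_right_mono)

text \<open>The constant is the \<open>2 * (C + 1)\<close> of the covering inequality times the
  \<open>2\<close> lost by thickening \<open>H\<close> to \<open>L\<close>. Restricting to indices
  \<open>r < N\<close> keeps the set \<open>K\<close> of shifts finite, so that one Foelner set can
  absorb it; continuity of the measure from below removes the restriction.\<close>

lemma maximal_inequality:
  assumes F: "folner_sequence F"
    and C: "\<And>r. real (card (\<Union>v<r. {i - j | i j. i \<in> F r \<and> j \<in> F v})) \<le> C * real (card (F r))"
    and g: "integrable M g" "\<And>x. 0 \<le> g x" and \<alpha>: "0 < \<alpha>"
  shows "\<alpha> * measure M {x\<in>space M. \<exists>r. \<alpha> < avg (F r) g x} \<le> 4 * (C + 1) * (LINT x|M. g x)"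
proof -
  note FD = folner_sequenceD[OF F]
  have gm [measurable]: "g \<in> borel_measurable M" using g by simp
  have cpos: "real (card (F r)) > 0" for r using FD by (simp add: card_gt_0_iff)
  have "0 \<le> C * real (card (F 0))" using C[of 0] by simp
  then have C0: "0 \<le> C" using cpos[of 0] by (simp add: zero_le_mult_iff)
  define E where "E N = {x\<in>space M. \<exists>r<N. \<alpha> < avg (F r) g x}" for N :: nat
  have E [measurable]: "E N \<in> sets M" for N unfolding E_def by measurable
  have fin: "\<alpha> * measure M (E N) \<le> 4 * (C + 1) * (LINT x|M. g x)" for N
  proof -
    \<comment> \<open>transference: apply the covering inequality along each orbit, over a large Foelner set \<open>H\<close>\<close>
    define K where "K = (\<Union>r<N. F r)"
    have fK: "finite K" unfolding K_def using FD by auto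
    from folner_thickening[OF F fK] obtain m where
      m: "real (card {k + c | k c. k \<in> K \<and> c \<in> F m}) \<le> 2 * real (card (F m))"
      unfolding eventually_sequentially by blast
    define H where "H = F m"
    define L where "L = {k + c | k c. k \<in> K \<and> c \<in> H}"
    have fH: "finite H" unfolding H_def by (rule FD)
    have "L = (\<lambda>(k, c). k + c) ` (K \<times> H)" unfolding L_def by auto
    then have fL: "finite L" using fK fH by simp
    have pt: "\<alpha> * (\<Sum>c\<in>H. indicator (E N) (T c x)) \<le> 2 * (C + 1) * (\<Sum>k\<in>L. g (T k x))"
      if x: "x \<in> space M" for x
    proof -
      define Hx where "Hx = {c\<in>H. T c x \<in> E N}"
      \<comment> \<open>The point \<open>x\<close> is fixed, so the choice of a level with large
        average at each bad orbit point raises no question of measurability.\<close>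
      define u where "u c = (SOME r. r < N \<and> \<alpha> < avg (F r) g (T c x))" for c
      have u: "u c < N" "\<alpha> < avg (F (u c)) g (T c x)" if "c \<in> Hx" for c
      proof -
        have "\<exists>r. r < N \<and> \<alpha> < avg (F r) g (T c x)" using that by (auto simp: Hx_def E_def)
        from someI_ex[OF this] show "u c < N" "\<alpha> < avg (F (u c)) g (T c x)" unfolding u_def by auto
      qed
      have "\<alpha> * real (card Hx) \<le> 2 * (C + 1) * (\<Sum>k\<in>L. g (T k x))"
      proof (rule covering_inequality[where F=F and u=u])
        fix c assume c: "c \<in> Hx"
        have "\<alpha> * real (card (F (u c))) \<le> avg (F (u c)) g (T c x) * real (card (F (u c)))"
          using u(2)[OF c] by (intro mult_right_mono) auto
        also have "\<dots> = (\<Sum>k\<in>F (u c). g (T (k + c) x))"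
          using cpos[of "u c"] x by (simp add: avg_def T_add)
        finally show "\<alpha> * real (card (F (u c))) \<le> (\<Sum>k\<in>F (u c). g (T (k + c) x))" .
      next
        fix c k assume "c \<in> Hx" "k \<in> F (u c)"
        then show "k + c \<in> L" using u(1)[of c] unfolding L_def K_def Hx_def by blast
      qed (use fH fL FD C g \<alpha> in \<open>auto simp: Hx_def\<close>)
      also have "real (card Hx) = (\<Sum>c\<in>H. indicator (E N) (T c x))"
        using fH by (simp add: Hx_def sum.If_cases indicator_def Int_def)
      finally show ?thesis .
    qed
    have int: "integrable M (\<lambda>x. indicator (E N) (T c x) :: real)" for c
      by (rule integrable_T) (simp add: integrable_indicator_iff emeasure_eq_measure)
    have "\<alpha> * (real (card H) * measure M (E N)) = (LINT x|M. \<alpha> * (\<Sum>c\<in>H. indicator (E N) (T c x)))"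
    proof -
      have "(LINT x|M. indicator (E N) (T c x) :: real) = measure M (E N)" for c
        using integral_T[of "indicator (E N)" c] by (simp add: integrable_indicator_iff emeasure_eq_measure)
      then show ?thesis using int by simp
    qed
    also have "\<dots> \<le> (LINT x|M. 2 * (C + 1) * (\<Sum>k\<in>L. g (T k x)))"
      by (intro integral_mono pt integrable_mult_right Bochner_Integration.integrable_sum integrable_T g(1) int)
    also have "\<dots> = 2 * (C + 1) * (real (card L) * (LINT x|M. g x))"
      using g(1) by (simp add: integrable_T integral_T)
    also have "\<dots> \<le> 2 * (C + 1) * ((2 * real (card H)) * (LINT x|M. g x))"
      using m C0 g unfolding L_def H_def by (intro mult_left_mono mult_right_mono) auto
    finally have "real (card H) * (\<alpha> * measure M (E N)) \<le> real (card H) * (4 * (C + 1) * (LINT x|M. g x))"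
      by (simp add: algebra_simps)
    then show ?thesis using cpos[of m] by (simp add: H_def)
  qed
  have "incseq E" unfolding incseq_def E_def using less_le_trans by fastforce
  then have "(\<lambda>N. measure M (E N)) \<longlonglongrightarrow> measure M (\<Union>N. E N)"
    by (intro finite_Lim_measure_incseq) auto
  also have "(\<Union>N. E N) = {x\<in>space M. \<exists>r. \<alpha> < avg (F r) g x}" unfolding E_def by blast
  finally have "(\<lambda>N. \<alpha> * measure M (E N)) \<longlonglongrightarrow> \<alpha> * measure M {x\<in>space M. \<exists>r. \<alpha> < avg (F r) g x}"
    by (intro tendsto_mult tendsto_const)
  then show ?thesis using fin by (intro LIMSEQ_le_const2) auto
qed

text \<open>Reindexing turns the average of the translated function into a sum over the translated
  set; the common terms cancel, and those on the symmetric difference are bounded by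
  \<open>B\<close>.\<close>

lemma avg_T_diff_le:
  assumes "finite F" "\<And>x. x \<in> space M \<Longrightarrow> \<bar>b x\<bar> \<le> B" "x \<in> space M"
  shows "\<bar>avg F (\<lambda>y. b (T k y)) x - avg F b x\<bar>
    \<le> B * (real (card (sym_diff ((\<lambda>f. f + k) ` F) F)) / real (card F))"
proof -
  define G where "G = (\<lambda>f. f + k) ` F"
  have fG: "finite G" using assms by (simp add: G_def)
  have "(\<Sum>i\<in>F. b (T k (T i x))) = (\<Sum>i\<in>G. b (T i x))"
    unfolding G_def using assms(3)
    by (subst sum.reindex) (auto simp: inj_on_def o_def T_add[symmetric] add.commute)
  then have "(\<Sum>i\<in>F. b (T k (T i x))) - (\<Sum>i\<in>F. b (T i x)) = (\<Sum>i\<in>G - F. b (T i x)) - (\<Sum>i\<in>F - G. b (T i x))"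
    using assms(1) fG sum.Int_Diff[of G "\<lambda>i. b (T i x)" F] sum.Int_Diff[of F "\<lambda>i. b (T i x)" G]
    by (simp add: Int_commute)
  also have "\<bar>\<dots>\<bar> \<le> (\<Sum>i\<in>G - F. \<bar>b (T i x)\<bar>) + (\<Sum>i\<in>F - G. \<bar>b (T i x)\<bar>)"
    by (intro order.trans[OF abs_triangle_ineq4] add_mono sum_abs)
  also have "\<dots> = (\<Sum>i\<in>sym_diff G F. \<bar>b (T i x)\<bar>)"
    using assms(1) fG by (intro sum.union_disjoint[symmetric]) auto
  also have "\<dots> \<le> (\<Sum>i\<in>sym_diff G F. B)" by (intro sum_mono assms(2) T_space assms(3))
  also have "\<dots> = B * real (card (sym_diff G F))" by simp
  finally have "\<bar>(\<Sum>i\<in>F. b (T k (T i x))) - (\<Sum>i\<in>F. b (T i x))\<bar> / real (card F)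
    \<le> B * real (card (sym_diff G F)) / real (card F)"
    by (rule divide_right_mono) simp
  then show ?thesis
    unfolding avg_def G_def by (simp add: diff_divide_distrib[symmetric])
qed

lemma avg_avg_diff_tendsto:
  assumes F: "folner_sequence F" and G: "finite G" "G \<noteq> {}"
    and b: "\<And>x. x \<in> space M \<Longrightarrow> \<bar>b x\<bar> \<le> B" and x: "x \<in> space M"
  shows "(\<lambda>r. avg (F r) (avg G b) x - avg (F r) b x) \<longlonglongrightarrow> 0"
proof -
  note FD = folner_sequenceD[OF F]
  have eq: "avg (F r) (avg G b) x - avg (F r) b x
    = (\<Sum>k\<in>G. avg (F r) (\<lambda>y. b (T k y)) x - avg (F r) b x) / real (card G)" for r
  proof -
    have "avg (F r) (avg G b) x = (\<Sum>k\<in>G. avg (F r) (\<lambda>y. b (T k y)) x) / real (card G)"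
      unfolding avg_def by (subst sum_divide_distrib[symmetric], subst sum.swap)
        (simp add: sum_divide_distrib mult.commute)
    then show ?thesis using G by (simp add: sum_subtractf diff_divide_distrib)
  qed
  have "(\<lambda>r. avg (F r) (\<lambda>y. b (T k y)) x - avg (F r) b x) \<longlonglongrightarrow> 0" for k
  proof (rule Lim_null_comparison)
    show "\<forall>\<^sub>F r in sequentially. norm (avg (F r) (\<lambda>y. b (T k y)) x - avg (F r) b x) \<le>
      B * (real (card (sym_diff ((\<lambda>f. f + k) ` F r) (F r))) / real (card (F r)))"
      using avg_T_diff_le[where b=b and k=k, OF FD(1) b x] by simp
    show "(\<lambda>r. B * (real (card (sym_diff ((\<lambda>f. f + k) ` F r) (F r))) / real (card (F r)))) \<longlonglongrightarrow> 0"
      using tendsto_mult_right_zero[OF folner_translate[OF F]] .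
  qed
  then have "(\<lambda>r. (\<Sum>k\<in>G. avg (F r) (\<lambda>y. b (T k y)) x - avg (F r) b x) / real (card G)) \<longlonglongrightarrow> (\<Sum>k\<in>G. 0) / real (card G)"
    using G by (intro tendsto_divide tendsto_sum tendsto_const) auto
  then show ?thesis by (simp add: eq)
qed

lemma truncation_L1:
  assumes g: "integrable M g" and "0 < (\<eta> :: real)"
  obtains b B where "b \<in> borel_measurable M" "\<And>x. \<bar>b x\<bar> \<le> B" "(LINT x|M. \<bar>g x - b x\<bar>) < \<eta>"
proof -
  have gm [measurable]: "g \<in> borel_measurable M" using g by simp
  define b where "b n x = max (- real n) (min (real n) (g x))" for n :: nat and x
  have bm [measurable]: "b n \<in> borel_measurable M" for n unfolding b_def by measurable
  have "(\<lambda>n. LINT x|M. \<bar>g x - b n x\<bar>) \<longlonglongrightarrow> (LINT x|M. 0)"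
  proof (rule integral_dominated_convergence[where w="\<lambda>x. \<bar>g x\<bar>"])
    show "AE x in M. (\<lambda>n. \<bar>g x - b n x\<bar>) \<longlonglongrightarrow> 0"
    proof (intro AE_I2 tendsto_eventually)
      fix x
      obtain N :: nat where "\<bar>g x\<bar> \<le> real N" using real_arch_simple by blast
      then show "\<forall>\<^sub>F n in sequentially. \<bar>g x - b n x\<bar> = 0"
        unfolding eventually_sequentially b_def by (intro exI[of _ N]) (auto simp: max_def min_def abs_if split: if_splits)
    qed
    show "AE x in M. norm \<bar>g x - b n x\<bar> \<le> \<bar>g x\<bar>" for n
      by (intro AE_I2) (auto simp: b_def max_def min_def abs_if)
  qed (use g in auto)
  then have "eventually (\<lambda>n. (LINT x|M. \<bar>g x - b n x\<bar>) < \<eta>) sequentially"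
    using assms(2) by (intro order_tendstoD) auto
  then obtain n where "(LINT x|M. \<bar>g x - b n x\<bar>) < \<eta>" by (auto simp: eventually_sequentially)
  moreover have "\<bar>b n x\<bar> \<le> real n" for x by (auto simp: b_def)
  ultimately show ?thesis using that[of "b n" "real n"] by simp
qed

text \<open>Ergodicity enters only through \<open>mean\<close>, which supplies a single set
  \<open>F m\<close> over which the average of a bounded function is close in mean to its integral.
  Temperedness enters only through the maximal inequality.\<close>

theorem pointwise_ergodic:
  assumes F: "folner_sequence F" "tempered F" and g: "integrable M g"
    and mean: "\<And>b B. b \<in> borel_measurable M \<Longrightarrow> (\<And>x. \<bar>b x\<bar> \<le> B) \<Longrightarrow>
      (\<lambda>r. LINT x|M. \<bar>avg (F r) b x - (LINT y|M. b y)\<bar>) \<longlonglongrightarrow> 0"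
  shows "AE x in M. (\<lambda>r. avg (F r) g x) \<longlonglongrightarrow> (LINT y|M. g y)"
proof -
  note FD = folner_sequenceD[OF F(1)]
  obtain C where C: "C > 0" "\<And>r. real (card (\<Union>v<r. {i - j | i j. i \<in> F r \<and> j \<in> F v})) \<le> C * real (card (F r))"
    using F(2) unfolding tempered_def by blast
  have gm [measurable]: "g \<in> borel_measurable M" using g by simp
  define c where "c = (LINT y|M. g y)"
  \<comment> \<open>Of the \<open>3 * \<alpha>\<close>, one \<open>\<alpha>\<close> is for the
    maximal function of \<open>h\<close>, one for the averaged coboundaries, and one for the
    difference of the integrals, at most \<open>\<eta> \<le> \<alpha>\<close>.\<close>
  define Bad where "Bad \<alpha> = {x\<in>space M. \<not> (\<exists>N. \<forall>r\<ge>N. \<bar>avg (F r) g x - c\<bar> \<le> 3 * \<alpha>)}" for \<alpha> :: real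
  have Bad_sets [measurable]: "Bad \<alpha> \<in> sets M" for \<alpha> unfolding Bad_def by measurable
  have small: "\<alpha> * measure M (Bad \<alpha>) \<le> 4 * (C + 1) * (2 * \<eta>)" if \<alpha>: "0 < \<alpha>" and \<eta>: "0 < \<eta>" "\<eta> \<le> \<alpha>" for \<alpha> \<eta>
  proof -
    obtain b B where b [measurable]: "b \<in> borel_measurable M" and bB: "\<And>x. \<bar>b x\<bar> \<le> B" and gb: "(LINT x|M. \<bar>g x - b x\<bar>) < \<eta>"
      using truncation_L1[OF g \<eta>(1)] by blast
    have bi: "integrable M b" by (rule integrable_const_bound[of _ B]) (use bB in auto)
    define c' where "c' = (LINT y|M. b y)"
    have "eventually (\<lambda>r. (LINT x|M. \<bar>avg (F r) b x - c'\<bar>) < \<eta>) sequentially"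
      unfolding c'_def using \<eta>(1) by (intro order_tendstoD[OF mean[OF b bB]]) auto
    then obtain m where m: "(LINT x|M. \<bar>avg (F m) b x - c'\<bar>) < \<eta>" by (auto simp: eventually_sequentially)
    have cc: "\<bar>c' - c\<bar> \<le> \<eta>"
    proof -
      have "c - c' = (LINT x|M. g x - b x)" using g bi by (simp add: c_def c'_def)
      also have "\<bar>\<dots>\<bar> \<le> (LINT x|M. \<bar>g x - b x\<bar>)" by (rule integral_abs_bound)
      finally show ?thesis using gb by linarith
    qed
    \<comment> \<open>The two terms that are small in mean are merged into one nonnegative function
      of integral below \<open>2 * \<eta>\<close>, so the maximal inequality is applied
      once.\<close>
    define h where "h x = \<bar>g x - b x\<bar> + \<bar>avg (F m) b x - c'\<bar>" for x
    have i1: "integrable M (\<lambda>x. \<bar>g x - b x\<bar>)"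
      by (intro integrable_abs Bochner_Integration.integrable_diff g bi)
    have i2: "integrable M (\<lambda>x. \<bar>avg (F m) b x - c'\<bar>)"
      by (intro integrable_abs Bochner_Integration.integrable_diff integrable_avg bi integrable_const)
    have hi: "integrable M h" unfolding h_def by (intro Bochner_Integration.integrable_add i1 i2)
    have "Bad \<alpha> \<subseteq> {x\<in>space M. \<exists>r. \<alpha> < avg (F r) h x}"
    proof (rule ccontr)
      assume "\<not> ?thesis"
      then obtain x where xs: "x \<in> space M" and x: "x \<in> Bad \<alpha>" "\<And>r. avg (F r) h x \<le> \<alpha>"
        unfolding Bad_def subset_iff by (auto simp: not_less)
      have "eventually (\<lambda>r. dist (avg (F r) (avg (F m) b) x - avg (F r) b x) 0 < \<alpha>) sequentially"
        using \<alpha> by (intro tendstoD avg_avg_diff_tendsto[OF F(1) FD(1,2) bB xs])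
      then have "eventually (\<lambda>r. \<bar>avg (F r) g x - c\<bar> \<le> 3 * \<alpha>) sequentially"
      proof eventually_elim
        case (elim r)
        have "\<bar>avg (F r) g x - avg (F r) b x\<bar> + \<bar>avg (F r) (avg (F m) b) x - c'\<bar>
          \<le> avg (F r) h x"
        proof -
          have "avg (F r) h x = avg (F r) (\<lambda>x. \<bar>g x - b x\<bar>) x + avg (F r) (\<lambda>x. \<bar>avg (F m) b x - c'\<bar>) x"
            unfolding h_def by (rule avg_add)
          moreover have "\<bar>avg (F r) (\<lambda>x. g x - b x) x\<bar> \<le> avg (F r) (\<lambda>x. \<bar>g x - b x\<bar>) x" by (rule abs_avg_le)
          moreover have "\<bar>avg (F r) (\<lambda>x. avg (F m) b x - c') x\<bar> \<le> avg (F r) (\<lambda>x. \<bar>avg (F m) b x - c'\<bar>) x" by (rule abs_avg_le)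
          ultimately show ?thesis using FD by (simp add: avg_diff avg_const)
        qed
        then show ?case using elim x(2)[of r] cc \<eta>(2) by (simp add: dist_real_def)
      qed
      then show False using x(1) unfolding Bad_def eventually_sequentially by blast
    qed
    then have "measure M (Bad \<alpha>) \<le> measure M {x\<in>space M. \<exists>r. \<alpha> < avg (F r) h x}"
      using hi by (intro finite_measure_mono) (auto simp: borel_measurable_integrable)
    then have "\<alpha> * measure M (Bad \<alpha>) \<le> \<alpha> * measure M {x\<in>space M. \<exists>r. \<alpha> < avg (F r) h x}"
      using \<alpha> by (intro mult_left_mono) auto
    also have "\<dots> \<le> 4 * (C + 1) * (LINT x|M. h x)"
      by (rule maximal_inequality[OF F(1) C(2) hi _ \<alpha>]) (simp add: h_def)
    also have "(LINT x|M. h x) = (LINT x|M. \<bar>g x - b x\<bar>) + (LINT x|M. \<bar>avg (F m) b x - c'\<bar>)"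
      unfolding h_def by (intro Bochner_Integration.integral_add i1 i2)
    also have "4 * (C + 1) * \<dots> \<le> 4 * (C + 1) * (2 * \<eta>)" using gb m C(1) by (intro mult_left_mono) auto
    finally show ?thesis .
  qed
  have null: "measure M (Bad \<alpha>) = 0" if \<alpha>: "0 < \<alpha>" for \<alpha>
  proof -
    \<comment> \<open>\<open>Bad \<alpha>\<close> does not depend on \<open>\<eta>\<close>, while
      the approximation \<open>b\<close> does; so \<open>\<eta>\<close> may tend to \<open>0\<close>
      with \<open>\<alpha>\<close> fixed.\<close>
    have "((\<lambda>\<eta>. 4 * (C + 1) * (2 * \<eta>)) \<longlongrightarrow> 4 * (C + 1) * (2 * 0)) (at_right 0)"
      by (intro tendsto_intros)
    moreover have "eventually (\<lambda>\<eta>. \<alpha> * measure M (Bad \<alpha>) \<le> 4 * (C + 1) * (2 * \<eta>)) (at_right 0)"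
      unfolding eventually_at_right_field using small[OF \<alpha>] \<alpha> by (intro exI[of _ \<alpha>]) auto
    ultimately have "\<alpha> * measure M (Bad \<alpha>) \<le> 4 * (C + 1) * (2 * 0)"
      by (intro tendsto_lowerbound) auto
    then show ?thesis using \<alpha> measure_nonneg[of M "Bad \<alpha>"] by (simp add: mult_le_0_iff)
  qed
  have "AE x in M. \<forall>n. x \<notin> Bad (1 / real (Suc n))"
    unfolding AE_all_countable
    by (intro allI AE_not_in null_setsI) (auto simp: null emeasure_eq_measure)
  then show ?thesis
  proof (rule AE_mp, intro AE_I2 impI)
    fix x assume x: "x \<in> space M" "\<forall>n. x \<notin> Bad (1 / real (Suc n))"
    show "(\<lambda>r. avg (F r) g x) \<longlonglongrightarrow> (LINT y|M. g y)"
      unfolding LIMSEQ_def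
    proof (intro allI impI)
      fix e :: real assume "0 < e"
      then obtain n where n: "1 / real (Suc n) < e / 3" using nat_approx_posE[of "e / 3"] by auto
      have "x \<notin> Bad (1 / real (Suc n))" using x(2) by blast
      then obtain N where "\<forall>r\<ge>N. \<bar>avg (F r) g x - c\<bar> \<le> 3 * (1 / real (Suc n))"
        unfolding Bad_def using x(1) by blast
      then show "\<exists>no. \<forall>r\<ge>no. dist (avg (F r) g x) (LINT y|M. g y) < e"
        using n by (intro exI[of _ N]) (fastforce simp: dist_real_def c_def)
    qed
  qed
qed

end

section \<open>Mean convergence\<close>

context lattice_action
begin

definition mean_convergent :: "(nat \<Rightarrow> (int ^ 'd) set) \<Rightarrow> ('a \<Rightarrow> real) \<Rightarrow> bool" where
  "mean_convergent F g \<longleftrightarrow> (\<lambda>r. LINT x|M. \<bar>avg (F r) g x - (LINT y|M. g y)\<bar>) \<longlonglongrightarrow> 0"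

lemma integrable_abs_avg_diff:
  "integrable M g \<Longrightarrow> integrable M (\<lambda>x. \<bar>avg F g x - c\<bar>)"
  by (intro integrable_abs Bochner_Integration.integrable_diff integrable_avg integrable_const)

lemma avg_mult: "avg F (\<lambda>x. c * g x) x = c * avg F g x"
  by (simp add: avg_def sum_distrib_left)

lemma mean_convergent_add:
  assumes "mean_convergent F g" "mean_convergent F h" "integrable M g" "integrable M h"
  shows "mean_convergent F (\<lambda>x. g x + h x)"
  unfolding mean_convergent_def
proof (rule tendsto_sandwich[OF _ _ tendsto_const])
  show "(\<lambda>r. (LINT x|M. \<bar>avg (F r) g x - (LINT y|M. g y)\<bar>) + (LINT x|M. \<bar>avg (F r) h x - (LINT y|M. h y)\<bar>)) \<longlonglongrightarrow> 0"
    using tendsto_add_zero[OF assms(1,2)[unfolded mean_convergent_def]] .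
  show "\<forall>\<^sub>F r in sequentially. (LINT x|M. \<bar>avg (F r) (\<lambda>x. g x + h x) x - (LINT y|M. g y + h y)\<bar>)
    \<le> (LINT x|M. \<bar>avg (F r) g x - (LINT y|M. g y)\<bar>) + (LINT x|M. \<bar>avg (F r) h x - (LINT y|M. h y)\<bar>)"
  proof (intro always_eventually allI)
    fix r
    have "(LINT x|M. \<bar>avg (F r) (\<lambda>x. g x + h x) x - (LINT y|M. g y + h y)\<bar>)
      \<le> (LINT x|M. \<bar>avg (F r) g x - (LINT y|M. g y)\<bar> + \<bar>avg (F r) h x - (LINT y|M. h y)\<bar>)"
      using assms(3,4)
      by (intro integral_mono Bochner_Integration.integrable_add integrable_abs_avg_diff)
        (auto simp: avg_add)
    also have "\<dots> = (LINT x|M. \<bar>avg (F r) g x - (LINT y|M. g y)\<bar>) + (LINT x|M. \<bar>avg (F r) h x - (LINT y|M. h y)\<bar>)"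
      using assms(3,4) by (intro Bochner_Integration.integral_add integrable_abs_avg_diff)
    finally show "(LINT x|M. \<bar>avg (F r) (\<lambda>x. g x + h x) x - (LINT y|M. g y + h y)\<bar>) \<le> \<dots>" .
  qed
qed auto

lemma mean_convergent_mult:
  assumes "mean_convergent F g" "integrable M g"
  shows "mean_convergent F (\<lambda>x. c * g x)"
proof -
  have "(LINT x|M. \<bar>avg (F r) (\<lambda>x. c * g x) x - (LINT y|M. c * g y)\<bar>)
    = \<bar>c\<bar> * (LINT x|M. \<bar>avg (F r) g x - (LINT y|M. g y)\<bar>)" for r
    by (simp add: avg_mult abs_mult flip: right_diff_distrib)
  then show ?thesis
    using tendsto_mult_right_zero[OF assms(1)[unfolded mean_convergent_def]]
    unfolding mean_convergent_def by simp
qed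

lemma mean_convergent_const:
  assumes "\<And>r. finite (F r)" "\<And>r. F r \<noteq> {}"
  shows "mean_convergent F (\<lambda>_. c)"
  using assms by (simp add: mean_convergent_def avg_const prob_space)

text \<open>Averaging preserves the integral of \<open>\<bar>g - h\<bar>\<close>, so replacing
  \<open>g\<close> by \<open>h\<close> costs that distance once in the average and once in the
  integral. With the error of \<open>h\<close> itself this makes three parts of
  \<open>e / 3\<close>.\<close>

lemma mean_convergent_approx:
  assumes F: "\<And>r. finite (F r)" "\<And>r. F r \<noteq> {}" and g: "integrable M g"
    and h: "\<And>\<epsilon>::real. 0 < \<epsilon> \<Longrightarrow> \<exists>h. integrable M h \<and> mean_convergent F h \<and> (LINT x|M. \<bar>g x - h x\<bar>) < \<epsilon>"
  shows "mean_convergent F g"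
  unfolding mean_convergent_def
proof (rule LIMSEQ_I)
  fix e :: real assume "0 < e"
  then obtain h where h: "integrable M h" "mean_convergent F h" "(LINT x|M. \<bar>g x - h x\<bar>) < e / 3"
    using h[of "e / 3"] by auto
  have gh: "integrable M (\<lambda>x. \<bar>g x - h x\<bar>)" using g h by auto
  have "eventually (\<lambda>r. (LINT x|M. \<bar>avg (F r) h x - (LINT y|M. h y)\<bar>) < e / 3) sequentially"
    using h(2) \<open>0 < e\<close> unfolding mean_convergent_def by (intro order_tendstoD) auto
  then obtain N where N: "\<And>r. N \<le> r \<Longrightarrow> (LINT x|M. \<bar>avg (F r) h x - (LINT y|M. h y)\<bar>) < e / 3"
    unfolding eventually_sequentially by blast
  have "(LINT x|M. \<bar>avg (F r) g x - (LINT y|M. g y)\<bar>) < e" if "N \<le> r" for r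
  proof -
    have "\<bar>(LINT y|M. h y) - (LINT y|M. g y)\<bar> \<le> (LINT x|M. \<bar>g x - h x\<bar>)"
      using integral_abs_bound[of M "\<lambda>x. g x - h x"] g h by (simp add: abs_minus_commute)
    then have pt: "\<bar>avg (F r) g x - (LINT y|M. g y)\<bar> \<le> avg (F r) (\<lambda>x. \<bar>g x - h x\<bar>) x
       + (\<bar>avg (F r) h x - (LINT y|M. h y)\<bar> + (LINT x|M. \<bar>g x - h x\<bar>))" for x
      using abs_avg_le[of "F r" "\<lambda>x. g x - h x" x] by (simp add: avg_diff)
    have "(LINT x|M. \<bar>avg (F r) g x - (LINT y|M. g y)\<bar>) \<le> (LINT x|M. avg (F r) (\<lambda>x. \<bar>g x - h x\<bar>) x
       + (\<bar>avg (F r) h x - (LINT y|M. h y)\<bar> + (LINT x|M. \<bar>g x - h x\<bar>)))"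
      using g h(1) gh
      by (intro integral_mono pt Bochner_Integration.integrable_add integrable_abs_avg_diff integrable_avg integrable_const)
    also have "\<dots> = (LINT x|M. avg (F r) (\<lambda>x. \<bar>g x - h x\<bar>) x)
       + ((LINT x|M. \<bar>avg (F r) h x - (LINT y|M. h y)\<bar>) + (LINT x|M. \<bar>g x - h x\<bar>))"
      using integrable_avg[OF gh, of "F r"] integrable_abs_avg_diff[OF h(1)]
      by (simp add: prob_space)
    also have "(LINT x|M. avg (F r) (\<lambda>x. \<bar>g x - h x\<bar>) x) = (LINT x|M. \<bar>g x - h x\<bar>)"
      by (rule integral_avg[OF gh F])
    finally show ?thesis using h(3) N[OF that] by linarith
  qed
  then show "\<exists>no. \<forall>r\<ge>no. norm ((LINT x|M. \<bar>avg (F r) g x - (LINT y|M. g y)\<bar>) - 0) < e"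
    by (intro exI[of _ N]) (auto simp: abs_of_nonneg)
qed

lemma integrable_indicator [intro, simp]: "E \<in> sets M \<Longrightarrow> integrable M (indicator E :: 'a \<Rightarrow> real)"
  by (simp add: integrable_indicator_iff emeasure_eq_measure)

text \<open>The sets whose indicators converge in mean form a Dynkin system: complements and finite
  disjoint unions by linearity, countable ones by approximation. An intersection-stable generator
  therefore suffices.\<close>

lemma mean_convergent_indicator:
  assumes F: "\<And>r. finite (F r)" "\<And>r. F r \<noteq> {}"
    and G: "Int_stable G" "G \<subseteq> Pow (space M)" "sets M = sigma_sets (space M) G"
    and mc: "\<And>E. E \<in> G \<Longrightarrow> mean_convergent F (indicator E)" and E: "E \<in> sets M"
  shows "mean_convergent F (indicator E)"
proof -
  have "E \<in> sigma_sets (space M) G" using E G by simp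
  from G(1,2) this show ?thesis
  proof (induction E rule: sigma_sets_induct_disjoint)
    case (basic A) then show ?case by (rule mc)
  next
    case empty
    have "indicator {} = (\<lambda>_::'a. 0 :: real)" by auto
    then show ?case using mean_convergent_const[OF F] by simp
  next
    case (compl A)
    have A: "A \<in> sets M" using compl G by simp
    have "mean_convergent F (\<lambda>x. 1 + (- 1) * indicator A x)"
      using A by (intro mean_convergent_add mean_convergent_mult mean_convergent_const F compl.IH) auto
    also have "?this \<longleftrightarrow> mean_convergent F (indicator (space M - A))"
    proof -
      \<comment> \<open>\<open>1 - indicator A\<close> is the indicator of the complement only on
        \<open>space M\<close>, so the two averages are compared along orbits inside the
        space.\<close>
      have avg: "avg (F r) (\<lambda>x. 1 + (- 1) * indicator A x) x = avg (F r) (indicator (space M - A)) x"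
        if "x \<in> space M" for r x
        unfolding avg_def using that by (intro arg_cong2[where f="(/)"] sum.cong refl) (auto simp: indicator_def T_space)
      have "(LINT x|M. 1 + (- 1) * indicator A x) = (LINT x|M. indicator (space M - A) x :: real)"
        by (intro Bochner_Integration.integral_cong refl) (auto simp: indicator_def)
      then show ?thesis unfolding mean_convergent_def
        using avg by (simp cong: Bochner_Integration.integral_cong)
    qed
    finally show ?case .
  next
    case (union A)
    have A: "A i \<in> sets M" for i using union G by auto
    have fin: "mean_convergent F (\<lambda>x. \<Sum>i<n. indicator (A i) x)" for n :: nat
    proof (induction n)
      case 0 then show ?case using mean_convergent_const[OF F] by simp
    next
      case (Suc n) then show ?case using A union.IH
        by (auto intro!: mean_convergent_add Bochner_Integration.integrable_sum)
    qed
    show ?case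
    proof (rule mean_convergent_approx[OF F])
      show "integrable M (indicator (\<Union>i. A i) :: 'a \<Rightarrow> real)" using A by (intro integrable_indicator) auto
      fix \<epsilon> :: real assume "0 < \<epsilon>"
      have "(\<lambda>n. measure M (\<Union>i<n. A i)) \<longlonglongrightarrow> measure M (\<Union>n. \<Union>i<n. A i)"
        using A by (intro finite_Lim_measure_incseq) (fastforce simp: incseq_def)+
      also have "(\<Union>n. \<Union>i<n. A i) = (\<Union>i. A i)" by auto
      finally have "eventually (\<lambda>n. measure M (\<Union>i. A i) - \<epsilon> < measure M (\<Union>i<n. A i)) sequentially"
        using \<open>0 < \<epsilon>\<close> by (intro order_tendstoD) auto
      then obtain n where n: "measure M (\<Union>i. A i) - \<epsilon> < measure M (\<Union>i<n. A i)"
        by (auto simp: eventually_sequentially)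
      have ind: "(\<Sum>i<n. indicator (A i) x) = (indicator (\<Union>i<n. A i) x :: real)" for x
        using union.hyps by (intro indicator_UN_disjoint[symmetric]) (auto simp: disjoint_family_on_def)
      have "(LINT x|M. \<bar>indicator (\<Union>i. A i) x - indicator (\<Union>i<n. A i) x\<bar>)
        = (LINT x|M. indicator (\<Union>i. A i) x - indicator (\<Union>i<n. A i) x :: real)"
        by (intro Bochner_Integration.integral_cong refl) (auto simp: indicator_def)
      also have "\<dots> = measure M (\<Union>i. A i) - measure M (\<Union>i<n. A i)"
        using A by (subst Bochner_Integration.integral_diff) (auto simp: Int_absorb2 sets.sets_into_space)
      finally have "(LINT x|M. \<bar>indicator (\<Union>i. A i) x - (\<Sum>i<n. indicator (A i) x)\<bar>) < \<epsilon>"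
        using n by (simp add: ind)
      then show "\<exists>h. integrable M h \<and> mean_convergent F h \<and> (LINT x|M. \<bar>indicator (\<Union>i. A i) x - h x\<bar>) < \<epsilon>"
        using fin A by (intro exI[of _ "\<lambda>x. \<Sum>i<n. indicator (A i) x"]) (auto intro!: Bochner_Integration.integrable_sum)
    qed
  qed
qed

lemma mean_convergent_generator:
  assumes F: "\<And>r. finite (F r)" "\<And>r. F r \<noteq> {}"
    and G: "Int_stable G" "G \<subseteq> Pow (space M)" "sets M = sigma_sets (space M) G"
    and mc: "\<And>E. E \<in> G \<Longrightarrow> mean_convergent F (indicator E)" and g: "integrable M g"
  shows "mean_convergent F g"
  using g
proof (induction rule: integrable_induct)
  case (base A c)
  then show ?case
    using mean_convergent_mult[OF mean_convergent_indicator[OF F G mc], of A c] by (simp add: mult.commute)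
next
  case (add f g) then show ?case by (intro mean_convergent_add)
next
  case (lim f s)
  have [measurable]: "f \<in> borel_measurable M" "s i \<in> borel_measurable M" for i
    using lim by auto
  show ?case
  proof (rule mean_convergent_approx[OF F])
    fix \<epsilon> :: real assume "0 < \<epsilon>"
    have "(\<lambda>n. LINT x|M. \<bar>f x - s n x\<bar>) \<longlonglongrightarrow> (LINT x|M. 0)"
    \<comment> \<open>The approximating simple functions are bounded by twice
      \<open>norm (f x)\<close>, hence the factor \<open>3\<close> for the difference.\<close>
    proof (rule integral_dominated_convergence[where w="\<lambda>x. 3 * norm (f x)"])
      show "AE x in M. (\<lambda>n. \<bar>f x - s n x\<bar>) \<longlonglongrightarrow> 0"
      proof (intro AE_I2)
        fix x assume "x \<in> space M"
        from tendsto_diff[OF tendsto_const lim(2)[OF this], of "f x"]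
        show "(\<lambda>n. \<bar>f x - s n x\<bar>) \<longlonglongrightarrow> 0" by (simp add: tendsto_rabs_zero)
      qed
      show "AE x in M. norm \<bar>f x - s n x\<bar> \<le> 3 * norm (f x)" for n
        using lim(3)[of _ n] by (intro AE_I2) fastforce
    qed (use lim in auto)
    then have "eventually (\<lambda>n. (LINT x|M. \<bar>f x - s n x\<bar>) < \<epsilon>) sequentially"
      using \<open>0 < \<epsilon>\<close> by (intro order_tendstoD) auto
    then obtain n where "(LINT x|M. \<bar>f x - s n x\<bar>) < \<epsilon>" by (auto simp: eventually_sequentially)
    then show "\<exists>h. integrable M h \<and> mean_convergent F h \<and> (LINT x|M. \<bar>f x - h x\<bar>) < \<epsilon>"
      using lim by blast
  qed (rule lim)
qed

end

section \<open>Relabelling the coordinates of a product measure\<close>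

text \<open>The marginals may differ between coordinates but not along an orbit, since arrivals and
  departures have different laws. Freeness on coordinates, \<open>\<tau>_free\<close>, is what
  separates finite coordinate sets. The lattice acts on configurations by precomposition, which
  reverses composition; hence the order in \<open>\<tau>_add\<close>.\<close>

locale product_relabelling = product_prob_space \<nu> "UNIV :: 'k set"
  for \<nu> :: "'k \<Rightarrow> 'b measure" +
  fixes \<tau> :: "int ^ 'd \<Rightarrow> 'k \<Rightarrow> 'k"
  assumes \<tau>_add: "\<And>i j k. \<tau> (i + j) k = \<tau> j (\<tau> i k)"
    and \<tau>_inj: "\<And>i. inj (\<tau> i)"
    and \<tau>_free: "\<And>k. inj (\<lambda>i. \<tau> i k)"
    and \<tau>_law: "\<And>i k. \<nu> (\<tau> i k) = \<nu> k"
begin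

abbreviation \<Omega> where "\<Omega> \<equiv> Pi\<^sub>M UNIV \<nu>"

sublocale shift: lattice_action \<Omega> "\<lambda>i c k. c (\<tau> i k)"
proof
  fix i
  show meas: "(\<lambda>c k. c (\<tau> i k)) \<in> measurable \<Omega> \<Omega>"
  proof (rule measurable_PiM_single')
    fix k
    have "(\<lambda>c. c (\<tau> i k)) \<in> measurable \<Omega> (\<nu> (\<tau> i k))" by (rule measurable_component_singleton) simp
    then show "(\<lambda>c. c (\<tau> i k)) \<in> measurable \<Omega> (\<nu> k)" by (simp add: \<tau>_law)
  next
    have "x (\<tau> i k) \<in> space (\<nu> k)" if "\<forall>k. x k \<in> space (\<nu> k)" for x k
      using that[rule_format, of "\<tau> i k"] by (simp add: \<tau>_law)
    then show "(\<lambda>c k. c (\<tau> i k)) \<in> space \<Omega> \<rightarrow> (\<Pi>\<^sub>E k\<in>UNIV. space (\<nu> k))"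
      by (auto simp: space_PiM PiE_def Pi_def)
  qed
  have "distr \<Omega> (Pi\<^sub>M UNIV (\<lambda>k. \<nu> (\<tau> i k))) (\<lambda>c. \<lambda>k\<in>UNIV. c (\<tau> i k)) = Pi\<^sub>M UNIV (\<lambda>k. \<nu> (\<tau> i k))"
    using \<tau>_inj by (intro distr_PiM_reindex) (auto simp: prob_space_axioms prob_space)
  then show "distr \<Omega> \<Omega> (\<lambda>c k. c (\<tau> i k)) = \<Omega>" by (simp add: \<tau>_law restrict_UNIV)
qed (simp add: \<tau>_add)

definition cylinder :: "'k set \<Rightarrow> ('k \<Rightarrow> 'b set) \<Rightarrow> ('k \<Rightarrow> 'b) set" where
  "cylinder J X = {c\<in>space \<Omega>. \<forall>k\<in>J. c k \<in> X k}"

lemma cylinder_eq_emb: "cylinder J X = prod_emb UNIV \<nu> J (Pi\<^sub>E J X)"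
  by (auto simp: cylinder_def prod_emb_def space_PiM PiE_def Pi_def)

lemma cylinder_sets: "finite J \<Longrightarrow> (\<And>k. k \<in> J \<Longrightarrow> X k \<in> sets (\<nu> k)) \<Longrightarrow> cylinder J X \<in> sets \<Omega>"
  unfolding cylinder_eq_emb by (intro sets_PiM_I) auto

lemma measure_cylinder:
  assumes "finite J" "\<And>k. k \<in> J \<Longrightarrow> X k \<in> sets (\<nu> k)"
  shows "measure \<Omega> (cylinder J X) = (\<Prod>k\<in>J. measure (\<nu> k) (X k))"
  unfolding cylinder_eq_emb using assms by (intro measure_PiM_emb) auto

text \<open>\<open>inv (\<tau> i)\<close> is evaluated only on the range of \<open>\<tau> i\<close>,
  where injectivity makes it a true inverse.\<close>

lemma cylinder_shift:
  assumes "c \<in> space \<Omega>"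
  shows "(\<lambda>k. c (\<tau> i k)) \<in> cylinder J X \<longleftrightarrow> c \<in> cylinder (\<tau> i ` J) (X \<circ> inv (\<tau> i))"
  using assms shift.T_space[OF assms, of i] \<tau>_inj[of i] by (simp add: cylinder_def)

lemma measure_cylinder_shift:
  assumes "finite J" "\<And>k. k \<in> J \<Longrightarrow> X k \<in> sets (\<nu> k)"
  shows "measure \<Omega> (cylinder (\<tau> i ` J) (X \<circ> inv (\<tau> i))) = measure \<Omega> (cylinder J X)"
proof -
  have "measure \<Omega> (cylinder J X) = measure \<Omega> {c\<in>space \<Omega>. (\<lambda>k. c (\<tau> i k)) \<in> cylinder J X}"
    using shift.measure_T[OF cylinder_sets[OF assms]] by simp
  also have "{c\<in>space \<Omega>. (\<lambda>k. c (\<tau> i k)) \<in> cylinder J X} = cylinder (\<tau> i ` J) (X \<circ> inv (\<tau> i))"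
  proof (intro set_eqI)
    fix c show "c \<in> {c\<in>space \<Omega>. (\<lambda>k. c (\<tau> i k)) \<in> cylinder J X} \<longleftrightarrow> c \<in> cylinder (\<tau> i ` J) (X \<circ> inv (\<tau> i))"
      using cylinder_shift[of c i J X] by (cases "c \<in> space \<Omega>") (simp_all add: cylinder_def)
  qed
  finally show ?thesis by simp
qed

lemma measure_cylinder_Int:
  assumes "finite J" "finite L" "J \<inter> L = {}"
    "\<And>k. k \<in> J \<Longrightarrow> X k \<in> sets (\<nu> k)" "\<And>k. k \<in> L \<Longrightarrow> Y k \<in> sets (\<nu> k)"
  shows "measure \<Omega> (cylinder J X \<inter> cylinder L Y) = measure \<Omega> (cylinder J X) * measure \<Omega> (cylinder L Y)"
proof -
  define Z where "Z k = (if k \<in> J then X k else Y k)" for k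
  have "cylinder J X \<inter> cylinder L Y = cylinder (J \<union> L) Z"
    using assms(3) by (fastforce simp: cylinder_def Z_def split: if_splits)
  also have "measure \<Omega> \<dots> = (\<Prod>k\<in>J \<union> L. measure (\<nu> k) (Z k))"
    using assms by (intro measure_cylinder) (auto simp: Z_def)
  also have "\<dots> = (\<Prod>k\<in>J. measure (\<nu> k) (Z k)) * (\<Prod>k\<in>L. measure (\<nu> k) (Z k))"
    using assms by (intro prod.union_disjoint)
  also have "(\<Prod>k\<in>J. measure (\<nu> k) (Z k)) = measure \<Omega> (cylinder J X)"
    using assms by (subst measure_cylinder) (auto simp: Z_def)
  also have "(\<Prod>k\<in>L. measure (\<nu> k) (Z k)) = measure \<Omega> (cylinder L Y)"
    using assms by (subst measure_cylinder) (auto simp: Z_def intro!: prod.cong)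
  finally show ?thesis .
qed

text \<open>An overlap is witnessed by \<open>k\<close> and \<open>l\<close> in \<open>J\<close>
  with \<open>\<tau> i k = \<tau> j l\<close>, and by freeness \<open>i\<close>, \<open>k\<close>
  and \<open>l\<close> determine \<open>j\<close>. The bound is thus linear in
  \<open>card F\<close>, against a quadratic number of pairs.\<close>

lemma card_overlaps_le:
  assumes "finite F" "finite J"
  shows "card {(i, j). i \<in> F \<and> j \<in> F \<and> \<tau> i ` J \<inter> \<tau> j ` J \<noteq> {}} \<le> card J * card J * card F"
proof -
  have "{(i, j). i \<in> F \<and> j \<in> F \<and> \<tau> i ` J \<inter> \<tau> j ` J \<noteq> {}}
     \<subseteq> (\<lambda>(k, l, i). (i, THE j. \<tau> j l = \<tau> i k)) ` (J \<times> J \<times> F)"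
  proof
    fix x assume "x \<in> {(i, j). i \<in> F \<and> j \<in> F \<and> \<tau> i ` J \<inter> \<tau> j ` J \<noteq> {}}"
    then obtain i j k l where *: "i \<in> F" "j \<in> F" "k \<in> J" "\<tau> i k = \<tau> j l" "l \<in> J" and x: "x = (i, j)"
      by (auto simp: disjoint_iff)
    have "(THE j. \<tau> j l = \<tau> i k) = j" using *(4) \<tau>_free[of l] by (auto intro!: the_equality dest: injD)
    then show "x \<in> (\<lambda>(k, l, i). (i, THE j. \<tau> j l = \<tau> i k)) ` (J \<times> J \<times> F)"
      using * x by (intro image_eqI[of _ _ "(k, l, i)"]) auto
  qed
  then have "card {(i, j). i \<in> F \<and> j \<in> F \<and> \<tau> i ` J \<inter> \<tau> j ` J \<noteq> {}} \<le> card (J \<times> J \<times> F)"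
    by (rule surj_card_le[rotated]) (use assms in auto)
  then show ?thesis by (simp add: card_cartesian_product)
qed

text \<open>Cylinders over disjoint coordinate sets are independent, so in the second moment of the
  averaged centred indicators only overlapping pairs contribute, each at most \<open>1\<close>.
  Their number is linear in \<open>card (F r)\<close>, which leaves a second moment of order
  \<open>1 / card (F r)\<close>.\<close>

lemma mean_convergent_cylinder:
  assumes F: "\<And>r. finite (F r)" "\<And>r. F r \<noteq> {}" "(\<lambda>r. 1 / real (card (F r))) \<longlonglongrightarrow> 0"
    and J: "finite J" "\<And>k. k \<in> J \<Longrightarrow> X k \<in> sets (\<nu> k)"
  shows "shift.mean_convergent F (indicator (cylinder J X))"
proof -
  define E where "E = cylinder J X"
  define p where "p = measure \<Omega> E"
  define Ei where "Ei i = cylinder (\<tau> i ` J) (X \<circ> inv (\<tau> i))" for i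
  define Y where "Y i c = (indicator (Ei i) c - p :: real)" for i c
  have E [measurable]: "E \<in> sets \<Omega>" unfolding E_def using J by (rule cylinder_sets)
  have XX: "(X \<circ> inv (\<tau> i)) k \<in> sets (\<nu> k)" if "k \<in> \<tau> i ` J" for i k
    using that J(2) \<tau>_inj[of i] by (auto simp: \<tau>_law)
  have Ei [measurable]: "Ei i \<in> sets \<Omega>" for i
    unfolding Ei_def using J XX by (intro cylinder_sets) auto
  have pEi: "measure \<Omega> (Ei i) = p" for i unfolding Ei_def p_def E_def by (rule measure_cylinder_shift[OF J])
  have p: "0 \<le> p" "p \<le> 1" unfolding p_def by (auto intro: P.prob_le_1)
  have Y1: "\<bar>Y i c\<bar> \<le> 1" for i c using p by (auto simp: Y_def indicator_def)
  have Ym [measurable]: "Y i \<in> borel_measurable \<Omega>" for i unfolding Y_def by measurable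
  have YY: "integrable \<Omega> (\<lambda>c. Y i c * Y j c)" for i j
    by (rule P.integrable_const_bound[of _ 1])
       (use Y1 in \<open>auto simp: abs_mult intro!: AE_I2 mult_le_one\<close>)
  have cov1: "(LINT c|\<Omega>. Y i c * Y j c) \<le> 1" for i j
  proof -
    have "(LINT c|\<Omega>. Y i c * Y j c) \<le> (LINT c|\<Omega>. 1)"
    proof (intro integral_mono YY)
      show "Y i c * Y j c \<le> 1" for c
        using abs_mult[of "Y i c" "Y j c"] mult_le_one[OF Y1[of i c] _ Y1[of j c]] by simp
    qed simp
    then show ?thesis by (simp add: P.prob_space)
  qed
  have cov0: "(LINT c|\<Omega>. Y i c * Y j c) = 0" if "\<tau> i ` J \<inter> \<tau> j ` J = {}" for i j
  proof -
    have "measure \<Omega> (Ei i \<inter> Ei j) = p * p"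
    proof -
      have "measure \<Omega> (Ei i \<inter> Ei j) = measure \<Omega> (Ei i) * measure \<Omega> (Ei j)"
        unfolding Ei_def using J(1) by (intro measure_cylinder_Int that XX) auto
      then show ?thesis by (simp add: pEi)
    qed
    moreover have "(LINT c|\<Omega>. Y i c * Y j c) =
      (LINT c|\<Omega>. indicator (Ei i \<inter> Ei j) c - p * indicator (Ei i) c - p * indicator (Ei j) c + p * p)"
      by (intro Bochner_Integration.integral_cong refl)
        (simp add: Y_def algebra_simps indicator_inter_arith)
    moreover have "\<dots> = measure \<Omega> (Ei i \<inter> Ei j) - p * measure \<Omega> (Ei i) - p * measure \<Omega> (Ei j) + p * p"
      by (simp add: P.prob_space)
    ultimately show ?thesis by (simp add: pEi)
  qed
  have bound: "(LINT c|\<Omega>. \<bar>shift.avg (F r) (indicator E) c - p\<bar>) \<le> real (card J) * sqrt (1 / real (card (F r)))" for r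
  proof -
    define n where "n = real (card (F r))"
    have n: "0 < n" using F by (simp add: n_def card_gt_0_iff)
    define meet where "meet i j \<longleftrightarrow> \<tau> i ` J \<inter> \<tau> j ` J \<noteq> {}" for i j
    define V where "V c = \<bar>(\<Sum>i\<in>F r. Y i c) / n\<bar>" for c
    have eq: "\<bar>shift.avg (F r) (indicator E) c - p\<bar> = V c" if "c \<in> space \<Omega>" for c
    proof -
      have "indicator E (\<lambda>k. c (\<tau> i k)) = (indicator (Ei i) c :: real)" for i
        unfolding E_def Ei_def using cylinder_shift[OF that] by (simp add: indicator_def)
      then show ?thesis using n by (simp add: V_def shift.avg_def Y_def sum_subtractf diff_divide_distrib n_def)
    qed
    have Vm: "V \<in> borel_measurable \<Omega>" unfolding V_def by measurable
    have V1: "0 \<le> V c" "V c \<le> 1" for c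
    proof -
      have "\<bar>\<Sum>i\<in>F r. Y i c\<bar> \<le> (\<Sum>i\<in>F r. 1)" by (rule order.trans[OF sum_abs sum_mono]) (rule Y1)
      then show "0 \<le> V c" "V c \<le> 1" using n by (auto simp: V_def n_def abs_divide)
    qed
    have Vi: "integrable \<Omega> V" "integrable \<Omega> (\<lambda>c. (V c)\<^sup>2)"
      using V1 Vm by (auto intro!: P.integrable_const_bound[of _ 1] AE_I2 simp: power_le_one)
    have "(LINT c|\<Omega>. (V c)\<^sup>2) = (LINT c|\<Omega>. (\<Sum>i\<in>F r. \<Sum>j\<in>F r. Y i c * Y j c) / n\<^sup>2)"
      by (simp add: V_def power_divide power2_eq_square sum_product)
    also have "\<dots> = (\<Sum>i\<in>F r. \<Sum>j\<in>F r. LINT c|\<Omega>. Y i c * Y j c) / n\<^sup>2"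
      using YY by (simp add: Bochner_Integration.integral_sum Bochner_Integration.integrable_sum)
    also have "(\<Sum>i\<in>F r. \<Sum>j\<in>F r. LINT c|\<Omega>. Y i c * Y j c) \<le> (\<Sum>i\<in>F r. \<Sum>j\<in>F r. of_bool (meet i j))"
      using cov0 cov1 by (intro sum_mono) (auto simp: meet_def)
    also have "\<dots> = (\<Sum>(i, j)\<in>F r \<times> F r. of_bool (meet i j))" by (simp add: sum.cartesian_product)
    also have "\<dots> = (\<Sum>x\<in>{(i, j). i \<in> F r \<and> j \<in> F r \<and> meet i j}. 1)"
      using F(1)[of r] by (intro sum.mono_neutral_cong_right) auto
    also have "\<dots> = real (card {(i, j). i \<in> F r \<and> j \<in> F r \<and> \<tau> i ` J \<inter> \<tau> j ` J \<noteq> {}})"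
      by (simp add: meet_def)
    also have "\<dots> \<le> real (card J * card J * card (F r))"
      by (rule of_nat_mono[OF card_overlaps_le[OF F(1) J(1)]])
    also have "real (card J * card J * card (F r)) / n\<^sup>2 = (real (card J))\<^sup>2 * (1 / n)"
      using n by (simp add: power2_eq_square n_def)
    finally have "(LINT c|\<Omega>. (V c)\<^sup>2) \<le> (real (card J))\<^sup>2 * (1 / n)"
      using n by (simp add: divide_right_mono)
    \<comment> \<open>Nonnegativity of the variance of \<open>V\<close> is the Cauchy-Schwarz bound
      of the first moment by the second.\<close>
    moreover have "0 \<le> (LINT c|\<Omega>. (V c)\<^sup>2) - (LINT c|\<Omega>. V c)\<^sup>2"
      using P.variance_positive[of V] P.variance_eq[OF Vi] by simp
    ultimately have "(LINT c|\<Omega>. V c)\<^sup>2 \<le> (real (card J))\<^sup>2 * (1 / n)" by linarith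
    then have "(LINT c|\<Omega>. V c) \<le> sqrt ((real (card J))\<^sup>2 * (1 / n))" by (rule real_le_rsqrt)
    also have "\<dots> = real (card J) * sqrt (1 / n)" by (simp add: real_sqrt_mult real_sqrt_divide)
    finally show ?thesis unfolding n_def using eq by (simp cong: Bochner_Integration.integral_cong)
  qed
  have pint: "(LINT c|\<Omega>. indicator E c) = p" by (simp add: p_def)
  show ?thesis
    unfolding shift.mean_convergent_def E_def[symmetric] pint
  proof (rule tendsto_sandwich[OF _ _ tendsto_const])
    have "(\<lambda>r. real (card J) * sqrt (1 / real (card (F r)))) \<longlonglongrightarrow> real (card J) * sqrt 0"
      by (intro tendsto_mult tendsto_const tendsto_real_sqrt F(3))
    then show "(\<lambda>r. real (card J) * sqrt (1 / real (card (F r)))) \<longlonglongrightarrow> 0" by simp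
  qed (use bound in auto)
qed

theorem mean_ergodic:
  assumes F: "\<And>r. finite (F r)" "\<And>r. F r \<noteq> {}" "(\<lambda>r. 1 / real (card (F r))) \<longlonglongrightarrow> 0"
    and g: "integrable \<Omega> g"
  shows "shift.mean_convergent F g"
proof (rule shift.mean_convergent_generator[OF F(1,2)])
  show "Int_stable (prod_algebra UNIV \<nu>)" by (rule Int_stable_prod_algebra)
  show "prod_algebra UNIV \<nu> \<subseteq> Pow (space \<Omega>)" using prod_algebra_sets_into_space by (simp add: space_PiM)
  show "sets \<Omega> = sigma_sets (space \<Omega>) (prod_algebra UNIV \<nu>)" by (simp add: sets_PiM space_PiM)
  fix E assume "E \<in> prod_algebra UNIV \<nu>"
  then obtain J X where "E = prod_emb UNIV \<nu> J (Pi\<^sub>E J X)" "finite J" "\<And>k. k \<in> J \<Longrightarrow> X k \<in> sets (\<nu> k)"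
    by (rule prod_algebraE) blast
  then show "shift.mean_convergent F (indicator E)"
    using mean_convergent_cylinder[OF F] by (simp add: cylinder_eq_emb)
qed (rule g)

end

section \<open>The least trajectory of the queues\<close>

lemma ennreal_inverse_antimono: "x \<le> y \<Longrightarrow> inverse y \<le> inverse (x :: ennreal)"
proof (cases "x = 0 \<or> y = top")
  case False
  assume le: "x \<le> y"
  with False obtain r q where "x = ennreal r" "y = ennreal q" "0 < r" "0 < q"
    by (cases x; cases y) (auto simp: top_unique ennreal_eq_0_iff not_le)
  then show ?thesis using le by (simp add: inverse_ennreal ennreal_le_iff le_imp_inverse_le)
qed auto

text \<open>Only the interference in the denominator grows. The numerator must be held fixed by
  \<open>x i = y i\<close>, since a longer queue at \<open>i\<close> can raise its own rate.\<close>

lemma departure_rate_antimono: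
  assumes "\<And>j. x j \<le> y j" "x i = y i"
  shows "departure_rate a y i \<le> departure_rate a x i"
proof -
  have "(\<Sum>\<^sub>\<infinity>j. ennreal (a j) * of_nat (x (i - j))) \<le> (\<Sum>\<^sub>\<infinity>j. ennreal (a j) * of_nat (y (i - j)))"
    by (intro infsum_mono nonneg_summable_on_complete mult_left_mono of_nat_mono assms(1)) auto
  then show ?thesis
    unfolding departure_rate_def divide_ennreal_def assms(2)
    by (intro mult_left_mono ennreal_inverse_antimono) auto
qed

text \<open>The index from which \<open>x n j\<close> equals \<open>y j\<close> may depend on the
  site, so the infinite sum is handled by monotone convergence: each finite partial sum is
  eventually exact and bounded by the supremum.\<close>

lemma departure_rate_tendsto:
  fixes x :: "nat \<Rightarrow> 'i::ab_group_add \<Rightarrow> nat"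
  assumes mono: "\<And>m n j. m \<le> n \<Longrightarrow> x m j \<le> x n j"
    and ev: "\<And>j. eventually (\<lambda>n. x n j = y j) sequentially"
  shows "(\<lambda>n. departure_rate a (x n) i) \<longlonglongrightarrow> departure_rate a y i"
proof -
  define S where "S n = (\<Sum>\<^sub>\<infinity>j. ennreal (a j) * of_nat (x n (i - j)))" for n
  define S' where "S' = (\<Sum>\<^sub>\<infinity>j. ennreal (a j) * of_nat (y (i - j)))"
  have xy: "x n j \<le> y j" for n j
  proof -
    obtain N where "\<And>m. N \<le> m \<Longrightarrow> x m j = y j" using ev[of j] unfolding eventually_sequentially by blast
    then show ?thesis using mono[of n "max n N" j] by (metis max.cobounded1 max.cobounded2)
  qed
  have incS: "incseq S" unfolding incseq_def S_def
    by (intro allI impI infsum_mono nonneg_summable_on_complete mult_left_mono of_nat_mono mono) auto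
  have "S' \<le> (SUP n. S n)"
  proof -
    have "(\<Sum>j\<in>F. ennreal (a j) * of_nat (y (i - j))) \<le> (SUP n. S n)" if F: "finite F" for F
    proof (rule tendsto_upperbound)
      show "(\<lambda>n. \<Sum>j\<in>F. ennreal (a j) * of_nat (x n (i - j))) \<longlonglongrightarrow> (\<Sum>j\<in>F. ennreal (a j) * of_nat (y (i - j)))"
      proof (intro tendsto_sum tendsto_eventually)
        show "\<forall>\<^sub>F n in sequentially. ennreal (a j) * of_nat (x n (i - j)) = ennreal (a j) * of_nat (y (i - j))" for j
          using ev[of "i - j"] by eventually_elim simp
      qed
      show "\<forall>\<^sub>F n in sequentially. (\<Sum>j\<in>F. ennreal (a j) * of_nat (x n (i - j))) \<le> (SUP n. S n)"
      proof (intro always_eventually allI)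
        fix n
        have "(\<Sum>j\<in>F. ennreal (a j) * of_nat (x n (i - j))) \<le> S n"
          unfolding S_def using F
          by (subst infsum_finite[symmetric], simp, intro infsum_mono_neutral nonneg_summable_on_complete) auto
        also have "\<dots> \<le> (SUP n. S n)" by (rule SUP_upper) simp
        finally show "(\<Sum>j\<in>F. ennreal (a j) * of_nat (x n (i - j))) \<le> (SUP n. S n)" .
      qed
    qed simp
    then show ?thesis unfolding S'_def by (subst nonneg_infsum_complete) (auto intro!: SUP_least)
  qed
  moreover have "S n \<le> S'" for n unfolding S_def S'_def
    by (intro infsum_mono nonneg_summable_on_complete mult_left_mono of_nat_mono xy) auto
  ultimately have "(SUP n. S n) = S'" by (intro antisym SUP_least) auto
  then have "S \<longlonglongrightarrow> S'" using LIMSEQ_SUP[OF incS] by simp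
  moreover have "continuous_on UNIV (\<lambda>z :: ennreal. inverse z)" by (intro continuous_intros)
  ultimately have inv: "(\<lambda>n. inverse (S n)) \<longlonglongrightarrow> inverse S'"
    by (metis (no_types) UNIV_I continuous_on_eq_continuous_at isCont_tendsto_compose open_UNIV)
  have ex: "eventually (\<lambda>n. of_nat (x n i) * inverse (S n) = of_nat (y i) * inverse (S n)) sequentially"
    using ev[of i] by eventually_elim simp
  have "(\<lambda>n. of_nat (y i) * inverse (S n)) \<longlonglongrightarrow> of_nat (y i) * inverse S'"
  \<comment> \<open>Multiplication of extended reals is discontinuous at zero times infinity, and
    the inverse may tend to infinity; for \<open>y i = 0\<close> the product is constantly
    \<open>0\<close>.\<close>
  proof (cases "y i = 0")
    case False
    then show ?thesis by (intro tendsto_mult_ennreal tendsto_const inv) (auto simp: of_nat_eq_0_iff)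
  qed simp
  then show ?thesis
    unfolding departure_rate_def divide_ennreal_def S_def[symmetric] S'_def[symmetric]
    by (simp add: tendsto_cong[OF ex])
qed

section \<open>Trajectories as fixed points of a monotone operator\<close>

definition event :: "('i \<Rightarrow> real set) \<Rightarrow> ('i \<Rightarrow> (real \<times> real) set) \<Rightarrow> 'i \<Rightarrow> real \<Rightarrow> bool" where
  "event Ar De i t \<longleftrightarrow> t \<in> Ar i \<or> (\<exists>u. (t, u) \<in> De i)"

definition update :: "('i::ab_group_add \<Rightarrow> real) \<Rightarrow> ('i \<Rightarrow> real set) \<Rightarrow> ('i \<Rightarrow> (real \<times> real) set) \<Rightarrow>
   real \<Rightarrow> ('i \<Rightarrow> nat) \<Rightarrow> 'i \<Rightarrow> nat" where
  "update a Ar De t x i = x i + of_bool (t \<in> Ar i)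
     - of_bool (\<exists>u. (t, u) \<in> De i \<and> ennreal u \<le> departure_rate a x i)"

text \<open>\<open>E\<close> stands for the events of queue \<open>i\<close> in a bounded time
  window, a finite set, so \<open>Max\<close> picks the latest. Without events the queue still has
  its initial length \<open>0\<close>.\<close>

definition last_update :: "('i::ab_group_add \<Rightarrow> real) \<Rightarrow> ('i \<Rightarrow> real set) \<Rightarrow> ('i \<Rightarrow> (real \<times> real) set) \<Rightarrow>
   (real \<Rightarrow> 'i \<Rightarrow> nat) \<Rightarrow> 'i \<Rightarrow> real set \<Rightarrow> nat" where
  "last_update a Ar De W i E = (if E = {} then 0 else update a Ar De (Max E) (W (Max E)) i)"

text \<open>
  A trajectory from the empty configuration is determined by its left values \<open>W\<close>, and these are
  exactly the fixed points of the following monotone operator.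
\<close>

definition pre_step :: "('i::ab_group_add \<Rightarrow> real) \<Rightarrow> ('i \<Rightarrow> real set) \<Rightarrow> ('i \<Rightarrow> (real \<times> real) set) \<Rightarrow>
   real \<Rightarrow> (real \<Rightarrow> 'i \<Rightarrow> nat) \<Rightarrow> real \<Rightarrow> 'i \<Rightarrow> nat" where
  "pre_step a Ar De s0 W t i = last_update a Ar De W i {\<tau>. s0 < \<tau> \<and> \<tau> < t \<and> event Ar De i \<tau>}"

text \<open>The right-continuous value at \<open>t\<close>, where \<open>pre_step\<close> is the
  left limit; the windows differ only in the endpoint \<open>t\<close>.\<close>

definition post_step :: "('i::ab_group_add \<Rightarrow> real) \<Rightarrow> ('i \<Rightarrow> real set) \<Rightarrow> ('i \<Rightarrow> (real \<times> real) set) \<Rightarrow>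
   real \<Rightarrow> (real \<Rightarrow> 'i \<Rightarrow> nat) \<Rightarrow> real \<Rightarrow> 'i \<Rightarrow> nat" where
  "post_step a Ar De s0 W t i = last_update a Ar De W i {\<tau>. s0 < \<tau> \<and> \<tau> \<le> t \<and> event Ar De i \<tau>}"

definition pre_iter :: "('i::ab_group_add \<Rightarrow> real) \<Rightarrow> ('i \<Rightarrow> real set) \<Rightarrow> ('i \<Rightarrow> (real \<times> real) set) \<Rightarrow>
   real \<Rightarrow> nat \<Rightarrow> real \<Rightarrow> 'i \<Rightarrow> nat" where
  "pre_iter a Ar De s0 n = (pre_step a Ar De s0 ^^ n) (\<lambda>_ _. 0)"

text \<open>The supremum of naturals is meaningful because the iterates are bounded by the number of
  arrivals since \<open>s0\<close>.\<close>

definition pre_limit :: "('i::ab_group_add \<Rightarrow> real) \<Rightarrow> ('i \<Rightarrow> real set) \<Rightarrow> ('i \<Rightarrow> (real \<times> real) set) \<Rightarrow>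
   real \<Rightarrow> real \<Rightarrow> 'i \<Rightarrow> nat" where
  "pre_limit a Ar De s0 t i = (SUP n. pre_iter a Ar De s0 n t i)"

definition locally_finite :: "'b::metric_space set \<Rightarrow> bool" where
  "locally_finite P \<longleftrightarrow> (\<forall>B. bounded B \<longrightarrow> finite (P \<inter> B))"

text \<open>If the queues at \<open>i\<close> are equal, the larger configuration has the smaller
  rate, so a departure there forces one in the smaller configuration. If they differ, the gap of at
  least \<open>1\<close> absorbs the single possible departure.\<close>

lemma update_mono:
  assumes "\<And>j. x j \<le> y j"
  shows "update a Ar De t x i \<le> update a Ar De t y i"
proof (cases "x i = y i")
  case True
  have "departure_rate a y i \<le> departure_rate a x i" by (rule departure_rate_antimono[of x y, OF assms True])
  then have "(\<exists>u. (t, u) \<in> De i \<and> ennreal u \<le> departure_rate a y i) \<Longrightarrow>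
     (\<exists>u. (t, u) \<in> De i \<and> ennreal u \<le> departure_rate a x i)" by (meson order.trans)
  then show ?thesis unfolding update_def True by (auto simp: of_bool_def)
next
  case False
  then have "x i < y i" using assms[of i] by simp
  then show ?thesis unfolding update_def by (auto simp: of_bool_def)
qed

lemma last_update_mono:
  assumes "\<And>t j. W t j \<le> W' t j"
  shows "last_update a Ar De W i E \<le> last_update a Ar De W' i E"
  unfolding last_update_def using assms by (auto intro: update_mono)

lemma pre_step_mono:
  "(\<And>t j. W t j \<le> W' t j) \<Longrightarrow> pre_step a Ar De s0 W t i \<le> pre_step a Ar De s0 W' t i"
  unfolding pre_step_def by (rule last_update_mono)

lemma post_step_mono:
  "(\<And>t j. W t j \<le> W' t j) \<Longrightarrow> post_step a Ar De s0 W t i \<le> post_step a Ar De s0 W' t i"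
  unfolding post_step_def by (rule last_update_mono)

lemma pre_iter_0: "pre_iter a Ar De s0 0 t i = 0"
  and pre_iter_Suc: "pre_iter a Ar De s0 (Suc n) = pre_step a Ar De s0 (pre_iter a Ar De s0 n)"
  by (simp_all add: pre_iter_def)

lemma pre_iter_mono:
  assumes "m \<le> n"
  shows "pre_iter a Ar De s0 m t i \<le> pre_iter a Ar De s0 n t i"
proof -
  have Suc: "pre_iter a Ar De s0 n t i \<le> pre_iter a Ar De s0 (Suc n) t i" for n t i
  proof (induction n arbitrary: t i)
    case 0 then show ?case by (simp add: pre_iter_0)
  next
    case (Suc n) show ?case
      by (subst (1 2) pre_iter_Suc) (rule pre_step_mono[OF Suc])
  qed
  show ?thesis by (rule lift_Suc_mono_le[of "\<lambda>n. pre_iter a Ar De s0 n t i", OF Suc assms])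
qed

lemma pre_iter_le_fixpoint:
  assumes "pre_step a Ar De s0 Y = Y"
  shows "pre_iter a Ar De s0 n t i \<le> Y t i"
proof (induction n arbitrary: t i)
  case 0 then show ?case by (simp add: pre_iter_0)
next
  case (Suc n)
  then have "pre_iter a Ar De s0 (Suc n) t i \<le> pre_step a Ar De s0 Y t i"
    unfolding pre_iter_Suc by (rule pre_step_mono)
  then show ?case by (simp only: assms)
qed

lemma nat_incseq_bounded_eventually_SUP:
  fixes f :: "nat \<Rightarrow> nat"
  assumes "incseq f" "\<And>n. f n \<le> B"
  shows "eventually (\<lambda>n. f n = (SUP n. f n)) sequentially"
proof -
  have fin: "finite (range f)" by (rule finite_subset[of _ "{..B}"]) (use assms(2) in auto)
  then have "(SUP n. f n) \<in> range f" by (subst cSup_eq_Max) (auto intro: Max_in)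
  then obtain N where N: "f N = (SUP n. f n)" by auto
  have "f n = (SUP n. f n)" if "N \<le> n" for n
  proof (rule antisym)
    show "f n \<le> (SUP n. f n)" using fin by (intro cSUP_upper) auto
    show "(SUP n. f n) \<le> f n" using N incseqD[OF assms(1) that] by simp
  qed
  then show ?thesis unfolding eventually_sequentially by blast
qed

text \<open>One fixed realisation. Confining the marks to a bounded interval makes the events of
  each single queue locally finite in time, although those of all queues together need not
  be.\<close>

locale queue_driving =
  fixes a :: "'i::ab_group_add \<Rightarrow> real" and Ar :: "'i \<Rightarrow> real set" and De :: "'i \<Rightarrow> (real \<times> real) set"
  assumes Ar: "\<And>i. locally_finite (Ar i)" and De: "\<And>i. locally_finite (De i)"
    and marks: "\<And>i. De i \<subseteq> UNIV \<times> {0..1}"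
begin

abbreviation "evt \<equiv> event Ar De"
abbreviation "upd \<equiv> update a Ar De"
abbreviation "pre \<equiv> pre_step a Ar De"
abbreviation "post \<equiv> post_step a Ar De"
abbreviation "iter \<equiv> pre_iter a Ar De"
abbreviation "plim \<equiv> pre_limit a Ar De"

lemma finite_events: "finite {\<tau>. p \<le> \<tau> \<and> \<tau> \<le> q \<and> evt i \<tau>}"
proof -
  have "finite (Ar i \<inter> {p..q})" "finite (De i \<inter> ({p..q} \<times> {0..1}))"
    using Ar[of i] De[of i] by (auto simp: locally_finite_def bounded_Times)
  moreover have "{\<tau>. p \<le> \<tau> \<and> \<tau> \<le> q \<and> evt i \<tau>} \<subseteq> (Ar i \<inter> {p..q}) \<union> fst ` (De i \<inter> ({p..q} \<times> {0..1}))"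
    using marks[of i] by (force simp: event_def)
  ultimately show ?thesis by (meson finite_UnI finite_imageI finite_subset)
qed

lemma finite_events':
  "finite {\<tau>. p < \<tau> \<and> \<tau> < q \<and> evt i \<tau>}" "finite {\<tau>. p < \<tau> \<and> \<tau> \<le> q \<and> evt i \<tau>}"
  by (rule finite_subset[OF _ finite_events[of p q i]], auto)+

lemma finite_marks: "finite {u. (t, u) \<in> De i}"
proof -
  have "finite (De i \<inter> ({t} \<times> {0..1}))" using De[of i] by (auto simp: locally_finite_def bounded_Times)
  then have "finite (snd ` (De i \<inter> ({t} \<times> {0..1})))" by simp
  moreover have "{u. (t, u) \<in> De i} \<subseteq> snd ` (De i \<inter> ({t} \<times> {0..1}))" using marks[of i] by force
  ultimately show ?thesis by (rule rev_finite_subset)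
qed

lemma eventually_no_event_right: "eventually (\<lambda>r. \<forall>\<tau>. s < \<tau> \<and> \<tau> \<le> r \<longrightarrow> \<not> evt i \<tau>) (at_right s)"
proof -
  define E where "E = {\<tau>. s < \<tau> \<and> \<tau> \<le> s + 1 \<and> evt i \<tau>}"
  have E: "finite E" unfolding E_def by (rule finite_events')
  define b where "b = Min (insert (s + 1) E)"
  have b: "s < b" "b \<le> s + 1" using E by (auto simp: b_def E_def)
  have no: "\<not> evt i \<tau>" if "s < \<tau>" "\<tau> < b" for \<tau>
  proof
    assume "evt i \<tau>"
    then have "\<tau> \<in> E" using that b by (auto simp: E_def)
    then have "b \<le> \<tau>" unfolding b_def using E by simp
    then show False using that by simp
  qed
  show ?thesis unfolding eventually_at_right_field
    by (intro exI[of _ b]) (use b no in auto)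
qed

lemma eventually_no_event_left: "eventually (\<lambda>r. \<forall>\<tau>. r < \<tau> \<and> \<tau> < s \<longrightarrow> \<not> evt i \<tau>) (at_left s)"
proof -
  define E where "E = {\<tau>. s - 1 < \<tau> \<and> \<tau> < s \<and> evt i \<tau>}"
  have E: "finite E" unfolding E_def by (rule finite_events')
  define b where "b = Max (insert (s - 1) E)"
  have b: "b < s" "s - 1 \<le> b" using E by (auto simp: b_def E_def)
  have no: "\<not> evt i \<tau>" if "b < \<tau>" "\<tau> < s" for \<tau>
  proof
    assume "evt i \<tau>"
    then have "\<tau> \<in> E" using that b by (auto simp: E_def)
    then have "\<tau> \<le> b" unfolding b_def using E by simp
    then show False using that by simp
  qed
  show ?thesis unfolding eventually_at_left_field
    by (intro exI[of _ b]) (use b no in auto)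
qed

lemma upd_no_event: "\<not> evt i t \<Longrightarrow> upd t x i = x i"
  by (auto simp: update_def event_def)

lemma upd_le: "upd t x i \<le> x i + of_bool (t \<in> Ar i)"
  by (simp add: update_def)

text \<open>Departures only lower a queue, so the number of arrivals since \<open>s0\<close> is a
  bound preserved by the operator. It is the same for all iterates, which makes each increasing
  sequence of values eventually constant.\<close>

lemma pre_le_arrivals:
  assumes "\<And>t j. W t j \<le> card {\<tau>. \<tau> \<in> Ar j \<and> s0 < \<tau> \<and> \<tau> < t}"
  shows "pre s0 W t i \<le> card {\<tau>. \<tau> \<in> Ar i \<and> s0 < \<tau> \<and> \<tau> < t}"
proof (cases "{\<tau>. s0 < \<tau> \<and> \<tau> < t \<and> evt i \<tau>} = {}")
  case True then show ?thesis by (simp add: pre_step_def last_update_def)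
next
  case False
  define m where "m = Max {\<tau>. s0 < \<tau> \<and> \<tau> < t \<and> evt i \<tau>}"
  have m: "s0 < m" "m < t" using Max_in[OF finite_events'(1) False] by (auto simp: m_def)
  have fin: "finite {\<tau>. \<tau> \<in> Ar i \<and> s0 < \<tau> \<and> \<tau> < t}" for t
    by (rule finite_subset[OF _ finite_events'(1)[of s0 t i]]) (auto simp: event_def)
  have "pre s0 W t i = upd m (W m) i" unfolding pre_step_def last_update_def if_not_P[OF False] m_def ..
  also have "\<dots> \<le> card {\<tau>. \<tau> \<in> Ar i \<and> s0 < \<tau> \<and> \<tau> < m} + of_bool (m \<in> Ar i)"
    using upd_le[of m "W m" i] assms[of m i] by linarith
  also have "\<dots> \<le> card {\<tau>. \<tau> \<in> Ar i \<and> s0 < \<tau> \<and> \<tau> < t}"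
  proof (cases "m \<in> Ar i")
    case True
    have "card (insert m {\<tau>. \<tau> \<in> Ar i \<and> s0 < \<tau> \<and> \<tau> < m}) \<le> card {\<tau>. \<tau> \<in> Ar i \<and> s0 < \<tau> \<and> \<tau> < t}"
      using True m by (intro card_mono fin) auto
    then show ?thesis using True fin by simp
  next
    case False
    have "card {\<tau>. \<tau> \<in> Ar i \<and> s0 < \<tau> \<and> \<tau> < m} \<le> card {\<tau>. \<tau> \<in> Ar i \<and> s0 < \<tau> \<and> \<tau> < t}"
      using m by (intro card_mono fin) auto
    then show ?thesis using False by simp
  qed
  finally show ?thesis .
qed

lemma iter_le_arrivals: "iter s0 n t i \<le> card {\<tau>. \<tau> \<in> Ar i \<and> s0 < \<tau> \<and> \<tau> < t}"
proof (induction n arbitrary: t i)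
  case 0 then show ?case by (simp add: pre_iter_0)
next
  case (Suc n) then show ?case unfolding pre_iter_Suc by (rule pre_le_arrivals)
qed

lemma eventually_iter_eq: "eventually (\<lambda>n. iter s0 n t i = plim s0 t i) sequentially"
  unfolding pre_limit_def
  by (rule nat_incseq_bounded_eventually_SUP) (auto simp: incseq_def pre_iter_mono intro: iter_le_arrivals)

lemma iter_le_plim: "iter s0 n t i \<le> plim s0 t i"
proof -
  obtain N where "\<And>m. N \<le> m \<Longrightarrow> iter s0 m t i = plim s0 t i"
    using eventually_iter_eq unfolding eventually_sequentially by blast
  then show ?thesis using pre_iter_mono[of n "max n N"] by (metis max.cobounded1 max.cobounded2)
qed

text \<open>The acceptance test is a closed condition and the rates approach the limit rate from
  above once the queue at \<open>i\<close> has settled. Marks up to the limit rate are then accepted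
  all along; the finitely many marks above it are eventually rejected.\<close>

lemma eventually_upd_eq:
  assumes mono: "\<And>m n j. m \<le> n \<Longrightarrow> x m j \<le> x n j"
    and ev: "\<And>j. eventually (\<lambda>n. x n j = y j) sequentially"
  shows "eventually (\<lambda>n. upd t (x n) i = upd t y i) sequentially"
proof -
  have xy: "x n j \<le> y j" for n j
  proof -
    obtain N where "\<And>m. N \<le> m \<Longrightarrow> x m j = y j" using ev[of j] unfolding eventually_sequentially by blast
    then show ?thesis using mono[of n "max n N" j] by (metis max.cobounded1 max.cobounded2)
  qed
  have "eventually (\<lambda>n. \<forall>u\<in>{u. (t, u) \<in> De i}. departure_rate a y i < ennreal u \<longrightarrow> departure_rate a (x n) i < ennreal u) sequentially"
  proof (rule eventually_ball_finite[OF finite_marks], rule ballI)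
    fix u
    show "\<forall>\<^sub>F n in sequentially. departure_rate a y i < ennreal u \<longrightarrow> departure_rate a (x n) i < ennreal u"
      using order_tendstoD(2)[OF departure_rate_tendsto[of x y a i, OF mono ev], of "ennreal u"]
      by (cases "departure_rate a y i < ennreal u") auto
  qed
  then show ?thesis using ev[of i]
  proof eventually_elim
    case (elim n)
    have "departure_rate a y i \<le> departure_rate a (x n) i" by (rule departure_rate_antimono[of "x n" y, OF xy elim(2)])
    then have "(\<exists>u. (t, u) \<in> De i \<and> ennreal u \<le> departure_rate a (x n) i)
      \<longleftrightarrow> (\<exists>u. (t, u) \<in> De i \<and> ennreal u \<le> departure_rate a y i)"
      using elim(1) by (meson leD not_le_imp_less order.trans mem_Collect_eq)
    then show ?case unfolding update_def using elim(2) by simp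
  qed
qed

text \<open>The operator at \<open>t\<close> and \<open>i\<close> reads its argument at one time
  only, the last event, and there the update is eventually exact along the iterates. So the limit of
  the iterates is already a fixed point.\<close>

lemma pre_plim: "pre s0 (plim s0) = plim s0"
proof (intro ext)
  fix t i
  let ?E = "{\<tau>. s0 < \<tau> \<and> \<tau> < t \<and> evt i \<tau>}"
  have "eventually (\<lambda>n. pre s0 (iter s0 n) t i = pre s0 (plim s0) t i) sequentially"
  proof (cases "?E = {}")
    case True then show ?thesis by (simp add: pre_step_def last_update_def)
  next
    case False
    then show ?thesis unfolding pre_step_def last_update_def if_not_P[OF False]
      by (intro eventually_upd_eq pre_iter_mono eventually_iter_eq)
  qed
  moreover have "eventually (\<lambda>n. iter s0 (Suc n) t i = plim s0 t i) sequentially"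
    using eventually_iter_eq[of s0 t i]
    by (subst eventually_sequentially_Suc[of "\<lambda>n. iter s0 n t i = plim s0 t i"])
  ultimately have "eventually (\<lambda>n::nat. pre s0 (plim s0) t i = plim s0 t i) sequentially"
    by eventually_elim (simp add: pre_iter_Suc)
  then show "pre s0 (plim s0) t i = plim s0 t i" by simp
qed

lemma plim_le_fixpoint:
  assumes "pre s0 Y = Y" shows "plim s0 t i \<le> Y t i"
  unfolding pre_limit_def by (intro cSUP_least pre_iter_le_fixpoint[OF assms]) auto


lemma post_eventually_left: "eventually (\<lambda>r. post s0 W r i = pre s0 W s i) (at_left s)"
proof -
  have "eventually (\<lambda>r. r < s) (at_left s)" by (simp add: eventually_at_filter)
  with eventually_no_event_left[of s i] show ?thesis
  proof eventually_elim
    case (elim r)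
    then have "{\<tau>. s0 < \<tau> \<and> \<tau> \<le> r \<and> evt i \<tau>} = {\<tau>. s0 < \<tau> \<and> \<tau> < s \<and> evt i \<tau>}"
      by (auto simp: not_le intro: leI)
    then show ?case by (simp add: post_step_def pre_step_def)
  qed
qed

lemma post_eventually_right: "eventually (\<lambda>r. post s0 W r i = post s0 W s i) (at_right s)"
proof -
  have "eventually (\<lambda>r. s < r) (at_right s)" by (simp add: eventually_at_filter)
  with eventually_no_event_right[of s i] show ?thesis
  proof eventually_elim
    case (elim r)
    then have "{\<tau>. s0 < \<tau> \<and> \<tau> \<le> r \<and> evt i \<tau>} = {\<tau>. s0 < \<tau> \<and> \<tau> \<le> s \<and> evt i \<tau>}"
      by (auto simp: not_le intro: leI)
    then show ?case by (simp add: post_step_def)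
  qed
qed

lemma post_eq_upd:
  assumes "s0 < s" "pre s0 W = W"
  shows "post s0 W s i = upd s (W s) i"
proof (cases "evt i s")
  case True
  have "Max {\<tau>. s0 < \<tau> \<and> \<tau> \<le> s \<and> evt i \<tau>} = s"
    using True assms(1) by (intro Max_eqI finite_events') auto
  moreover have "{\<tau>. s0 < \<tau> \<and> \<tau> \<le> s \<and> evt i \<tau>} \<noteq> {}" using True assms(1) by auto
  ultimately show ?thesis unfolding post_step_def last_update_def by (simp only: if_False)
next
  case False
  have "{\<tau>. s0 < \<tau> \<and> \<tau> \<le> s \<and> evt i \<tau>} = {\<tau>. s0 < \<tau> \<and> \<tau> < s \<and> evt i \<tau>}"
    using False by (auto simp: order.order_iff_strict)
  then have "post s0 W s i = pre s0 W s i" by (simp add: post_step_def pre_step_def)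
  then show ?thesis using assms(2) upd_no_event[OF False] by simp
qed

lemma left_value_eqI:
  assumes "eventually (\<lambda>r. X r i = w) (at_left s)"
  shows "left_value X s i = w"
  unfolding left_value_def
  using tendsto_eventually[OF assms] by (intro tendsto_Lim) auto

lemma left_value_post: "left_value (post s0 W) s i = pre s0 W s i"
  by (rule left_value_eqI) (rule post_eventually_left)

lemma queue_path_post:
  assumes "pre s0 W = W"
  shows "queue_path a Ar De s0 (\<lambda>_. 0) (post s0 W)"
proof -
  have L: "left_value (post s0 W) s = W s" for s
    using left_value_post[of s0 W s] assms by (auto simp: fun_eq_iff)
  have "post s0 W s = (\<lambda>_. 0)" if "s \<le> s0" for s
    using that by (auto simp: post_step_def last_update_def fun_eq_iff)
  moreover have "((\<lambda>r. post s0 W r i) \<longlongrightarrow> post s0 W s i) (at_right s)" for s i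
    by (rule tendsto_eventually[OF post_eventually_right])
  moreover have "((\<lambda>r. post s0 W r i) \<longlongrightarrow> W s i) (at_left s)" for s i
    using tendsto_eventually[OF post_eventually_left, of s0 W i s] assms by simp
  moreover have "post s0 W s i = W s i + of_bool (s \<in> Ar i)
      - of_bool (\<exists>u. (s, u) \<in> De i \<and> ennreal u \<le> departure_rate a (W s) i)" if "s0 < s" for s i
    using post_eq_upd[OF that assms] by (simp add: update_def)
  ultimately show ?thesis unfolding queue_path_def L by blast
qed

text \<open>Convergence in a discrete space is eventual equality. At a time without event the jump
  rule returns the left value, so the path is locally constant on \<open>{p..q}\<close>, and
  intervals are connected.\<close>

lemma queue_path_constant:
  assumes X: "queue_path a Ar De s0 x X" and pq: "s0 \<le> p" "p \<le> q"
    and no: "\<And>\<tau>. p < \<tau> \<Longrightarrow> \<tau> \<le> q \<Longrightarrow> \<not> evt i \<tau>"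
  shows "X q i = X p i"
proof (rule connected_local_const[where A="{p..q}" and f="\<lambda>r. X r i"])
  show "\<forall>s\<in>{p..q}. \<forall>\<^sub>F r in at s within {p..q}. X s i = X r i"
  proof
    fix s assume s: "s \<in> {p..q}"
    have "((\<lambda>r. X r i) \<longlongrightarrow> X s i) (at_right s)" using X by (simp add: queue_path_def)
    then have R: "eventually (\<lambda>r. X r i = X s i) (at_right s)" by (simp add: tendsto_discrete)
    show "\<forall>\<^sub>F r in at s within {p..q}. X s i = X r i"
    \<comment> \<open>At the endpoint \<open>p\<close> only right neighbours lie in
      \<open>{p..q}\<close>: right continuity suffices, and an event at \<open>p\<close> itself is
      allowed.\<close>
    proof (cases "s = p")
      case True
      then show ?thesis using R unfolding eventually_at_filter by (auto elim!: eventually_mono)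
    next
      case False
      then have "p < s" "s0 < s" "\<not> evt i s" using s pq no[of s] by auto
      then have "X s i = left_value X s i"
        using X upd_no_event[of i s "left_value X s"] by (simp add: queue_path_def update_def)
      moreover have "((\<lambda>r. X r i) \<longlongrightarrow> left_value X s i) (at_left s)" using X by (simp add: queue_path_def)
      ultimately have "eventually (\<lambda>r. X r i = X s i) (at_left s)" by (simp add: tendsto_discrete)
      with R have "eventually (\<lambda>r. X s i = X r i) (at s)"
        by (auto simp: eventually_at_split elim: eventually_mono)
      then show ?thesis by (rule filter_leD[OF at_le, rotated]) simp
    qed
  qed
qed (use pq in auto)

lemma queue_path_fixpoint:
  assumes X: "queue_path a Ar De s0 (\<lambda>_. 0) X"
  shows "X = post s0 (left_value X)" "pre s0 (left_value X) = left_value X"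
proof -
  have eq: "X s i = post s0 (left_value X) s i" for s i
  proof (cases "{\<tau>. s0 < \<tau> \<and> \<tau> \<le> s \<and> evt i \<tau>} = {}")
    case True
    have "X s i = 0"
    proof (cases "s \<le> s0")
      case True then show ?thesis using X by (simp add: queue_path_def)
    next
      case False
      then have "X s i = X s0 i" using True by (intro queue_path_constant[OF X]) auto
      then show ?thesis using X by (simp add: queue_path_def)
    qed
    then show ?thesis using True by (simp add: post_step_def last_update_def)
  next
    case False
    define m where "m = Max {\<tau>. s0 < \<tau> \<and> \<tau> \<le> s \<and> evt i \<tau>}"
    have m: "s0 < m" "m \<le> s" using Max_in[OF finite_events'(2) False] by (auto simp: m_def)
    have "\<not> evt i \<tau>" if "m < \<tau>" "\<tau> \<le> s" for \<tau>
    proof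
      assume "evt i \<tau>"
      then have "\<tau> \<le> m" unfolding m_def using that m by (intro Max_ge finite_events') auto
      then show False using that by simp
    qed
    then have "X s i = X m i" using m by (intro queue_path_constant[OF X]) auto
    also have "\<dots> = upd m (left_value X m) i" using X m by (simp add: queue_path_def update_def)
    also have "\<dots> = post s0 (left_value X) s i"
      unfolding post_step_def last_update_def if_not_P[OF False] m_def ..
    finally show ?thesis .
  qed
  then show *: "X = post s0 (left_value X)" by blast
  show "pre s0 (left_value X) = left_value X"
    using left_value_post[of s0 "left_value X"] *[symmetric] by (auto simp: fun_eq_iff)
qed

text \<open>Fixed points give trajectories by \<open>queue_path_post\<close>, and every trajectory
  arises so from its left values by \<open>queue_path_fixpoint\<close>. As \<open>post_step\<close>
  is monotone, the least fixed point yields the least trajectory.\<close>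

lemma queue_process_eq: "queue_process a Ar De s0 (\<lambda>_. 0) = post s0 (plim s0)"
  unfolding queue_process_def
proof (rule Least_equality)
  show "queue_path a Ar De s0 (\<lambda>_. 0) (post s0 (plim s0))" by (rule queue_path_post[OF pre_plim])
  fix X assume X: "queue_path a Ar De s0 (\<lambda>_. 0) X"
  show "post s0 (plim s0) \<le> X"
    by (subst queue_path_fixpoint(1)[OF X])
      (intro le_funI post_step_mono plim_le_fixpoint queue_path_fixpoint(2)[OF X])
qed

text \<open>An earlier start extends the window only downwards. If the later window contains an
  event, the last event is the same for both starts; otherwise the later start gives
  \<open>0\<close>.\<close>

lemma pre_antimono_start:
  assumes "s1 \<le> s0" "\<And>t j. W t j \<le> W' t j"
  shows "pre s0 W t i \<le> pre s1 W' t i"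
proof (cases "{\<tau>. s0 < \<tau> \<and> \<tau> < t \<and> evt i \<tau>} = {}")
  case True then show ?thesis by (simp add: pre_step_def last_update_def)
next
  case False
  let ?E = "\<lambda>s. {\<tau>. s < \<tau> \<and> \<tau> < t \<and> evt i \<tau>}"
  have in0: "Max (?E s0) \<in> ?E s0" by (rule Max_in[OF finite_events'(1) False])
  have Mx: "Max (?E s1) = Max (?E s0)"
  proof (rule Max_eqI)
    show "Max (?E s0) \<in> ?E s1" using in0 assms(1) by auto
    fix y assume y: "y \<in> ?E s1"
    show "y \<le> Max (?E s0)"
    proof (cases "s0 < y")
      case True then show ?thesis using y by (intro Max_ge finite_events') auto
    qed (use in0 in auto)
  qed (rule finite_events')
  have "?E s1 \<noteq> {}" using in0 assms(1) by auto
  then show ?thesis unfolding pre_step_def last_update_def if_not_P[OF False] using Mx assms(2)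
    by (simp only: if_False) (rule update_mono)
qed

lemma plim_antimono_start:
  assumes "s1 \<le> s0" shows "plim s0 t i \<le> plim s1 t i"
proof -
  have "iter s0 n t i \<le> iter s1 n t i" for n
  proof (induction n arbitrary: t i)
    case 0 then show ?case by (simp add: pre_iter_0)
  next
    case (Suc n) then show ?case unfolding pre_iter_Suc by (rule pre_antimono_start[OF assms])
  qed
  then have "iter s0 n t i \<le> plim s1 t i" for n using iter_le_plim order.trans by blast
  then show ?thesis unfolding pre_limit_def[of a Ar De s0] by (intro cSUP_least) auto
qed

lemma post_antimono_start:
  assumes "s1 \<le> s0" shows "post s0 (plim s0) t i \<le> post s1 (plim s1) t i"
proof (cases "s0 < t")
  case True
  then show ?thesis using assms
    by (auto simp: post_eq_upd pre_plim intro!: update_mono plim_antimono_start)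
next
  case False
  then have "{\<tau>. s0 < \<tau> \<and> \<tau> \<le> t \<and> evt i \<tau>} = {}" by auto
  then show ?thesis unfolding post_step_def[of a Ar De s0] last_update_def by simp
qed

end

section \<open>Measurability of random locally finite sets\<close>

definition point_space :: "'b::euclidean_space set \<Rightarrow> 'b set set" where
  "point_space E = {P. P \<subseteq> E \<and> locally_finite P}"

text \<open>Boundedness keeps the counts of a locally finite set finite; \<open>card\<close> would
  be \<open>0\<close> on an infinite set.\<close>

definition point_events :: "'b::euclidean_space set \<Rightarrow> 'b set set set" where
  "point_events E = {{P\<in>point_space E. card (P \<inter> B) = k} | B k. B \<in> sets borel \<and> bounded B}"

definition point_measure :: "'b::euclidean_space set \<Rightarrow> 'b set measure" where
  "point_measure E = sigma (point_space E) (point_events E)"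

lemma point_events_subset: "point_events E \<subseteq> Pow (point_space E)"
  by (auto simp: point_events_def)

lemma space_point_measure: "space (point_measure E) = point_space E"
  and sets_point_measure: "sets (point_measure E) = sigma_sets (point_space E) (point_events E)"
  using point_events_subset[of E] by (simp_all add: point_measure_def)

lemma count_measurable_point_measure:
  assumes "B \<in> sets borel" "bounded B"
  shows "(\<lambda>P. card (P \<inter> B)) \<in> measurable (point_measure E) (count_space UNIV)"
proof (subst measurable_count_space_eq_countable, simp, intro conjI ballI)
  fix k :: nat
  have "(\<lambda>P. card (P \<inter> B)) -` {k} \<inter> space (point_measure E) = {P\<in>point_space E. card (P \<inter> B) = k}"
    by (auto simp: space_point_measure)
  then have "(\<lambda>P. card (P \<inter> B)) -` {k} \<inter> space (point_measure E) \<in> point_events E"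
    using assms unfolding point_events_def by blast
  then show "(\<lambda>P. card (P \<inter> B)) -` {k} \<inter> space (point_measure E) \<in> sets (point_measure E)"
    by (auto simp: sets_point_measure)
qed auto

lemma measurable_point_measureI:
  assumes "\<And>y. y \<in> space N \<Longrightarrow> P y \<in> point_space E"
    and "\<And>B. B \<in> sets borel \<Longrightarrow> bounded B \<Longrightarrow> (\<lambda>y. card (P y \<inter> B)) \<in> measurable N (count_space UNIV)"
  shows "P \<in> measurable N (point_measure E)"
  unfolding point_measure_def
proof (rule measurable_measure_of)
  fix S assume "S \<in> point_events E"
  then obtain B k where S: "S = {P\<in>point_space E. card (P \<inter> B) = k}" "B \<in> sets borel" "bounded B"
    by (auto simp: point_events_def)
  have "P -` S \<inter> space N = (\<lambda>y. card (P y \<inter> B)) -` {k} \<inter> space N"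
    using assms(1) by (auto simp: S(1))
  then show "P -` S \<inter> space N \<in> sets N" using measurable_sets[OF assms(2)[OF S(2,3)], of "{k}"] by simp
qed (use assms(1) point_events_subset in auto)

text \<open>For rectangles the count is a count of \<open>P y\<close> in a fixed bounded set,
  switched on or off by \<open>y\<close>; a Dynkin argument extends this to all of the product.
  Cutting with the bounded \<open>K\<close> turns complements into subtraction of finite numbers,
  and the counting measure in place of \<open>card\<close> provides countable additivity.\<close>

lemma measurable_count_random_set:
  fixes P :: "'y \<Rightarrow> 'b::euclidean_space set"
  assumes fin: "\<And>y. y \<in> space N \<Longrightarrow> locally_finite (P y)"
    and cnt: "\<And>B. B \<in> sets borel \<Longrightarrow> bounded B \<Longrightarrow> (\<lambda>y. card (P y \<inter> B)) \<in> measurable N (count_space UNIV)"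
    and K: "K \<in> sets borel" "bounded K" and B: "B \<in> sets (borel \<Otimes>\<^sub>M N)"
  shows "(\<lambda>y. emeasure (count_space UNIV) {x\<in>P y \<inter> K. (x, y) \<in> B}) \<in> borel_measurable N"
proof -
  let ?G = "{U \<times> V | U V. U \<in> sets (borel :: 'b measure) \<and> V \<in> sets N}"
  let ?c = "\<lambda>B y. emeasure (count_space UNIV) {x\<in>P y \<inter> K. (x, y) \<in> B}"
  have finK: "finite (P y \<inter> K)" if "y \<in> space N" for y
    using fin[OF that] K by (simp add: locally_finite_def)
  have c_eq: "?c B y = ennreal (real (card {x\<in>P y \<inter> K. (x, y) \<in> B}))" if "y \<in> space N" for B y
  proof -
    have "finite {x\<in>P y \<inter> K. (x, y) \<in> B}" by (rule finite_subset[OF _ finK[OF that]]) auto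
    then show ?thesis by (subst emeasure_count_space_finite) (auto simp: ennreal_of_nat_eq_real_of_nat)
  qed
  have meas: "(\<lambda>y. ennreal (real (card (P y \<inter> K')))) \<in> borel_measurable N" if "K' \<in> sets borel" "bounded K'" for K'
  proof -
    have "(\<lambda>n::nat. ennreal (real n)) \<in> measurable (count_space UNIV) borel" by simp
    from measurable_compose[OF cnt[OF that] this] show ?thesis .
  qed
  have "Int_stable ?G" by (rule Int_stable_pair_measure_generator)
  moreover have "?G \<subseteq> Pow (space borel \<times> space N)" by (rule pair_measure_closed)
  moreover have "B \<in> sigma_sets (space borel \<times> space N) ?G" using B by (simp add: sets_pair_measure)
  ultimately show ?thesis
  proof (induction B rule: sigma_sets_induct_disjoint)
    case (basic B)
    then obtain U V where UV: "B = U \<times> V" "U \<in> sets borel" "V \<in> sets N" by auto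
    have "?c B y = ennreal (real (card (P y \<inter> (K \<inter> U)))) * indicator V y" if "y \<in> space N" for y
    proof -
      have "{x\<in>P y \<inter> K. (x, y) \<in> B} = (if y \<in> V then P y \<inter> (K \<inter> U) else {})" by (auto simp: UV)
      then show ?thesis using c_eq[OF that, of B] by (auto simp: indicator_def)
    qed
    moreover have "(\<lambda>y. ennreal (real (card (P y \<inter> (K \<inter> U)))) * indicator V y) \<in> borel_measurable N"
      using UV K by (intro borel_measurable_times_ennreal meas borel_measurable_indicator) (auto intro: bounded_subset)
    ultimately show ?case by (subst measurable_cong)
  next
    case empty then show ?case by simp
  next
    case (compl B)
    have "?c (space borel \<times> space N - B) y = ennreal (real (card (P y \<inter> K))) - ?c B y" if y: "y \<in> space N" for y
    proof -
      have "{x\<in>P y \<inter> K. (x, y) \<in> space borel \<times> space N - B} = (P y \<inter> K) - {x\<in>P y \<inter> K. (x, y) \<in> B}"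
        using y by auto
      moreover have fS: "finite {x\<in>P y \<inter> K. (x, y) \<in> B}" by (rule finite_subset[OF _ finK[OF y]]) auto
      moreover have "{x\<in>P y \<inter> K. (x, y) \<in> B} \<subseteq> P y \<inter> K" by auto
      ultimately have "card {x\<in>P y \<inter> K. (x, y) \<in> space borel \<times> space N - B}
          = card (P y \<inter> K) - card {x\<in>P y \<inter> K. (x, y) \<in> B}"
        "card {x\<in>P y \<inter> K. (x, y) \<in> B} \<le> card (P y \<inter> K)"
        using finK[OF y] by (simp_all only: card_Diff_subset card_mono)
      then show ?thesis unfolding c_eq[OF y] by (simp add: of_nat_diff ennreal_minus)
    qed
    moreover have "(\<lambda>y. ennreal (real (card (P y \<inter> K))) - ?c B y) \<in> borel_measurable N"
      using K compl by (intro borel_measurable_minus_ennreal meas)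
    ultimately show ?case by (subst measurable_cong)
  next
    case (union B)
    have "?c (\<Union>i. B i) y = (\<Sum>i. ?c (B i) y)" for y
    proof -
      have "{x\<in>P y \<inter> K. (x, y) \<in> (\<Union>i. B i)} = (\<Union>i. {x\<in>P y \<inter> K. (x, y) \<in> B i})" by auto
      then show ?thesis using union.hyps
        by (subst suminf_emeasure) (auto simp: disjoint_family_on_def)
    qed
    then show ?case using union by simp
  qed
qed

text \<open>An existential quantifier over a random locally finite set says that the count in some
  ball of integer radius is nonzero, which is a countable union. This replaces measurable selection
  of points.\<close>

lemma pred_ex_random_set:
  fixes P :: "'y \<Rightarrow> 'b::euclidean_space set"
  assumes P: "P \<in> measurable N (point_measure E)"
    and Q: "Measurable.pred (borel \<Otimes>\<^sub>M N) (\<lambda>(x, y). Q x y)"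
  shows "Measurable.pred N (\<lambda>y. \<exists>x\<in>P y. Q x y)"
proof -
  define B where "B = {z\<in>space (borel \<Otimes>\<^sub>M N). case z of (x, y) \<Rightarrow> Q x y}"
  have B: "B \<in> sets (borel \<Otimes>\<^sub>M N)" unfolding B_def using Q by (simp add: pred_def)
  have fin: "locally_finite (P y)" if "y \<in> space N" for y
    using measurable_space[OF P that] by (simp add: space_point_measure point_space_def)
  have "(\<lambda>y. emeasure (count_space UNIV) {x\<in>P y \<inter> cball 0 (real n). (x, y) \<in> B}) \<in> borel_measurable N" for n
    by (rule measurable_count_random_set[OF fin measurable_compose[OF P count_measurable_point_measure] _ _ B]) auto
  then have "Measurable.pred N (\<lambda>y. \<exists>n. emeasure (count_space UNIV) {x\<in>P y \<inter> cball 0 (real n). (x, y) \<in> B} \<noteq> 0)"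
    by measurable
  moreover have "(\<exists>n. emeasure (count_space UNIV) {x\<in>P y \<inter> cball 0 (real n). (x, y) \<in> B} \<noteq> 0) \<longleftrightarrow> (\<exists>x\<in>P y. Q x y)"
    if "y \<in> space N" for y
  proof -
    have "\<exists>n. x \<in> cball 0 (real n)" for x :: 'b using real_arch_simple[of "norm x"] by simp
    then show ?thesis using that by (fastforce simp: emeasure_count_space_eq_0 B_def space_pair_measure)
  qed
  ultimately show ?thesis by (subst measurable_cong) auto
qed

section \<open>The driving processes as a random configuration\<close>

text \<open>
  A configuration of the driving processes is one function on the disjoint sum of two copies of the
  sites; a set \<open>P\<close> of arrival times is encoded as \<open>P \<times> {0}\<close>.
\<close>

type_synonym 'i config = "'i + 'i \<Rightarrow> (real \<times> real) set"

definition arrivals :: "'i config \<Rightarrow> 'i \<Rightarrow> real set" where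
  "arrivals c i = fst ` c (Inl i)"

definition departures :: "'i config \<Rightarrow> 'i \<Rightarrow> (real \<times> real) set" where
  "departures c i = c (Inr i)"

abbreviation strip :: "(real \<times> real) set" where "strip \<equiv> UNIV \<times> {0..1}"

abbreviation config_measure :: "'i config measure" where
  "config_measure \<equiv> Pi\<^sub>M UNIV (\<lambda>_. point_measure strip)"

lemma config_coordinate: "c \<in> space config_measure \<Longrightarrow> c k \<in> point_space strip"
  by (auto simp: space_PiM space_point_measure)

lemma queue_driving_config:
  assumes "c \<in> space config_measure"
  shows "queue_driving (arrivals c) (departures c)"
proof
  fix i
  have c: "c k \<subseteq> strip" "locally_finite (c k)" for k
    using config_coordinate[OF assms, of k] by (auto simp: point_space_def)
  show "locally_finite (departures c i)" "departures c i \<subseteq> strip" using c by (simp_all add: departures_def)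
  show "locally_finite (arrivals c i)"
    unfolding locally_finite_def
  proof (intro allI impI)
    fix B :: "real set" assume "bounded B"
    then have "finite (fst ` (c (Inl i) \<inter> B \<times> {0..1}))"
      using c(2) by (intro finite_imageI) (simp add: locally_finite_def bounded_Times)
    moreover have "arrivals c i \<inter> B \<subseteq> fst ` (c (Inl i) \<inter> B \<times> {0..1})"
      using c(1)[of "Inl i"] by (force simp: arrivals_def)
    ultimately show "finite (arrivals c i \<inter> B)" by (rule rev_finite_subset)
  qed
qed

lemma event_config:
  "event (arrivals c) (departures c) i t \<longleftrightarrow> (\<exists>x\<in>c (Inl i). fst x = t) \<or> (\<exists>x\<in>c (Inr i). fst x = t)"
  by (auto simp: event_def arrivals_def departures_def image_iff) force+

lemma measurable_config_coordinate:
  "g \<in> measurable N config_measure \<Longrightarrow> (\<lambda>y. g y k) \<in> measurable N (point_measure strip)"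
  by (rule measurable_compose[OF _ measurable_component_singleton]) auto

lemma pred_ex_event:
  assumes g: "g \<in> measurable N (config_measure :: 'i config measure)"
    and Q: "Measurable.pred (borel \<Otimes>\<^sub>M N) (\<lambda>(t, y). Q t y)"
  shows "Measurable.pred N (\<lambda>y. \<exists>t. event (arrivals (g y)) (departures (g y)) i t \<and> Q t y)"
proof -
  have "(\<lambda>(x :: real \<times> real, y). (fst x, y)) \<in> measurable (borel \<Otimes>\<^sub>M N) (borel \<Otimes>\<^sub>M N)"
    unfolding borel_prod[symmetric] by measurable
  from measurable_compose[OF this Q]
  have Q': "Measurable.pred (borel \<Otimes>\<^sub>M N) (\<lambda>(x :: real \<times> real, y). Q (fst x) y)"
    by (simp add: case_prod_beta')
  have "(\<exists>t. event (arrivals (g y)) (departures (g y)) i t \<and> Q t y) \<longleftrightarrow>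
    (\<exists>x\<in>g y (Inl i). Q (fst x) y) \<or> (\<exists>x\<in>g y (Inr i). Q (fst x) y)" for y
    unfolding event_config by blast
  moreover have "Measurable.pred N (\<lambda>y. (\<exists>x\<in>g y (Inl i). Q (fst x) y) \<or> (\<exists>x\<in>g y (Inr i). Q (fst x) y))"
    using pred_ex_random_set[OF measurable_config_coordinate[OF g] Q'] by (intro pred_intros_logic) auto
  ultimately show ?thesis by simp
qed

lemma measurable_nat_iff_pred:
  "f \<in> measurable N (count_space (UNIV :: nat set)) \<longleftrightarrow> (\<forall>k. Measurable.pred N (\<lambda>y. f y = k))"
  by (subst measurable_count_space_eq_countable)
     (auto simp: pred_def vimage_def Int_def conj_commute)

text \<open>A nonnegative infinite sum is the supremum over finite index sets, of which there are
  countably many because the sites are countable.\<close>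

lemma measurable_departure_rate:
  fixes a :: "'i::{ab_group_add, countable} \<Rightarrow> real"
  assumes W: "\<And>j. (\<lambda>y. W y j) \<in> measurable N (count_space (UNIV :: nat set))"
  shows "(\<lambda>y. departure_rate a (W y) i) \<in> borel_measurable N"
proof -
  have m: "(\<lambda>y. of_nat (W y j) :: ennreal) \<in> borel_measurable N" for j
    using measurable_compose[OF W[of j], of "of_nat" borel] by simp
  have "(\<lambda>y. \<Sum>\<^sub>\<infinity>j. ennreal (a j) * of_nat (W y (i - j))) \<in> borel_measurable N"
    by (subst nonneg_infsum_complete, simp)
      (intro borel_measurable_SUP borel_measurable_sum borel_measurable_times_ennreal m borel_measurable_const,
        auto intro: countable_subset[OF _ countable_Collect_finite])
  then show ?thesis unfolding departure_rate_def by (intro borel_measurable_divide_ennreal m)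
qed

lemma measurable_fst_fst [measurable]:
    "(\<lambda>z. fst (fst z)) \<in> borel_measurable ((borel :: (real \<times> real) measure) \<Otimes>\<^sub>M N)"
  and measurable_snd_fst [measurable]:
    "(\<lambda>z. snd (fst z)) \<in> borel_measurable ((borel :: (real \<times> real) measure) \<Otimes>\<^sub>M N)"
  unfolding borel_prod[symmetric] by measurable

lemma measurable_update:
  fixes a :: "'i::{ab_group_add, countable} \<Rightarrow> real"
  assumes g: "g \<in> measurable N (config_measure :: 'i config measure)"
    and t: "t \<in> borel_measurable N"
    and W: "\<And>j. (\<lambda>y. W y j) \<in> measurable N (count_space (UNIV :: nat set))"
  shows "(\<lambda>y. update a (arrivals (g y)) (departures (g y)) (t y) (W y) i) \<in> measurable N (count_space UNIV)"
proof -
  define r where "r y = departure_rate a (W y) i" for y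
  have [measurable]: "r \<in> borel_measurable N" "t \<in> borel_measurable N"
    unfolding r_def using measurable_departure_rate[of W N a i, OF W] t by simp_all
  have "Measurable.pred (borel \<Otimes>\<^sub>M N) (\<lambda>z. fst (fst z :: real \<times> real) = t (snd z))"
    "Measurable.pred (borel \<Otimes>\<^sub>M N) (\<lambda>z. fst (fst z :: real \<times> real) = t (snd z) \<and> ennreal (snd (fst z)) \<le> r (snd z))"
    by measurable
  then have 1: "Measurable.pred N (\<lambda>y. \<exists>x\<in>g y (Inl i). fst x = t y)"
    and 2: "Measurable.pred N (\<lambda>y. \<exists>x\<in>g y (Inr i). fst x = t y \<and> ennreal (snd x) \<le> departure_rate a (W y) i)"
    by (intro pred_ex_random_set[OF measurable_config_coordinate[OF g]]; simp add: case_prod_beta' r_def)+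
  have "update a (arrivals (g y)) (departures (g y)) (t y) (W y) i = W y i
      + (if \<exists>x\<in>g y (Inl i). fst x = t y then 1 else 0)
      - (if \<exists>x\<in>g y (Inr i). fst x = t y \<and> ennreal (snd x) \<le> departure_rate a (W y) i then 1 else 0)" for y
    unfolding update_def arrivals_def departures_def of_bool_def by (force simp: image_iff)
  then show ?thesis using W[of i] 1 2 by simp
qed

text \<open>The latest event is not constructed as a random variable: the value is \<open>k\<close>
  iff some event in the window has no later one there and its update is \<open>k\<close>, or there
  is none and \<open>k = 0\<close>. Such quantifiers over events are measurable. \<open>W\<close>
  must be jointly measurable since it is read at a random time.\<close>

lemma measurable_last_update:
  fixes a :: "'i::{ab_group_add, countable} \<Rightarrow> real"
  assumes g: "g \<in> measurable N (config_measure :: 'i config measure)"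
    and W: "\<And>j. (\<lambda>(t, c). W c t j) \<in> measurable (borel \<Otimes>\<^sub>M config_measure) (count_space (UNIV :: nat set))"
    and L: "Measurable.pred (borel \<Otimes>\<^sub>M N) (\<lambda>(t, y). L t y)"
    and fin: "\<And>y. y \<in> space N \<Longrightarrow> finite {t. L t y \<and> event (arrivals (g y)) (departures (g y)) i t}"
  shows "(\<lambda>y. last_update a (arrivals (g y)) (departures (g y)) (W (g y)) i
      {t. L t y \<and> event (arrivals (g y)) (departures (g y)) i t}) \<in> measurable N (count_space UNIV)"
  unfolding measurable_nat_iff_pred
proof
  fix k
  let ?e = "\<lambda>y t. event (arrivals (g y)) (departures (g y)) i t"
  let ?U = "\<lambda>t y. update a (arrivals (g y)) (departures (g y)) t (W (g y) t) i"
  have g': "(\<lambda>(t, y). g y) \<in> measurable (borel \<Otimes>\<^sub>M N) config_measure"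
    using g by measurable
  have W': "(\<lambda>(t, y). W (g y) t j) \<in> measurable (borel \<Otimes>\<^sub>M N) (count_space UNIV)" for j
  proof -
    have "(\<lambda>(t, y). (t, g y)) \<in> measurable (borel \<Otimes>\<^sub>M N) (borel \<Otimes>\<^sub>M config_measure)"
      using g by measurable
    from measurable_compose[OF this W[of j]] show ?thesis by (simp add: case_prod_beta')
  qed
  have U: "(\<lambda>(t, y). ?U t y) \<in> measurable (borel \<Otimes>\<^sub>M N) (count_space UNIV)"
    using measurable_update[of "\<lambda>(t, y). g y" "borel \<Otimes>\<^sub>M N" fst "\<lambda>(t, y). W (g y) t", OF g' _] W'
    by (simp add: case_prod_beta')
  have L': "Measurable.pred (borel \<Otimes>\<^sub>M (borel \<Otimes>\<^sub>M N)) (\<lambda>(t', t, y). L t' y \<and> t < t')"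
  proof -
    have "(\<lambda>(t', t, y). (t', y)) \<in> measurable (borel \<Otimes>\<^sub>M (borel \<Otimes>\<^sub>M N)) (borel \<Otimes>\<^sub>M N)" by measurable
    from measurable_compose[OF this L]
    have "Measurable.pred (borel \<Otimes>\<^sub>M (borel \<Otimes>\<^sub>M N)) (\<lambda>x. L (fst x) (snd (snd x)))"
      by (simp add: case_prod_beta')
    moreover have "Measurable.pred (borel \<Otimes>\<^sub>M (borel \<Otimes>\<^sub>M N)) (\<lambda>x. fst (snd x) < (fst x :: real))"
      by measurable
    ultimately show ?thesis unfolding case_prod_beta' by (rule pred_intros_logic)
  qed
  have no_later: "Measurable.pred (borel \<Otimes>\<^sub>M N) (\<lambda>(t, y). \<not> (\<exists>t'. ?e y t' \<and> L t' y \<and> t < t'))"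
  proof -
    have "Measurable.pred (borel \<Otimes>\<^sub>M N) (\<lambda>z. \<exists>t'. ?e (snd z) t' \<and> L t' (snd z) \<and> fst z < t')"
      using pred_ex_event[OF g', of "\<lambda>t' z. L t' (snd z) \<and> fst z < t'" i] L'
      by (simp add: case_prod_beta')
    from pred_intros_logic(2)[OF this] show ?thesis unfolding case_prod_beta' .
  qed
  have "Measurable.pred N (\<lambda>y. (\<not> (\<exists>t. ?e y t \<and> L t y) \<and> k = 0) \<or>
     (\<exists>t. ?e y t \<and> (L t y \<and> \<not> (\<exists>t'. ?e y t' \<and> L t' y \<and> t < t') \<and> ?U t y = k)))"
  proof -
    have "Measurable.pred (borel \<Otimes>\<^sub>M N) (\<lambda>(t, y). L t y \<and> \<not> (\<exists>t'. ?e y t' \<and> L t' y \<and> t < t') \<and> ?U t y = k)"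
      using L no_later U[unfolded measurable_nat_iff_pred, rule_format, of k]
      unfolding case_prod_beta' by (intro pred_intros_logic(3))
    from pred_ex_event[OF g this] pred_ex_event[OF g L] show ?thesis
      by (intro pred_intros_logic) auto
  qed
  moreover have "last_update a (arrivals (g y)) (departures (g y)) (W (g y)) i {t. L t y \<and> ?e y t} = k \<longleftrightarrow>
     (\<not> (\<exists>t. ?e y t \<and> L t y) \<and> k = 0) \<or>
     (\<exists>t. ?e y t \<and> (L t y \<and> \<not> (\<exists>t'. ?e y t' \<and> L t' y \<and> t < t') \<and> ?U t y = k))"
    if y: "y \<in> space N" for y
  proof (cases "{t. L t y \<and> ?e y t} = {}")
    case True then show ?thesis unfolding last_update_def by auto
  next
    case False
    define m where "m = Max {t. L t y \<and> ?e y t}"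
    have m: "L m y" "?e y m" using Max_in[OF fin[OF y] False] by (auto simp: m_def)
    have le: "t \<le> m" if "L t y" "?e y t" for t unfolding m_def using that by (intro Max_ge fin[OF y]) auto
    have "t = m" if "?e y t" "L t y" "\<not> (\<exists>t'. ?e y t' \<and> L t' y \<and> t < t')" for t
      using le[OF that(2,1)] that(3) m by (auto simp: order.order_iff_strict)
    then have "(\<exists>t. ?e y t \<and> (L t y \<and> \<not> (\<exists>t'. ?e y t' \<and> L t' y \<and> t < t') \<and> ?U t y = k)) \<longleftrightarrow> ?U m y = k"
      using m le by (metis not_le)
    moreover have "last_update a (arrivals (g y)) (departures (g y)) (W (g y)) i {t. L t y \<and> ?e y t} = ?U m y"
      unfolding last_update_def if_not_P[OF False] m_def ..
    ultimately show ?thesis using False by auto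
  qed
  ultimately show "Measurable.pred N (\<lambda>y. last_update a (arrivals (g y)) (departures (g y)) (W (g y)) i {t. L t y \<and> ?e y t} = k)"
    by (rule measurable_cong[THEN iffD2, rotated])
qed

text \<open>The time \<open>t\<close> is a parameter of the measurable space because the next
  iterate evaluates this one at its last event time.\<close>

lemma measurable_pre_iter:
  fixes a :: "'i::{ab_group_add, countable} \<Rightarrow> real"
  shows "(\<lambda>(t, c). pre_iter a (arrivals c) (departures c) s0 n t i)
    \<in> measurable (borel \<Otimes>\<^sub>M config_measure) (count_space UNIV)"
proof (induction n arbitrary: i)
  case 0 then show ?case by (simp add: pre_iter_0 case_prod_beta')
next
  case (Suc n)
  have "(\<lambda>y. last_update a (arrivals (snd y)) (departures (snd y))
       (pre_iter a (arrivals (snd y)) (departures (snd y)) s0 n) i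
       {\<tau>. (s0 < \<tau> \<and> \<tau> < fst y) \<and> event (arrivals (snd y)) (departures (snd y)) i \<tau>})
    \<in> measurable (borel \<Otimes>\<^sub>M config_measure) (count_space UNIV)"
  proof (rule measurable_last_update)
    fix y :: "real \<times> 'i config" assume "y \<in> space (borel \<Otimes>\<^sub>M config_measure)"
    then interpret queue_driving a "arrivals (snd y)" "departures (snd y)"
      by (intro queue_driving_config) (simp add: space_pair_measure mem_Times_iff)
    show "finite {\<tau>. (s0 < \<tau> \<and> \<tau> < fst y) \<and> evt i \<tau>}"
      using finite_events'(1)[of s0 "fst y" i] by (simp add: conj_assoc)
  qed (use Suc in \<open>simp_all, measurable\<close>)
  then show ?case by (simp add: pre_iter_Suc pre_step_def case_prod_beta' conj_assoc)
qed

lemma measurable_pre_limit: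
  fixes a :: "'i::{ab_group_add, countable} \<Rightarrow> real"
  shows "(\<lambda>(t, c). pre_limit a (arrivals c) (departures c) s0 t i)
    \<in> measurable (borel \<Otimes>\<^sub>M config_measure) (count_space UNIV)"
  unfolding measurable_nat_iff_pred
proof
  fix k
  have "Measurable.pred (borel \<Otimes>\<^sub>M config_measure) (\<lambda>y. \<exists>N. \<forall>n\<ge>N. (\<lambda>(t, c). pre_iter a (arrivals c) (departures c) s0 n t i) y = k)"
    using measurable_pre_iter[unfolded measurable_nat_iff_pred, rule_format] by measurable
  moreover have "(\<exists>N. \<forall>n\<ge>N. (\<lambda>(t, c). pre_iter a (arrivals c) (departures c) s0 n t i) y = k) \<longleftrightarrow>
    (\<lambda>(t, c). pre_limit a (arrivals c) (departures c) s0 t i) y = k"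
    if "y \<in> space (borel \<Otimes>\<^sub>M config_measure)" for y
  proof -
    obtain t c where y: "y = (t, c)" by (cases y)
    then have "c \<in> space config_measure" using that by (simp add: space_pair_measure)
    then interpret queue_driving a "arrivals c" "departures c" by (rule queue_driving_config)
    obtain N where N: "\<And>n. N \<le> n \<Longrightarrow> iter s0 n t i = plim s0 t i"
      using eventually_iter_eq unfolding eventually_sequentially by blast
    show ?thesis unfolding y case_prod_conv
    proof
      assume "\<exists>N. \<forall>n\<ge>N. iter s0 n t i = k"
      then obtain M where "\<And>n. M \<le> n \<Longrightarrow> iter s0 n t i = k" by blast
      from this[of "max M N"] N[of "max M N"] show "plim s0 t i = k" by simp
    qed (use N in blast)
  qed
  ultimately show "Measurable.pred (borel \<Otimes>\<^sub>M config_measure) (\<lambda>y. (\<lambda>(t, c). pre_limit a (arrivals c) (departures c) s0 t i) y = k)"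
    by (rule measurable_cong[THEN iffD1, rotated])
qed

lemma measurable_queue_process:
  fixes a :: "'i::{ab_group_add, countable} \<Rightarrow> real"
  shows "(\<lambda>c. queue_process a (arrivals c) (departures c) s0 (\<lambda>_. 0) s i)
    \<in> measurable config_measure (count_space UNIV)"
proof -
  have "(\<lambda>c. last_update a (arrivals c) (departures c) (pre_limit a (arrivals c) (departures c) s0) i
       {\<tau>. (s0 < \<tau> \<and> \<tau> \<le> s) \<and> event (arrivals c) (departures c) i \<tau>})
    \<in> measurable config_measure (count_space UNIV)"
  proof (rule measurable_last_update[where g="\<lambda>c. c"])
    fix c :: "'i config" assume "c \<in> space config_measure"
    then interpret queue_driving a "arrivals c" "departures c" by (intro queue_driving_config)
    show "finite {\<tau>. (s0 < \<tau> \<and> \<tau> \<le> s) \<and> evt i \<tau>}"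
      using finite_events'(2)[of s0 s i] by (simp add: conj_assoc)
  qed (use measurable_pre_limit in \<open>simp_all, measurable\<close>)
  moreover have "queue_process a (arrivals c) (departures c) s0 (\<lambda>_. 0) s i =
     last_update a (arrivals c) (departures c) (pre_limit a (arrivals c) (departures c) s0) i
       {\<tau>. (s0 < \<tau> \<and> \<tau> \<le> s) \<and> event (arrivals c) (departures c) i \<tau>}"
    if "c \<in> space config_measure" for c
  proof -
    interpret queue_driving a "arrivals c" "departures c" by (rule queue_driving_config[OF that])
    show ?thesis by (simp add: queue_process_eq post_step_def conj_assoc)
  qed
  ultimately show ?thesis by (rule measurable_cong[THEN iffD2, rotated])
qed

text \<open>Monotonicity squeezes the values at real times between those at integers, so convergence
  is detected by countable quantifiers. The term \<open>THE l. False\<close> is the value of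
  \<open>Lim\<close> when nothing qualifies as a limit.\<close>

lemma Lim_at_top_mono_nat:
  fixes h :: "real \<Rightarrow> nat"
  assumes "mono h"
  shows "Lim at_top h = k \<longleftrightarrow> (\<exists>N. \<forall>n\<ge>N. h (real n) = k) \<or>
    (\<not> (\<exists>l N. \<forall>n\<ge>N. h (real n) = l) \<and> k = (THE l. False))"
proof -
  have conv: "(h \<longlongrightarrow> l) at_top \<longleftrightarrow> (\<exists>N. \<forall>n\<ge>N. h (real n) = l)" for l
  proof
    assume "(h \<longlongrightarrow> l) at_top"
    then have "eventually (\<lambda>t. h t = l) at_top" by (simp add: tendsto_discrete)
    then obtain b where b: "\<And>t. b \<le> t \<Longrightarrow> h t = l" unfolding eventually_at_top_linorder by blast
    obtain N :: nat where "b \<le> real N" using real_arch_simple by blast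
    then show "\<exists>N. \<forall>n\<ge>N. h (real n) = l" by (intro exI[of _ N] allI impI b) linarith
  next
    assume "\<exists>N. \<forall>n\<ge>N. h (real n) = l"
    then obtain N where N: "\<And>n. N \<le> n \<Longrightarrow> h (real n) = l" by blast
    have "h t = l" if t: "real N \<le> t" for t
    proof (rule antisym)
      obtain n :: nat where "t \<le> real n" using real_arch_simple by blast
      then show "h t \<le> l" using monoD[OF assms] N[of n] t by (metis of_nat_le_iff order.trans)
      show "l \<le> h t" using monoD[OF assms t] N[of N] by simp
    qed
    then have "eventually (\<lambda>t. h t = l) at_top" unfolding eventually_at_top_linorder by blast
    then show "(h \<longlongrightarrow> l) at_top" by (rule tendsto_eventually)
  qed
  show ?thesis
  proof (cases "\<exists>l. (h \<longlongrightarrow> l) at_top")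
    case True
    then obtain l where l: "(h \<longlongrightarrow> l) at_top" by blast
    have "Lim at_top h = k \<longleftrightarrow> (h \<longlongrightarrow> k) at_top"
      using tendsto_Lim[of at_top h k] tendsto_Lim[of at_top h l] l by auto
    then show ?thesis using l conv by blast
  next
    case False
    then have "Lim at_top h = (THE l. False)" by (simp add: t2_space_class.Lim_def)
    moreover have "\<not> (\<exists>l N. \<forall>n\<ge>N. h (real n) = l)" using False conv by blast
    ultimately show ?thesis by metis
  qed
qed

lemma queue_from_past_mono:
  assumes "c \<in> space config_measure"
  shows "mono (\<lambda>t. queue_from_past a (arrivals c) (departures c) t s i)"
proof -
  interpret queue_driving a "arrivals c" "departures c" by (rule queue_driving_config[OF assms])
  show ?thesis unfolding queue_from_past_def queue_process_eq
    by (intro monoI post_antimono_start) simp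
qed

definition cftp :: "('i::ab_group_add \<Rightarrow> real) \<Rightarrow> real \<Rightarrow> 'i config \<Rightarrow> 'i \<Rightarrow> nat" where
  "cftp a s c = queue_from_infinite_past a (arrivals c) (departures c) s"

lemma measurable_cftp:
  fixes a :: "'i::{ab_group_add, countable} \<Rightarrow> real"
  shows "cftp a s \<in> borel_measurable config_measure"
proof -
  have "(\<lambda>c. cftp a s c i) \<in> measurable config_measure (count_space UNIV)" for i
    unfolding measurable_nat_iff_pred
  proof
    fix k
    let ?h = "\<lambda>c t. queue_from_past a (arrivals c) (departures c) t s i"
    have h: "(\<lambda>c. ?h c t) \<in> measurable config_measure (count_space UNIV)" for t
      unfolding queue_from_past_def by (rule measurable_queue_process)
    from h[unfolded measurable_nat_iff_pred, rule_format] have "Measurable.pred config_measure (\<lambda>c. (\<exists>N::nat. \<forall>n\<ge>N. ?h c (real n) = k) \<or>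
      (\<not> (\<exists>l N. \<forall>n\<ge>N. ?h c (real n) = l) \<and> k = (THE l. False)))"
      by measurable
    moreover have "cftp a s c i = k \<longleftrightarrow> (\<exists>N::nat. \<forall>n\<ge>N. ?h c (real n) = k) \<or>
      (\<not> (\<exists>l N. \<forall>n\<ge>N. ?h c (real n) = l) \<and> k = (THE l. False))"
      if "c \<in> space config_measure" for c
      unfolding cftp_def queue_from_infinite_past_def
      by (rule Lim_at_top_mono_nat[OF queue_from_past_mono[OF that]])
    ultimately show "Measurable.pred config_measure (\<lambda>c. cftp a s c i = k)"
      by (rule measurable_cong[THEN iffD2, rotated])
  qed
  \<comment> \<open>On the discrete space of naturals every set is Borel, and over countably many
    sites coordinatewise measurability gives Borel measurability for the product topology.\<close>
  then have "(\<lambda>c. cftp a s c i) \<in> borel_measurable config_measure" for i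
    by (subst measurable_cong_sets[OF refl sets_borel_eq_count_space])
  then show ?thesis by (rule measurable_coordinatewise_then_product)
qed

section \<open>Equivariance under translations of the sites\<close>

definition relabel :: "'i::ab_group_add \<Rightarrow> 'i + 'i \<Rightarrow> 'i + 'i" where
  "relabel j = map_sum (\<lambda>i. i + j) (\<lambda>i. i + j)"

lemma arrivals_relabel: "arrivals (\<lambda>k. c (relabel j k)) = (\<lambda>i. arrivals c (i + j))"
  and departures_relabel: "departures (\<lambda>k. c (relabel j k)) = (\<lambda>i. departures c (i + j))"
  by (auto simp: arrivals_def departures_def relabel_def fun_eq_iff)

lemma departure_rate_translate: "departure_rate a (\<lambda>l. x (l + j)) i = departure_rate a x (i + j)"
  by (simp add: departure_rate_def algebra_simps)

lemma last_update_translate: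
  "last_update a (\<lambda>i. Ar (i + j)) (\<lambda>i. De (i + j)) (\<lambda>t i. W t (i + j)) i E = last_update a Ar De W (i + j) E"
  by (simp add: last_update_def update_def departure_rate_translate)

lemma event_translate: "event (\<lambda>i. Ar (i + j)) (\<lambda>i. De (i + j)) i t \<longleftrightarrow> event Ar De (i + j) t"
  by (simp add: event_def)

lemma pre_iter_translate:
  "pre_iter a (\<lambda>i. Ar (i + j)) (\<lambda>i. De (i + j)) s0 n = (\<lambda>t i. pre_iter a Ar De s0 n t (i + j))"
proof (induction n)
  case 0 then show ?case by (simp add: pre_iter_0 fun_eq_iff)
next
  case (Suc n)
  show ?case
    by (intro ext) (unfold pre_iter_Suc pre_step_def Suc.IH event_translate last_update_translate, rule refl)
qed

text \<open>Both sides are compared through the explicit formula \<open>queue_process_eq\<close>,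
  which involves positions only through differences of sites. For every starting time the processes
  agree after the shift, so \<open>Lim\<close> receives the same function.\<close>

lemma cftp_relabel:
  assumes "c \<in> space config_measure" "(\<lambda>k. c (relabel j k)) \<in> space config_measure"
  shows "cftp a s (\<lambda>k. c (relabel j k)) = translate j (cftp a s c)"
proof -
  interpret q: queue_driving a "arrivals c" "departures c" by (rule queue_driving_config[OF assms(1)])
  interpret q': queue_driving a "arrivals (\<lambda>k. c (relabel j k))" "departures (\<lambda>k. c (relabel j k))"
    by (rule queue_driving_config[OF assms(2)])
  have lim: "pre_limit a (\<lambda>i. arrivals c (i + j)) (\<lambda>i. departures c (i + j)) s0
    = (\<lambda>t i. pre_limit a (arrivals c) (departures c) s0 t (i + j))" for s0
    by (simp add: pre_limit_def fun_eq_iff pre_iter_translate)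
  have "queue_process a (arrivals (\<lambda>k. c (relabel j k))) (departures (\<lambda>k. c (relabel j k))) s0 (\<lambda>_. 0) t i
    = queue_process a (arrivals c) (departures c) s0 (\<lambda>_. 0) t (i + j)" for s0 t i
    unfolding q.queue_process_eq q'.queue_process_eq
    unfolding arrivals_relabel departures_relabel lim post_step_def event_translate
    by (rule last_update_translate)
  then show ?thesis
    by (simp add: cftp_def queue_from_infinite_past_def queue_from_past_def translate_def fun_eq_iff)
qed

section \<open>The law of the driving processes\<close>

lemma poisson_point_processD:
  assumes "poisson_point_process M E c P" "E \<in> sets borel"
  shows "\<And>\<omega>. \<omega> \<in> space M \<Longrightarrow> P \<omega> \<in> point_space E"
    and "\<And>B. B \<in> sets borel \<Longrightarrow> bounded B \<Longrightarrow> (\<lambda>\<omega>. card (P \<omega> \<inter> B)) \<in> measurable M (count_space UNIV)"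
proof -
  show P: "\<And>\<omega>. \<omega> \<in> space M \<Longrightarrow> P \<omega> \<in> point_space E"
    using assms(1) by (auto simp: poisson_point_process_def point_space_def locally_finite_def)
  fix B :: "'b set" assume B: "B \<in> sets borel" "bounded B"
  have "(\<lambda>\<omega>. card (P \<omega> \<inter> (B \<inter> E))) \<in> measurable M (count_space UNIV)"
    using assms B bounded_subset[of B "B \<inter> E"] by (simp add: poisson_point_process_def)
  moreover have "P \<omega> \<inter> B = P \<omega> \<inter> (B \<inter> E)" if "\<omega> \<in> space M" for \<omega>
    using P[OF that] by (auto simp: point_space_def)
  ultimately show "(\<lambda>\<omega>. card (P \<omega> \<inter> B)) \<in> measurable M (count_space UNIV)"
    by (simp cong: measurable_cong)
qed

text \<open>Independence makes the joint law a product of marginals, and the Poisson weights fix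
  each marginal; both depend on the process only through \<open>E\<close> and
  \<open>c\<close>.\<close>

lemma poisson_disjoint_counts_distr:
  fixes E :: "'b::euclidean_space set"
  assumes M: "prob_space M" and P: "poisson_point_process M E c P" and P': "poisson_point_process M E c P'"
    and B: "\<And>j. j < N \<Longrightarrow> B j \<in> sets borel \<and> bounded (B j) \<and> B j \<subseteq> E"
    and disj: "disjoint_family_on B {..<N::nat}" and N: "0 < N"
  shows "distr M (Pi\<^sub>M {..<N} (\<lambda>_. count_space UNIV)) (\<lambda>\<omega>. \<lambda>j\<in>{..<N}. card (P \<omega> \<inter> B j))
    = distr M (Pi\<^sub>M {..<N} (\<lambda>_. count_space UNIV)) (\<lambda>\<omega>. \<lambda>j\<in>{..<N}. card (P' \<omega> \<inter> B j))"
proof -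
  interpret prob_space M by (rule M)
  define C where "C Q j \<omega> = card (Q \<omega> \<inter> B j)" for Q :: "'a \<Rightarrow> 'b set" and j \<omega>
  have meas: "C Q j \<in> measurable M (count_space UNIV)" if "poisson_point_process M E c Q" "j < N" for Q j
    using that B[of j] by (simp add: poisson_point_process_def C_def[abs_def])
  have prod: "distr M (Pi\<^sub>M {..<N} (\<lambda>_. count_space UNIV)) (\<lambda>\<omega>. \<lambda>j\<in>{..<N}. C Q j \<omega>)
    = Pi\<^sub>M {..<N} (\<lambda>j. distr M (count_space UNIV) (C Q j))" if Q: "poisson_point_process M E c Q" for Q
  proof -
    have "indep_vars (\<lambda>_. count_space UNIV) (C Q) {..<N}"
      using Q B disj unfolding poisson_point_process_def C_def[abs_def] by blast
    then show ?thesis using indep_vars_iff_distr_eq_PiM'[where I="{..<N}" and M'="\<lambda>_. count_space UNIV" and X="C Q"] meas[OF Q] N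
      by auto
  qed
  have marg: "distr M (count_space UNIV) (C P j) = distr M (count_space UNIV) (C P' j)" if "j < N" for j
  proof (rule measure_eqI_countable[of _ UNIV])
    fix k
    have "emeasure (distr M (count_space UNIV) (C Q j)) {k} =
      ennreal (exp (- (c * measure lborel (B j))) * (c * measure lborel (B j)) ^ k / fact k)"
      if Q: "poisson_point_process M E c Q" for Q
    proof -
      have "emeasure (distr M (count_space UNIV) (C Q j)) {k} = emeasure M {\<omega>\<in>space M. card (Q \<omega> \<inter> B j) = k}"
        using meas[OF Q \<open>j < N\<close>] by (subst emeasure_distr) (auto simp: C_def intro!: arg_cong[where f="emeasure M"])
      then show ?thesis using Q B[OF \<open>j < N\<close>] by (simp add: emeasure_eq_measure poisson_point_process_def)
    qed
    then show "emeasure (distr M (count_space UNIV) (C P j)) {k} = emeasure (distr M (count_space UNIV) (C P' j)) {k}"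
      using P P' by simp
  qed auto
  have "Pi\<^sub>M {..<N} (\<lambda>j. distr M (count_space UNIV) (C P j)) = Pi\<^sub>M {..<N} (\<lambda>j. distr M (count_space UNIV) (C P' j))"
    by (rule PiM_cong) (use marg in auto)
  then show ?thesis using prod[OF P] prod[OF P'] by (simp add: C_def)
qed

text \<open>Poisson processes are specified by counts on disjoint sets, while an intersection-stable
  generator involves overlapping ones; each count is a sum of counts on disjoint atoms.\<close>

lemma poisson_counts_eq:
  fixes E :: "'b::euclidean_space set"
  assumes M: "prob_space M" and E: "E \<in> sets borel"
    and P: "poisson_point_process M E c P" and P': "poisson_point_process M E c P'"
    and B: "\<And>k. k < n \<Longrightarrow> B k \<in> sets borel \<and> bounded (B k)"
  shows "measure M {\<omega>\<in>space M. \<forall>k<n. card (P \<omega> \<inter> B k) = m k}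
    = measure M {\<omega>\<in>space M. \<forall>k<n::nat. card (P' \<omega> \<inter> B k) = m k}"
proof (cases "n = 0")
  case False
  \<comment> \<open>The empty index set is left out: its atom, the part of \<open>E\<close> outside
    all \<open>B k\<close>, may be unbounded.\<close>
  define I where "I = Pow {..<n} - {{}}"
  define N where "N = card I"
  have "finite I" by (simp add: I_def)
  then obtain e where e: "bij_betw e {..<N} I"
    using ex_bij_betw_nat_finite[of I] by (auto simp: N_def lessThan_atLeast0)
  have "{0} \<in> I" using False by (auto simp: I_def)
  then have N: "0 < N" using \<open>finite I\<close> by (auto simp: N_def card_gt_0_iff)
  \<comment> \<open>the atoms of the algebra generated by the sets \<open>B k\<close>, which may overlap\<close>
  define F where "F j = {x\<in>E. \<forall>k<n. x \<in> B k \<longleftrightarrow> k \<in> e j}" for j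
  have ej: "e j \<in> I" if "j < N" for j using e that by (auto simp: bij_betw_def)
  have F: "F j \<in> sets borel \<and> bounded (F j) \<and> F j \<subseteq> E" if j: "j < N" for j
  proof (intro conjI)
    have "F j = E \<inter> (\<Inter>k\<in>{..<n}. if k \<in> e j then B k else - B k)"
      by (auto simp: F_def split: if_splits)
    moreover have "(\<Inter>k\<in>{..<n}. if k \<in> e j then B k else - B k) \<in> sets borel"
      using False B by (intro sets.finite_INT) (auto intro: borel_comp)
    ultimately show "F j \<in> sets borel" using E by auto
    obtain k where "k \<in> e j" "k < n" using ej[OF j] by (auto simp: I_def)
    then have "F j \<subseteq> B k" by (auto simp: F_def)
    then show "bounded (F j)" using B[OF \<open>k < n\<close>] bounded_subset by blast
  qed (auto simp: F_def)
  have disj: "disjoint_family_on F {..<N}"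
    unfolding disjoint_family_on_def
  proof (intro ballI impI)
    fix i j assume ij: "i \<in> {..<N}" "j \<in> {..<N}" "i \<noteq> j"
    then have "e i \<noteq> e j" using e by (auto simp: bij_betw_def inj_on_def)
    moreover have "e i \<subseteq> {..<n}" "e j \<subseteq> {..<n}" using ej ij by (auto simp: I_def)
    ultimately show "F i \<inter> F j = {}" unfolding F_def by blast
  qed
  have count: "card (Q \<inter> B k) = (\<Sum>j\<in>{j\<in>{..<N}. k \<in> e j}. card (Q \<inter> F j))" if Q: "Q \<in> point_space E" and k: "k < n" for Q k
  proof -
    have "Q \<inter> B k = (\<Union>j\<in>{j\<in>{..<N}. k \<in> e j}. Q \<inter> F j)"
    proof
      show "(\<Union>j\<in>{j\<in>{..<N}. k \<in> e j}. Q \<inter> F j) \<subseteq> Q \<inter> B k" using k by (auto simp: F_def)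
      show "Q \<inter> B k \<subseteq> (\<Union>j\<in>{j\<in>{..<N}. k \<in> e j}. Q \<inter> F j)"
      proof
        fix x assume x: "x \<in> Q \<inter> B k"
        have "{l. l < n \<and> x \<in> B l} \<in> I" using x k by (auto simp: I_def)
        then obtain j where j: "j < N" "e j = {l. l < n \<and> x \<in> B l}" using e by (force simp: bij_betw_def)
        have "x \<in> F j" using x Q j by (auto simp: F_def point_space_def)
        then show "x \<in> (\<Union>j\<in>{j\<in>{..<N}. k \<in> e j}. Q \<inter> F j)" using x j k by auto
      qed
    qed
    also have "card \<dots> = (\<Sum>j\<in>{j\<in>{..<N}. k \<in> e j}. card (Q \<inter> F j))"
    proof (intro card_UN_disjoint ballI impI)
      show "finite (Q \<inter> F j)" if "j \<in> {j\<in>{..<N}. k \<in> e j}" for j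
        using Q F that by (auto simp: point_space_def locally_finite_def)
      show "(Q \<inter> F i) \<inter> (Q \<inter> F j) = {}" if "i \<in> {j\<in>{..<N}. k \<in> e j}" "j \<in> {j\<in>{..<N}. k \<in> e j}" "i \<noteq> j" for i j
        using disjoint_family_onD[OF disj, of i j] that by auto
    qed simp
    finally show ?thesis .
  qed
  define S where "S = {v\<in>space (Pi\<^sub>M {..<N} (\<lambda>_. count_space (UNIV :: nat set))). \<forall>k<n. (\<Sum>j\<in>{j\<in>{..<N}. k \<in> e j}. v j) = m k}"
  have S: "S \<in> sets (Pi\<^sub>M {..<N} (\<lambda>_. count_space UNIV))"
    unfolding S_def by measurable
  have "measure M {\<omega>\<in>space M. \<forall>k<n. card (Q \<omega> \<inter> B k) = m k} =
    measure (distr M (Pi\<^sub>M {..<N} (\<lambda>_. count_space UNIV)) (\<lambda>\<omega>. \<lambda>j\<in>{..<N}. card (Q \<omega> \<inter> F j))) S"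
    if Q: "poisson_point_process M E c Q" for Q
  proof -
    have "(\<lambda>\<omega>. \<lambda>j\<in>{..<N}. card (Q \<omega> \<inter> F j)) \<in> measurable M (Pi\<^sub>M {..<N} (\<lambda>_. count_space UNIV))"
      using F poisson_point_processD(2)[OF Q E] by (intro measurable_restrict) auto
    then have "measure (distr M (Pi\<^sub>M {..<N} (\<lambda>_. count_space UNIV)) (\<lambda>\<omega>. \<lambda>j\<in>{..<N}. card (Q \<omega> \<inter> F j))) S
      = measure M ((\<lambda>\<omega>. \<lambda>j\<in>{..<N}. card (Q \<omega> \<inter> F j)) -` S \<inter> space M)"
      using S by (intro measure_distr)
    also have "(\<lambda>\<omega>. \<lambda>j\<in>{..<N}. card (Q \<omega> \<inter> F j)) -` S \<inter> space M = {\<omega>\<in>space M. \<forall>k<n. card (Q \<omega> \<inter> B k) = m k}"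
      using count[OF poisson_point_processD(1)[OF Q E]] by (auto simp: S_def space_PiM)
    finally show ?thesis by (rule sym)
  qed
  from this[OF P] this[OF P'] poisson_disjoint_counts_distr[OF M P P' F disj N] show ?thesis by simp
qed simp

text \<open>Conditions on single counts are not closed under intersection, but finite conjunctions
  of them are; two conjunctions are merged by concatenating their sequences of sets.\<close>

lemma distr_point_measure_eqI:
  assumes M: "prob_space M"
    and P: "P \<in> measurable M (point_measure E)" and P': "P' \<in> measurable M (point_measure E)"
    and eq: "\<And>n B m. (\<And>k. k < n \<Longrightarrow> B k \<in> sets borel \<and> bounded (B k)) \<Longrightarrow>
      measure M {\<omega>\<in>space M. \<forall>k<n. card (P \<omega> \<inter> B k) = m k}
      = measure M {\<omega>\<in>space M. \<forall>k<n::nat. card (P' \<omega> \<inter> B k) = m k}"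
  shows "distr M (point_measure E) P = distr M (point_measure E) P'"
proof -
  interpret prob_space M by (rule M)
  define Z where "Z n B m = {Q\<in>point_space E. \<forall>k<n::nat. card (Q \<inter> B k) = (m k :: nat)}" for n B m
  define G where "G = {Z n B m | n B m. \<forall>k<n. B k \<in> sets borel \<and> bounded (B k)}"
  have Z: "Z n B m \<in> sets (point_measure E)" if "\<forall>k<n. B k \<in> sets borel \<and> bounded (B k)" for n B m
  proof -
    have "Measurable.pred (point_measure E) (\<lambda>Q. card (Q \<inter> B k) = m k)" if "k < n" for k
      using count_measurable_point_measure[of "B k" E] \<open>\<forall>k<n. _\<close> that by (auto simp: measurable_nat_iff_pred)
    then have "Measurable.pred (point_measure E) (\<lambda>Q. \<forall>k\<in>{..<n}. card (Q \<inter> B k) = m k)"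
      by (intro pred_intros_finite) auto
    moreover have "Z n B m = {Q\<in>space (point_measure E). \<forall>k\<in>{..<n}. card (Q \<inter> B k) = m k}"
      by (auto simp: Z_def space_point_measure)
    ultimately show ?thesis unfolding pred_def by metis
  qed
  show ?thesis
  proof (rule measure_eqI_generator_eq[where E=G and \<Omega>="point_space E" and A="\<lambda>_. point_space E"])
    show "Int_stable G"
    proof (rule Int_stableI)
      fix X Y assume "X \<in> G" "Y \<in> G"
      then obtain n B m n' B' m' where X: "X = Z n B m" "\<forall>k<n. B k \<in> sets borel \<and> bounded (B k)"
        and Y: "Y = Z n' B' m'" "\<forall>k<n'. B' k \<in> sets borel \<and> bounded (B' k)" unfolding G_def by blast
      define B2 where "B2 k = (if k < n then B k else B' (k - n))" for k
      define m2 where "m2 k = (if k < n then m k else m' (k - n))" for k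
      have "X \<inter> Y = Z (n + n') B2 m2"
      proof -
        have "(\<forall>k<n + n'. card (Q \<inter> B2 k) = m2 k) \<longleftrightarrow>
          (\<forall>k<n. card (Q \<inter> B k) = m k) \<and> (\<forall>k<n'. card (Q \<inter> B' k) = m' k)" for Q
        proof (intro iffI conjI allI impI)
          fix k assume *: "\<forall>k<n + n'. card (Q \<inter> B2 k) = m2 k"
          show "card (Q \<inter> B k) = m k" if "k < n" using *[rule_format, of k] that by (simp add: B2_def m2_def)
          show "card (Q \<inter> B' k) = m' k" if "k < n'" using *[rule_format, of "n + k"] that by (simp add: B2_def m2_def)
        next
          fix k assume "(\<forall>k<n. card (Q \<inter> B k) = m k) \<and> (\<forall>k<n'. card (Q \<inter> B' k) = m' k)" "k < n + n'"
          then show "card (Q \<inter> B2 k) = m2 k" by (auto simp: B2_def m2_def)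
        qed
        then show ?thesis unfolding X Y Z_def by auto
      qed
      moreover have "\<forall>k<n + n'. B2 k \<in> sets borel \<and> bounded (B2 k)" using X(2) Y(2) by (auto simp: B2_def)
      ultimately show "X \<inter> Y \<in> G" unfolding G_def by blast
    qed
    show "G \<subseteq> Pow (point_space E)" by (auto simp: G_def Z_def)
    show "sets (distr M (point_measure E) P) = sigma_sets (point_space E) G"
      "sets (distr M (point_measure E) P') = sigma_sets (point_space E) G"
    proof -
      have "sigma_sets (point_space E) (point_events E) \<subseteq> sigma_sets (point_space E) G"
      proof (rule sigma_sets_mono')
        show "point_events E \<subseteq> G"
        proof
          fix X assume "X \<in> point_events E"
          then obtain B k where "X = {Q\<in>point_space E. card (Q \<inter> B) = k}" "B \<in> sets borel" "bounded B"
            by (auto simp: point_events_def)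
          then have "X = Z 1 (\<lambda>_. B) (\<lambda>_. k) \<and> (\<forall>k<1::nat. B \<in> sets borel \<and> bounded B)" by (auto simp: Z_def)
          then show "X \<in> G" unfolding G_def by blast
        qed
      qed
      moreover have "sigma_sets (point_space E) G \<subseteq> sets (point_measure E)"
        using Z by (intro sets.sigma_sets_subset'[where a=G]) (auto simp: G_def space_point_measure[symmetric])
      ultimately show "sets (distr M (point_measure E) P) = sigma_sets (point_space E) G"
        "sets (distr M (point_measure E) P') = sigma_sets (point_space E) G"
        by (auto simp: sets_point_measure)
    qed
    fix X assume "X \<in> G"
    then obtain n B m where X: "X = Z n B m" "\<forall>k<n. B k \<in> sets borel \<and> bounded (B k)" unfolding G_def by blast
    have "emeasure (distr M (point_measure E) R) X = measure M {\<omega>\<in>space M. \<forall>k<n. card (R \<omega> \<inter> B k) = m k}"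
      if R: "R \<in> measurable M (point_measure E)" for R
    proof -
      have "R -` X \<inter> space M = {\<omega>\<in>space M. \<forall>k<n. card (R \<omega> \<inter> B k) = m k}"
        using measurable_space[OF R] by (auto simp: X Z_def space_point_measure)
      then show ?thesis using emeasure_distr[OF R, of X] Z[OF X(2)] by (simp add: X(1) emeasure_eq_measure)
    qed
    then show "emeasure (distr M (point_measure E) P) X = emeasure (distr M (point_measure E) P') X"
      using eq[of n B m] X(2) P P' by simp
  next
    have "point_space E = Z 0 (\<lambda>_. {}) (\<lambda>_. 0)" by (simp add: Z_def)
    then show "range (\<lambda>_::nat. point_space E) \<subseteq> G" unfolding G_def by blast
    show "emeasure (distr M (point_measure E) P) (point_space E) \<noteq> \<infinity>" for i :: nat
      using P by (simp add: emeasure_distr space_point_measure[symmetric] emeasure_eq_measure)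
  qed auto
qed

definition driving_config ::
  "('i \<Rightarrow> 'w \<Rightarrow> real set) \<Rightarrow> ('i \<Rightarrow> 'w \<Rightarrow> (real \<times> real) set) \<Rightarrow> 'i + 'i \<Rightarrow> 'w \<Rightarrow> (real \<times> real) set" where
  "driving_config A D = case_sum (\<lambda>i \<omega>. A i \<omega> \<times> {0}) D"

lemma strip_borel: "strip \<in> sets borel"
  by (intro borel_closed closed_Times) auto

lemma section_borel_bounded:
  fixes B :: "(real \<times> real) set"
  assumes "B \<in> sets borel" "bounded B"
  shows "{t. (t, 0) \<in> B} \<in> sets borel" "bounded {t. (t, 0) \<in> B}"
proof -
  have "(\<lambda>t :: real. (t, 0 :: real)) -` B \<inter> space borel \<in> sets borel"
    by (rule measurable_sets[OF _ assms(1)]) (intro borel_measurable_continuous_onI continuous_intros)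
  then show "{t. (t, 0) \<in> B} \<in> sets borel" by (simp add: vimage_def)
  have "{t. (t, 0) \<in> B} \<subseteq> fst ` B" by force
  then show "bounded {t. (t, 0) \<in> B}" using bounded_fst[OF assms(2)] bounded_subset by blast
qed

lemma card_times_singleton_Int: "card (P \<times> {0 :: real} \<inter> B) = card (P \<inter> {t. (t, 0) \<in> B})"
proof -
  have "P \<times> {0} \<inter> B = (\<lambda>t. (t, 0)) ` (P \<inter> {t. (t, 0) \<in> B})" by auto
  then show ?thesis by (simp add: card_image inj_on_def)
qed

context
  fixes M :: "'w measure" and lam :: real
    and A :: "'i::ab_group_add \<Rightarrow> 'w \<Rightarrow> real set" and D :: "'i \<Rightarrow> 'w \<Rightarrow> (real \<times> real) set"
  assumes driving: "driving_processes M lam A D"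
begin

interpretation prob_space M using driving by (simp add: driving_processes_def)

lemma A_poisson: "poisson_point_process M UNIV lam (A i)"
  and D_poisson: "poisson_point_process M strip 1 (D i)"
  using driving by (simp_all add: driving_processes_def)

lemma driving_config_events:
  assumes "B \<in> sets borel" "bounded B"
  shows "{\<omega>\<in>space M. card (driving_config A D k \<omega> \<inter> B) = m}
    \<in> case_sum (\<lambda>i. point_process_events M (A i)) (\<lambda>i. point_process_events M (D i)) k"
proof (cases k)
  case (Inl i)
  have "{\<omega>\<in>space M. card (A i \<omega> \<inter> {t. (t, 0) \<in> B}) = m} \<in> point_process_events M (A i)"
    unfolding point_process_events_def using section_borel_bounded[OF assms]
    by (intro sigma_sets.Basic) blast
  then show ?thesis by (simp add: Inl driving_config_def card_times_singleton_Int)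
next
  case (Inr i)
  have "{\<omega>\<in>space M. card (D i \<omega> \<inter> B) = m} \<in> point_process_events M (D i)"
    unfolding point_process_events_def using assms by (intro sigma_sets.Basic) blast
  then show ?thesis by (simp add: Inr driving_config_def)
qed

lemma driving_config_space: "\<omega> \<in> space M \<Longrightarrow> driving_config A D k \<omega> \<in> point_space strip"
proof (cases k)
  case (Inl i)
  assume "\<omega> \<in> space M"
  then have "locally_finite (A i \<omega>)"
    using poisson_point_processD(1)[OF A_poisson] by (simp add: point_space_def)
  have "finite (A i \<omega> \<times> {0 :: real} \<inter> B)" if "bounded B" for B
  proof -
    have "finite (A i \<omega> \<inter> fst ` B)"
      using \<open>locally_finite (A i \<omega>)\<close> bounded_fst[OF that] by (simp add: locally_finite_def)
    then have "finite ((A i \<omega> \<inter> fst ` B) \<times> {0 :: real})" by simp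
    then show ?thesis by (rule rev_finite_subset) force
  qed
  then show ?thesis by (auto simp: Inl driving_config_def point_space_def locally_finite_def)
next
  case (Inr i)
  assume "\<omega> \<in> space M"
  then show ?thesis using poisson_point_processD(1)[OF D_poisson strip_borel]
    by (simp add: Inr driving_config_def)
qed

lemma driving_config_count_measurable:
  assumes "B \<in> sets borel" "bounded B"
  shows "(\<lambda>\<omega>. card (driving_config A D k \<omega> \<inter> B)) \<in> measurable M (count_space UNIV)"
proof (cases k)
  case (Inl i)
  then show ?thesis using poisson_point_processD(2)[OF A_poisson _ section_borel_bounded[OF assms]]
    by (simp add: driving_config_def card_times_singleton_Int)
next
  case (Inr i)
  then show ?thesis using poisson_point_processD(2)[OF D_poisson strip_borel assms]
    by (simp add: driving_config_def)
qed

lemma driving_config_measurable: "driving_config A D k \<in> measurable M (point_measure strip)"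
  by (rule measurable_point_measureI[OF driving_config_space driving_config_count_measurable])

text \<open>Preimages under the encoded process form a \<open>\<sigma>\<close>-algebra generated by
  count events of the original process, so they stay inside the independent families, and
  independence passes to smaller families.\<close>

lemma driving_config_indep: "indep_vars (\<lambda>_. point_measure strip) (driving_config A D) UNIV"
  unfolding indep_vars_def2
proof (intro conjI ballI driving_config_measurable)
  let ?E = "case_sum (\<lambda>i. point_process_events M (A i)) (\<lambda>i. point_process_events M (D i))"
  have "indep_sets ?E UNIV" using driving by (simp add: driving_processes_def)
  then show "indep_sets (\<lambda>k. {driving_config A D k -` X \<inter> space M | X. X \<in> sets (point_measure strip)}) UNIV"
  proof (rule indep_sets_mono_sets)
    fix k
    have E: "\<exists>G. ?E k = sigma_sets (space M) G"
      by (cases k) (auto simp: point_process_events_def)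
    then obtain G where G: "?E k = sigma_sets (space M) G" by blast
    have "driving_config A D k -` X \<inter> space M \<in> ?E k"
      if "X \<in> sigma_sets (point_space strip) (point_events strip)" for X
      using that
    proof induction
      case (Basic X)
      then obtain B m where X: "X = {Q\<in>point_space strip. card (Q \<inter> B) = m}" "B \<in> sets borel" "bounded B"
        by (auto simp: point_events_def)
      have "driving_config A D k -` X \<inter> space M = {\<omega>\<in>space M. card (driving_config A D k \<omega> \<inter> B) = m}"
        using driving_config_space by (auto simp: X(1))
      then show ?case using driving_config_events[OF X(2,3)] by simp
    next
      case Empty then show ?case unfolding G by (simp add: sigma_sets.Empty)
    next
      case (Compl X)
      have "driving_config A D k -` (point_space strip - X) \<inter> space M
        = space M - (driving_config A D k -` X \<inter> space M)"
        using driving_config_space by auto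
      then show ?case using Compl.IH unfolding G by (simp add: sigma_sets.Compl)
    next
      case (Union X)
      have "driving_config A D k -` (\<Union>n. X n) \<inter> space M = (\<Union>n. driving_config A D k -` X n \<inter> space M)" by auto
      moreover have "(\<Union>n. driving_config A D k -` X n \<inter> space M) \<in> ?E k"
        using Union.IH unfolding G by (rule sigma_sets.Union)
      ultimately show ?case by simp
    qed
    then show "{driving_config A D k -` X \<inter> space M | X. X \<in> sets (point_measure strip)} \<subseteq> ?E k"
      by (auto simp: sets_point_measure)
  qed
qed

text \<open>\<open>relabel\<close> never mixes the two copies of the sites, so arrivals are compared
  with arrivals of the same intensity and departures with departures.\<close>

lemma driving_config_distr_relabel:
  "distr M (point_measure strip) (driving_config A D (relabel j k))
    = distr M (point_measure strip) (driving_config A D k)"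
proof (rule distr_point_measure_eqI[OF prob_space_axioms driving_config_measurable driving_config_measurable])
  fix n :: nat and B :: "nat \<Rightarrow> (real \<times> real) set" and m :: "nat \<Rightarrow> nat"
  assume B: "\<And>l. l < n \<Longrightarrow> B l \<in> sets borel \<and> bounded (B l)"
  show "measure M {\<omega>\<in>space M. \<forall>l<n. card (driving_config A D (relabel j k) \<omega> \<inter> B l) = m l}
    = measure M {\<omega>\<in>space M. \<forall>l<n. card (driving_config A D k \<omega> \<inter> B l) = m l}"
  proof (cases k)
    case (Inl i)
    show ?thesis unfolding Inl relabel_def driving_config_def
      using poisson_counts_eq[OF prob_space_axioms _ A_poisson A_poisson, of n "\<lambda>l. {t. (t, 0) \<in> B l}" "i + j" m i]
        section_borel_bounded B by (simp add: card_times_singleton_Int)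
  next
    case (Inr i)
    show ?thesis unfolding Inr relabel_def driving_config_def
      using poisson_counts_eq[OF prob_space_axioms strip_borel D_poisson D_poisson, of n B "i + j" m i] B by simp
  qed
qed

lemma distr_driving_config:
  "distr M config_measure (\<lambda>\<omega> k. driving_config A D k \<omega>)
    = Pi\<^sub>M UNIV (\<lambda>k. distr M (point_measure strip) (driving_config A D k))"
  using driving_config_indep indep_vars_iff_distr_eq_PiM[where I=UNIV and M'="\<lambda>_. point_measure strip" and X="driving_config A D"]
    driving_config_measurable by (simp add: restrict_UNIV)

end

lemma product_relabelling_driving_config:
  fixes A :: "int ^ 'd \<Rightarrow> 'w \<Rightarrow> real set"
  assumes driving: "driving_processes M lam A D"
  shows "product_relabelling (\<lambda>k. distr M (point_measure strip) (driving_config A D k)) relabel"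
proof -
  interpret prob_space M using driving by (simp add: driving_processes_def)
  have P: "prob_space (distr M (point_measure strip) (driving_config A D k))" for k
    by (rule prob_space_distr[OF driving_config_measurable[OF driving]])
  interpret product_prob_space "\<lambda>k. distr M (point_measure strip) (driving_config A D k)" UNIV
    using P by (simp add: product_prob_space_def product_prob_space_axioms_def product_sigma_finite_def
        prob_space_imp_sigma_finite)
  show ?thesis
  proof
    show "relabel (i + j) k = relabel j (relabel i k)" for i j and k :: "int ^ 'd + int ^ 'd"
      by (cases k) (simp_all add: relabel_def add.assoc)
    show "inj (relabel i)" for i :: "int ^ 'd" unfolding relabel_def by (intro sum.inj_map) (auto simp: inj_def)
    show "inj (\<lambda>i. relabel i k)" for k :: "int ^ 'd + int ^ 'd"
      by (cases k) (auto simp: relabel_def inj_def)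
  qed (rule driving_config_distr_relabel[OF driving])
qed

text \<open>All randomness enters through the encoded driving processes, whose joint law is a
  product by independence. Decoding recovers \<open>A\<close> and \<open>D\<close> exactly, so the
  limit can be studied on the product space.\<close>

lemma minimal_stationary_distribution_eq:
  fixes A :: "'i::{ab_group_add, countable} \<Rightarrow> 'w \<Rightarrow> real set"
  assumes driving: "driving_processes M lam A D"
  shows "minimal_stationary_distribution M a A D s
    = distr (Pi\<^sub>M UNIV (\<lambda>k. distr M (point_measure strip) (driving_config A D k))) borel (cftp a s)"
proof -
  have "(\<lambda>\<omega> k. driving_config A D k \<omega>) \<in> measurable M config_measure"
    using driving_config_measurable[OF driving] driving_config_space[OF driving]
    by (intro measurable_PiM_single') (auto simp: space_point_measure)
  then have "distr M borel (cftp a s \<circ> (\<lambda>\<omega> k. driving_config A D k \<omega>))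
    = distr (distr M config_measure (\<lambda>\<omega> k. driving_config A D k \<omega>)) borel (cftp a s)"
    using measurable_cftp by (subst distr_distr) auto
  moreover have "arrivals (\<lambda>k. driving_config A D k \<omega>) = (\<lambda>i. A i \<omega>)"
    "departures (\<lambda>k. driving_config A D k \<omega>) = (\<lambda>i. D i \<omega>)" for \<omega>
    by (auto simp: arrivals_def departures_def driving_config_def fun_eq_iff image_iff)
  ultimately show ?thesis
    by (simp add: minimal_stationary_distribution_def distr_driving_config[OF driving] cftp_def[abs_def] o_def)
qed

lemma translate_measurable: "translate i \<in> borel_measurable (borel :: ('i::{ab_group_add, countable} \<Rightarrow> nat) measure)"
  unfolding translate_def
  by (intro borel_measurable_continuous_onI continuous_on_coordinatewise_then_product)
    (auto intro: continuous_intros)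

section \<open>Transfer to the minimal stationary distribution\<close>

theorem corollary2p5:
  fixes M :: "'w measure"
    and a :: "(int ^ 'd) \<Rightarrow> real"
    and A :: "(int ^ 'd) \<Rightarrow> 'w \<Rightarrow> real set"
    and D :: "(int ^ 'd) \<Rightarrow> 'w \<Rightarrow> (real \<times> real) set"
    and lam s :: real
    and \<mu> :: "((int ^ 'd) \<Rightarrow> nat) measure"
    and f :: "((int ^ 'd) \<Rightarrow> nat) \<Rightarrow> real"
  assumes "interference_sequence a"
    and "0 \<le> lam" and "lam < 1 / (\<Sum>\<^sub>\<infinity>j. a j)"
    and "driving_processes M lam A D"
    and "\<mu> = minimal_stationary_distribution M a A D s"
    and "integrable \<mu> f"
  shows
    "(\<forall>F. folner_sequence F \<longrightarrow>
        (\<forall>r. integrable \<mu> (spatial_average (F r) f)) \<and>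
        (\<lambda>r. LINT x|\<mu>. \<bar>spatial_average (F r) f x - (LINT y|\<mu>. f y)\<bar>) \<longlonglongrightarrow> 0) \<and>
     (\<forall>F. folner_sequence F \<and> tempered F \<longrightarrow>
        (AE x in \<mu>. (\<lambda>r. spatial_average (F r) f x) \<longlonglongrightarrow> (LINT y|\<mu>. f y))) \<and>
     (\<forall>B :: nat \<Rightarrow> (int ^ 'd) set. exhausting_boxes B \<longrightarrow> folner_sequence B \<and> tempered B)"
proof -
  define \<nu> where "\<nu> k = distr M (point_measure strip) (driving_config A D k)" for k
  interpret product_relabelling \<nu> relabel
    unfolding \<nu>_def by (rule product_relabelling_driving_config[OF assms(4)])
  have sets_\<Omega>: "sets \<Omega> = sets config_measure" by (rule sets_PiM_cong) (auto simp: \<nu>_def)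
  have space_\<Omega>: "space \<Omega> = space config_measure" by (rule sets_eq_imp_space_eq[OF sets_\<Omega>])
  have \<Phi> [measurable]: "cftp a s \<in> borel_measurable \<Omega>"
    using measurable_cftp measurable_cong_sets[OF sets_\<Omega> refl] by blast
  have \<mu>: "\<mu> = distr \<Omega> borel (cftp a s)"
    unfolding assms(5) minimal_stationary_distribution_eq[OF assms(4)] \<nu>_def ..
  have f [measurable]: "f \<in> borel_measurable borel" using assms(6) unfolding \<mu> by simp
  define g where "g = (\<lambda>c. f (cftp a s c))"
  have g: "integrable \<Omega> g" using assms(6) unfolding \<mu> g_def by (simp add: integrable_distr_eq)
  have int: "(LINT y|\<mu>. f y) = (LINT c|\<Omega>. g c)" unfolding \<mu> g_def by (rule integral_distr) simp_all
  \<comment> \<open>Equivariance holds at every configuration and not only almost surely, so spatial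
    averages over the queues are exactly orbit averages of \<open>g\<close>.\<close>
  have avg_eq: "spatial_average F f (cftp a s c) = shift.avg F g c" if "c \<in> space \<Omega>" for F c
  proof -
    have "cftp a s (\<lambda>k. c (relabel i k)) = translate i (cftp a s c)" for i
      using that shift.T_space[OF that, of i] unfolding space_\<Omega> by (rule cftp_relabel)
    then show ?thesis by (simp add: spatial_average_def shift.avg_def g_def)
  qed
  have avg_m [measurable]: "spatial_average F f \<in> borel_measurable borel" for F
    unfolding spatial_average_def
    by (intro borel_measurable_times borel_measurable_const borel_measurable_sum
        measurable_compose[OF translate_measurable f])
  have 1: "integrable \<mu> (spatial_average (F r) f)" for F :: "nat \<Rightarrow> (int ^ 'd) set" and r
  proof -
    have "integrable \<Omega> (\<lambda>c. spatial_average (F r) f (cftp a s c))"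
      using shift.integrable_avg[OF g, of "F r"] avg_eq by (simp cong: Bochner_Integration.integrable_cong)
    then show ?thesis unfolding \<mu> by (simp add: integrable_distr_eq)
  qed
  have mean: "shift.mean_convergent F h" if "folner_sequence F" "integrable \<Omega> h" for F h
    by (rule mean_ergodic[of F]) (use that folner_sequenceD(1,2)[OF that(1)] folner_card_at_top[OF that(1)] in auto)
  have 2: "(\<lambda>r. LINT x|\<mu>. \<bar>spatial_average (F r) f x - (LINT y|\<mu>. f y)\<bar>) \<longlonglongrightarrow> 0"
    if F: "folner_sequence F" for F :: "nat \<Rightarrow> (int ^ 'd) set"
  proof -
    have "(LINT x|\<mu>. \<bar>spatial_average (F r) f x - (LINT y|\<mu>. f y)\<bar>)
      = (LINT c|\<Omega>. \<bar>shift.avg (F r) g c - (LINT c|\<Omega>. g c)\<bar>)" for r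
    proof -
      have "(LINT x|\<mu>. \<bar>spatial_average (F r) f x - (LINT y|\<mu>. f y)\<bar>)
        = (LINT c|\<Omega>. \<bar>spatial_average (F r) f (cftp a s c) - (LINT c|\<Omega>. g c)\<bar>)"
        unfolding int unfolding \<mu> by (rule integral_distr) measurable
      also have "\<dots> = (LINT c|\<Omega>. \<bar>shift.avg (F r) g c - (LINT c|\<Omega>. g c)\<bar>)"
        using avg_eq by (intro Bochner_Integration.integral_cong) auto
      finally show ?thesis .
    qed
    then show ?thesis using mean[OF F g] by (simp add: shift.mean_convergent_def)
  qed
  have 3: "AE x in \<mu>. (\<lambda>r. spatial_average (F r) f x) \<longlonglongrightarrow> (LINT y|\<mu>. f y)"
    if F: "folner_sequence F" "tempered F" for F :: "nat \<Rightarrow> (int ^ 'd) set"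
  proof -
    let ?L = "LINT y|\<mu>. f y"
    \<comment> \<open>Transferring an almost sure statement along \<open>cftp a s\<close> requires
      the set of convergence to be Borel; the tolerances \<open>1 / Suc m\<close> express it by
      countable quantifiers.\<close>
    have lim_iff: "u \<longlonglongrightarrow> l \<longleftrightarrow> (\<forall>m::nat. \<exists>N. \<forall>n\<ge>N. \<bar>u n - l\<bar> < 1 / real (Suc m))" for u :: "nat \<Rightarrow> real" and l
    proof
      assume R: "\<forall>m::nat. \<exists>N. \<forall>n\<ge>N. \<bar>u n - l\<bar> < 1 / real (Suc m)"
      show "u \<longlonglongrightarrow> l"
      proof (rule LIMSEQ_I)
        fix e :: real assume "0 < e"
        then obtain m where "1 / real (Suc m) < e" by (rule nat_approx_posE)
        then show "\<exists>N. \<forall>n\<ge>N. norm (u n - l) < e" using R[rule_format, of m] by (metis less_trans real_norm_def)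
      qed
    next
      assume "u \<longlonglongrightarrow> l"
      then show "\<forall>m::nat. \<exists>N. \<forall>n\<ge>N. \<bar>u n - l\<bar> < 1 / real (Suc m)"
        unfolding LIMSEQ_iff real_norm_def by simp
    qed
    have "AE c in \<Omega>. (\<lambda>r. shift.avg (F r) g c) \<longlonglongrightarrow> ?L"
      unfolding int
    proof (rule shift.pointwise_ergodic[OF F g])
      fix b :: "_ \<Rightarrow> real" and B assume b: "b \<in> borel_measurable \<Omega>" "\<And>x. \<bar>b x\<bar> \<le> B"
      then have "integrable \<Omega> b" by (intro P.integrable_const_bound[of _ B]) auto
      from mean[OF F(1) this] show "(\<lambda>r. LINT x|\<Omega>. \<bar>shift.avg (F r) b x - (LINT y|\<Omega>. b y)\<bar>) \<longlonglongrightarrow> 0"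
        by (simp add: shift.mean_convergent_def)
    qed
    then have "AE c in \<Omega>. (\<lambda>r. spatial_average (F r) f (cftp a s c)) \<longlonglongrightarrow> ?L"
      by (rule AE_mp) (auto simp: avg_eq intro!: AE_I2)
    moreover have "{x\<in>space borel. (\<lambda>r. spatial_average (F r) f x) \<longlonglongrightarrow> ?L} \<in> sets borel"
      unfolding lim_iff by measurable
    ultimately show ?thesis by (subst \<mu>, subst AE_distr_iff[OF \<Phi>]) simp_all
  qed
  show ?thesis
    using 1 2 3 exhausting_boxes_imp_folner_sequence exhausting_boxes_imp_tempered by blast
qed

end
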